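(* Let $n\ge3$. For each odd prime $p$ let $f_{R_{p,n+1}}$ be the HK density function of $(R_{p,n+1},\mathbf m)$ (over a perfect field of characteristic $p$). Then the pointwise limit $f^{\infty}_{R_{n+1}}(x):=\lim_{p\to\infty}f_{R_{p,n+1}}(x)$ exists for every $x\in[0,\infty)$, defines a continuous function $[0,\infty)\to[0,\infty)$, and $\int_0^\infty f^{\infty}_{R_{n+1}}(x)\,dx=1+m_{n+1}$. Moreover, if $p\ge 2n-4$ and $n$ is odd, or $p\ge n-2$ and $n$ is even, then $f_{R_{p,n+1}}(x)=f^{\infty}_{R_{n+1}}(x)$ for $x\in[0,\tfrac{n+2}{2}-\tfrac{n-2}{2p}]$, $f_{R_{p,n+1}}(x)\ge f^{\infty}_{R_{n+1}}(x)$ for $x\in[\tfrac{n+2}{2}-\tfrac{n-2}{2p},\tfrac{n+2}{2}+\tfrac{n-2}{2p}]$, and $f_{R_{p,n+1}}(x)=f^{\infty}_{R_{n+1}}(x)$ for $x\in[\tfrac{n+2}{2}+\tfrac{n-2}{2p},\infty)$.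
   Context: $R_{p,n+1}=k[x_0,\dots,x_{n+1}]/(x_0^2+\cdots+x_{n+1}^2)$, standard graded, $k$ a perfect field of characteristic $p$, $\mathbf m=(x_0,\dots,x_{n+1})$, $\mathbf m^{[q]}=(x_0^q,\dots,x_{n+1}^q)$. The HK density function is $f_{R_{p,n+1}}(x)=\lim_{s\to\infty}q^{-n}\dim_k\big(R_{p,n+1}/\mathbf m^{[q]}\big)_{\lfloor xq\rfloor}$, $q=p^s$, for $x\ge 0$; it is a continuous compactly supported function with $\int_0^\infty f_{R_{p,n+1}}=e_{HK}(R_{p,n+1},\mathbf m)$. The numbers $m_j$ are defined by $\sec(x)+\tan(x)=1+\sum_{j\ge1}m_jx^j$ for $|x|<\pi/2$. *)

theory Defs
  imports "HOL-Algebra.Algebra" "HOL-Analysis.Analysis"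
begin

text \<open>Monomials in the variables x_0,...,x_{N-1} are exponent vectors e :: nat => nat
  with e i = 0 for i >= N.  Homogeneous elements of degree d of k[x_0..x_{N-1}] are
  coefficient functions on the (finite) set of degree-d monomials.\<close>

definition mons :: "nat \<Rightarrow> nat \<Rightarrow> (nat \<Rightarrow> nat) set" where
  "mons N d = {e. (\<forall>i. N \<le> i \<longrightarrow> e i = 0) \<and> (\<Sum>i<N. e i) = d}"

definition unitv :: "nat \<Rightarrow> nat \<Rightarrow> nat" where
  "unitv i = (\<lambda>j. if j = i then 1 else 0)"

text \<open>Degree-d part of the ideal (x_0^q,...,x_{N-1}^q, x_0^2+...+x_{N-1}^2) is spanned by
  the products of degree-(d - deg g) monomials with the generators g.\<close>

definition frob_gens :: "('a, 'b) ring_scheme \<Rightarrow> nat \<Rightarrow> nat \<Rightarrow> nat \<Rightarrow> ((nat \<Rightarrow> nat) \<Rightarrow> 'a) set" where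
  "frob_gens K N q d =
     {(\<lambda>m. if m = (\<lambda>j. e j + q * unitv i j) then \<one>\<^bsub>K\<^esub> else \<zero>\<^bsub>K\<^esub>) | e i.
        q \<le> d \<and> e \<in> mons N (d - q) \<and> i < N}"

definition quad_gens :: "('a, 'b) ring_scheme \<Rightarrow> nat \<Rightarrow> nat \<Rightarrow> ((nat \<Rightarrow> nat) \<Rightarrow> 'a) set" where
  "quad_gens K N d =
     {(\<lambda>m. if (\<exists>i<N. m = (\<lambda>j. e j + 2 * unitv i j)) then \<one>\<^bsub>K\<^esub> else \<zero>\<^bsub>K\<^esub>) | e.
        2 \<le> d \<and> e \<in> mons N (d - 2)}"

definition lin_indep :: "('a, 'b) ring_scheme \<Rightarrow> 'c set \<Rightarrow> ('c \<Rightarrow> 'a) set \<Rightarrow> bool" where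
  "lin_indep K M T \<longleftrightarrow>
     (\<forall>c \<in> T \<rightarrow> carrier K.
        (\<forall>m\<in>M. (\<Oplus>\<^bsub>K\<^esub>v\<in>T. c v \<otimes>\<^bsub>K\<^esub> v m) = \<zero>\<^bsub>K\<^esub>) \<longrightarrow> (\<forall>v\<in>T. c v = \<zero>\<^bsub>K\<^esub>))"

definition span_dim :: "('a, 'b) ring_scheme \<Rightarrow> 'c set \<Rightarrow> ('c \<Rightarrow> 'a) set \<Rightarrow> nat" where
  "span_dim K M S = Max {card T | T. T \<subseteq> S \<and> finite T \<and> lin_indep K M T}"

text \<open>dim_K (K[x_0..x_{N-1}]/(Q, x_0^q, ..., x_{N-1}^q))_d\<close>

definition hilb_frob :: "('a, 'b) ring_scheme \<Rightarrow> nat \<Rightarrow> nat \<Rightarrow> nat \<Rightarrow> nat" where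
  "hilb_frob K N q d =
     card (mons N d) - span_dim K (mons N d) (frob_gens K N q d \<union> quad_gens K N d)"

text \<open>HK density function of R_{p,n+1} = K[x_0..x_{n+1}]/(x_0^2+...+x_{n+1}^2):
  f(x) = lim_{s} q^{-n} dim (R/m^[q])_{floor(x q)}, q = p^s.\<close>

definition hk_density :: "('a, 'b) ring_scheme \<Rightarrow> nat \<Rightarrow> nat \<Rightarrow> real \<Rightarrow> real" where
  "hk_density K p n x =
     lim (\<lambda>s. real (hilb_frob K (n + 2) (p ^ s) (nat \<lfloor>x * real (p ^ s)\<rfloor>)) / real (p ^ s) ^ n)"

definition perfect_field_char :: "('a, 'b) ring_scheme \<Rightarrow> nat \<Rightarrow> bool" where
  "perfect_field_char K p \<longleftrightarrow>
     field K \<and> [p] \<cdot>\<^bsub>K\<^esub> \<one>\<^bsub>K\<^esub> = \<zero>\<^bsub>K\<^esub> \<and>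
     (\<forall>y\<in>carrier K. \<exists>x\<in>carrier K. x [^]\<^bsub>K\<^esub> p = y)"

definition sectan_coeff :: "nat \<Rightarrow> real" where
  "sectan_coeff j = (SOME a. \<forall>x::real. \<bar>x\<bar> < pi / 2 \<longrightarrow>
       (\<lambda>i. a (Suc i) * x ^ Suc i) sums (1 / cos x + tan x - 1)) j"

end

theory Submission
  imports Defs "HOL-Number_Theory.Cong" "HOL-Complex_Analysis.Complex_Analysis" "HOL-Decision_Procs.Algebra_Aux"
begin

hide_const (open) Divisibility.prime

text \<open>
  Let \<open>Q = x\<^sub>0\<^sup>2 + \<dots> + x\<^sub>n\<^sub>+\<^sub>1\<^sup>2\<close>, \<open>q = p\<^sup>s\<close> and \<open>N = n + 2\<close>. The algebra \<open>k[x]/(x\<^sub>i\<^sup>q)\<close> has a monomial basis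
  indexed by a box, and \<open>Q\<close> acts on it by a symmetric operator defined over the prime field. Hence the
  dimension of the cokernel of \<open>Q\<close> in degree \<open>d\<close> equals that of its kernel in degree \<open>N(q-1) - d\<close>,
  which gives \<open>f(x) - f(N-x) = 2B(x)\<close> for the density \<open>f\<close>, where \<open>B\<close> is the derivative of the cardinal
  B-spline of order \<open>N\<close>.

  The arithmetic input is that, in low degrees, the kernel of \<open>Q\<close> is the image of \<open>Q\<^sup>q\<^sup>-\<^sup>1\<close> and conversely.
  For \<open>q = p\<close> this follows from the corresponding statement for the linear form
  \<open>\<Sum>\<^sub>i x\<^sub>i\<close> (split exponents by parity), proved by enlarging the box one step at a time
  with the help of a partial derivative. One passes from \<open>q\<close> to \<open>pq\<close> through the components of a polynomial
  along the residues of the exponents modulo \<open>p\<close>, since \<open>Q\<^sup>p = \<Sum>\<^sub>i x\<^sub>i\<^sup>2\<^sup>p\<close> acts componentwise. With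
  \<open>\<epsilon> = (n-2)/(2p)\<close> this yields \<open>f(N-x) = f(x-2)\<close> for \<open>x < N/2 - \<epsilon>\<close>, and \<open>\<ge>\<close> for \<open>x < N/2 + 1 - \<epsilon>\<close>.
  Therefore \<open>f(x) = \<Sum>\<^sub>k 2B(x-2k)\<close> to the left of the window around \<open>N/2\<close>, \<open>f(x) = f(N-2-x)\<close> to the right of
  it, and the analogous inequality holds inside.

  The integral of the limit is a combination of Irwin-Hall distribution functions which satisfies the
  functional and differential equations of the rescaled Euler polynomials; their values at \<open>1/2\<close> and at
  \<open>0\<close> are, up to sign, the coefficients of \<open>sec\<close> and \<open>tan\<close>.
\<close>

text \<open>A polynomial is represented by its coefficient function on exponent vectors, with integer
  coefficients to be read modulo \<open>p\<close>. Then \<open>coord_shift k i\<close> is multiplication by \<open>x\<^sub>i\<^sup>k\<close> and \<open>psum k N\<close>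
  multiplication by \<open>\<Sum>\<^sub>i\<^sub><\<^sub>N x\<^sub>i\<^sup>k\<close>; restricting to a box \<open>m\<^sub>i < b\<^sub>i\<close> is
  reduction modulo the monomials \<open>x\<^sub>i ^ b\<^sub>i\<close>.\<close>

section \<open>Multiplication by power sums\<close>

text \<open>The kernel-image statement covers only low degrees, so existence of the density for
  fixed p needs a separate argument. Restriction to exponents congruent to -1 modulo p in one
  variable embeds a kernel for pq, up to a lower-order term, into at most p^n kernels for q, so the
  normalised Hilbert function is almost decreasing in q. A similar embedding, together with monomial
  counts, bounds its increments. This makes f Lipschitz with a constant independent of p, and that
  uniformity controls f inside the shrinking window as p grows. The half-width (n-2)/(2p) originates
  at q = p: there the property for Q holds if 2(e+2) + (n-2) < Np. Each passage from q to pq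
  multiplies the thresholds by p, so the defect n-2 is only rescaled. The passage closes up only
  when the properties of Q and of Q^(q-1) are carried along together. The shift in f(N-x) = f(x-2)
  has a simple source: the image of Q^(q-1) lies 2(q-1) degrees above its origin.\<close>

definition coord_shift :: "nat \<Rightarrow> nat \<Rightarrow> ((nat \<Rightarrow> nat) \<Rightarrow> int) \<Rightarrow> (nat \<Rightarrow> nat) \<Rightarrow> int" where
  "coord_shift k i f m = (if m i < k then 0 else f (m(i := m i - k)))"

definition psum :: "nat \<Rightarrow> nat \<Rightarrow> ((nat \<Rightarrow> nat) \<Rightarrow> int) \<Rightarrow> (nat \<Rightarrow> nat) \<Rightarrow> int" where
  "psum k N f m = (\<Sum>i<N. coord_shift k i f m)"

definition xbox :: "nat \<Rightarrow> (nat \<Rightarrow> nat) \<Rightarrow> (nat \<Rightarrow> nat) set" where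
  "xbox N b = {m. (\<forall>i<N. m i < b i) \<and> (\<forall>i\<ge>N. m i = 0)}"

definition xdeg :: "nat \<Rightarrow> (nat \<Rightarrow> nat) \<Rightarrow> nat" where
  "xdeg N m = (\<Sum>i<N. m i)"

lemma xdeg_upd_diff: "i < N \<Longrightarrow> k \<le> m i \<Longrightarrow> xdeg N (m(i := m i - k)) + k = xdeg N m"
proof -
  assume i: "i < N" and k: "k \<le> m i"
  have "xdeg N m = m i + (\<Sum>j\<in>{..<N}-{i}. m j)"
    unfolding xdeg_def using i by (simp add: sum.remove[of _ i])
  moreover have "xdeg N (m(i := m i - k)) = (m i - k) + (\<Sum>j\<in>{..<N}-{i}. m j)"
    unfolding xdeg_def using i by (simp add: sum.remove[of _ i])
  ultimately show ?thesis using k by simp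
qed

lemma xdeg_upd_add: "i < N \<Longrightarrow> xdeg N (m(i := m i + k)) = xdeg N m + k"
  using xdeg_upd_diff[of i N k "m(i := m i + k)"] by simp

lemma xbox_upd_diff: "m \<in> xbox N b \<Longrightarrow> m(i := m i - k) \<in> xbox N b"
  unfolding xbox_def by (auto simp: less_imp_diff_less)

lemma xbox_mono: "m \<in> xbox N b \<Longrightarrow> (\<And>i. i < N \<Longrightarrow> b i \<le> b' i) \<Longrightarrow> m \<in> xbox N b'"
  unfolding xbox_def by (auto intro: less_le_trans)

lemma coord_shift_add: "coord_shift k i (\<lambda>m. f m + g m) m = coord_shift k i f m + coord_shift k i g m"
  by (simp add: coord_shift_def)
lemma coord_shift_diff: "coord_shift k i (\<lambda>m. f m - g m) m = coord_shift k i f m - coord_shift k i g m"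
  by (simp add: coord_shift_def)
lemma coord_shift_cmult: "coord_shift k i (\<lambda>m. c * f m) m = c * coord_shift k i f m"
  by (simp add: coord_shift_def)
lemma coord_shift_coord_shift_commute: "coord_shift k i (coord_shift l j f) m = coord_shift l j (coord_shift k i f) m"
  by (auto simp: coord_shift_def fun_upd_twist add.commute)

lemma psum_add: "psum k N (\<lambda>m. f m + g m) = (\<lambda>m. psum k N f m + psum k N g m)"
  by (simp add: psum_def coord_shift_add sum.distrib fun_eq_iff)
lemma psum_diff: "psum k N (\<lambda>m. f m - g m) = (\<lambda>m. psum k N f m - psum k N g m)"
  by (simp add: psum_def coord_shift_diff sum_subtractf fun_eq_iff)
lemma psum_cmult: "psum k N (\<lambda>m. c * f m) = (\<lambda>m. c * psum k N f m)"
  by (simp add: psum_def coord_shift_cmult sum_distrib_left fun_eq_iff)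

lemma psum_pow_add: "(psum k N ^^ n) (\<lambda>m. f m + g m) = (\<lambda>m. (psum k N ^^ n) f m + (psum k N ^^ n) g m)"
  by (induction n) (simp_all add: psum_add)
lemma psum_pow_diff: "(psum k N ^^ n) (\<lambda>m. f m - g m) = (\<lambda>m. (psum k N ^^ n) f m - (psum k N ^^ n) g m)"
  by (induction n) (simp_all add: psum_diff)
lemma psum_pow_cmult: "(psum k N ^^ n) (\<lambda>m. c * f m) = (\<lambda>m. c * (psum k N ^^ n) f m)"
  by (induction n) (simp_all add: psum_cmult)
lemma psum_pow_zero: "(psum k N ^^ n) (\<lambda>m. 0) = (\<lambda>m. 0)"
  using psum_pow_cmult[of n k N 0 "\<lambda>m. 0"] by simp

lemma psum_zero: "psum k N (\<lambda>m. 0) = (\<lambda>m. 0)"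
  using psum_pow_zero[of 1 k N] by simp

lemma coord_shift_sum: "coord_shift k i (\<lambda>m. \<Sum>j\<in>A. f j m) m = (\<Sum>j\<in>A. coord_shift k i (f j) m)"
  by (simp add: coord_shift_def)

lemma coord_shift_psum: "coord_shift k i (psum l N f) = psum l N (coord_shift k i f)"
proof
  fix m
  have "coord_shift k i (psum l N f) m = coord_shift k i (\<lambda>m. \<Sum>j<N. coord_shift l j f m) m"
    by (simp add: psum_def[abs_def])
  also have "\<dots> = (\<Sum>j<N. coord_shift k i (coord_shift l j f) m)" by (rule coord_shift_sum)
  also have "\<dots> = psum l N (coord_shift k i f) m" by (simp add: psum_def coord_shift_coord_shift_commute)
  finally show "coord_shift k i (psum l N f) m = psum l N (coord_shift k i f) m" .
qed

lemma coord_shift_psum_pow: "coord_shift k i ((psum l N ^^ n) f) = (psum l N ^^ n) (coord_shift k i f)"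
  by (induction n) (simp_all add: coord_shift_psum)

text \<open>Lowering an exponent stays in the box, so a value in the box depends only on values in
  the box. This is why functions on all exponent vectors can stand for elements of the quotient by
  the monomials \<open>x_i ^ b_i\<close>. The offset \<open>l\<close> replaces a subtraction of
  degrees.\<close>

lemma psum_dvd_local:
  assumes "\<And>m. m \<in> xbox N b \<Longrightarrow> xdeg N m + l = e \<Longrightarrow> p dvd f m"
    and "m \<in> xbox N b" and "xdeg N m + l = e + k"
  shows "p dvd psum k N f m"
  unfolding psum_def
proof (rule dvd_sum)
  fix i assume "i \<in> {..<N}"
  then show "p dvd coord_shift k i f m"
    using assms(1)[of "m(i := m i - k)"] assms(2,3) xdeg_upd_diff[of i N k m] xbox_upd_diff[of m N b i k]
    by (auto simp: coord_shift_def)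
qed

lemma psum_pow_dvd_local:
  assumes "\<And>m. m \<in> xbox N b \<Longrightarrow> xdeg N m + l = e \<Longrightarrow> p dvd f m"
    and "m \<in> xbox N b" and "xdeg N m + l = e + k * n"
  shows "p dvd (psum k N ^^ n) f m"
  using assms(2,3)
proof (induction n arbitrary: m)
  case 0 then show ?case using assms(1) by simp
next
  case (Suc n)
  have "p dvd psum k N ((psum k N ^^ n) f) m"
    by (rule psum_dvd_local[where b=b and l=l and e="e + k * n"]) (use Suc in auto)
  then show ?case by simp
qed

lemma psum_pow_dvd: "(\<And>m. p dvd f m) \<Longrightarrow> p dvd (psum k N ^^ n) f m"
proof (induction n arbitrary: m)
  case (Suc n)
  then show ?case by (auto simp: psum_def coord_shift_def intro!: dvd_sum)
qed simp

lemma psum_pow_low: "xdeg N m < k * n \<Longrightarrow> (psum k N ^^ n) f m = 0"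
proof (induction n arbitrary: m)
  case (Suc n)
  have "coord_shift k i ((psum k N ^^ n) f) m = 0" if "i < N" for i
  proof (cases "k \<le> m i")
    case True
    then have "xdeg N (m(i := m i - k)) < k * n"
      using xdeg_upd_diff[of i N k m] that Suc.prems by simp
    from Suc.IH[OF this] show ?thesis unfolding coord_shift_def by argo
  qed (simp add: coord_shift_def)
  then show ?case by (simp add: psum_def[of k N "(psum k N ^^ n) f"])
qed simp

section \<open>Formal partial derivatives\<close>

definition partial_deriv :: "nat \<Rightarrow> ((nat \<Rightarrow> nat) \<Rightarrow> int) \<Rightarrow> (nat \<Rightarrow> nat) \<Rightarrow> int" where
  "partial_deriv j f m = int (m j + 1) * f (m(j := m j + 1))"

lemma partial_deriv_psum: "j < N \<Longrightarrow> partial_deriv j (psum 1 N f) = (\<lambda>m. psum 1 N (partial_deriv j f) m + f m)"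
proof
  fix m assume j: "j < N"
  have e: "partial_deriv j (coord_shift 1 i f) m = coord_shift 1 i (partial_deriv j f) m + (if i = j then f m else 0)" for i
    by (cases "m j = 0") (auto simp: partial_deriv_def coord_shift_def fun_upd_twist fun_upd_idem of_nat_diff left_diff_distrib distrib_right)
  have "partial_deriv j (psum 1 N f) m = (\<Sum>i<N. partial_deriv j (coord_shift 1 i f) m)"
    by (simp add: partial_deriv_def psum_def sum_distrib_left)
  also have "\<dots> = psum 1 N (partial_deriv j f) m + f m"
    unfolding e using j by (simp add: sum.distrib psum_def sum.delta)
  finally show "partial_deriv j (psum 1 N f) m = psum 1 N (partial_deriv j f) m + f m" .
qed

text \<open>The linear form has derivative 1 in each variable, so its n-th power and d/dx_j have
  commutator n times the power n-1. The induction on boxes rests on this relation.\<close>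

lemma partial_deriv_psum_pow: "j < N \<Longrightarrow>
  partial_deriv j ((psum 1 N ^^ n) f) m = (psum 1 N ^^ n) (partial_deriv j f) m + int n * (psum 1 N ^^ (n - 1)) f m"
proof (induction n arbitrary: m)
  case (Suc n)
  have IH: "partial_deriv j ((psum 1 N ^^ n) f) = (\<lambda>m. (psum 1 N ^^ n) (partial_deriv j f) m + int n * (psum 1 N ^^ (n - 1)) f m)"
    using Suc by blast
  have "psum 1 N (\<lambda>m. int n * (psum 1 N ^^ (n - 1)) f m) m = int n * (psum 1 N ^^ n) f m"
    by (cases n) (simp_all add: psum_cmult psum_zero del: One_nat_def)
  then show ?case using Suc.prems
    by (simp add: partial_deriv_psum[of j N "(psum 1 N ^^ n) f"] IH psum_add algebra_simps del: One_nat_def)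
qed simp

section \<open>Kernel and image of the linear form\<close>

text \<open>Modulo p the p-th power of the linear form is the sum of the \<open>x_i ^ p\<close>,
  which vanishes in a box with sides at most p. There the image of the power p-a lies in the kernel
  of the power a, and the definition asks for the converse in degree \<open>d\<close>.\<close>

definition ker_im_box :: "nat \<Rightarrow> nat \<Rightarrow> (nat \<Rightarrow> nat) \<Rightarrow> nat \<Rightarrow> nat \<Rightarrow> bool" where
  "ker_im_box p N b a d \<longleftrightarrow> (\<forall>f. (\<forall>m\<in>xbox N b. xdeg N m = d + a \<longrightarrow> int p dvd (psum 1 N ^^ a) f m) \<longrightarrow>
     (\<exists>g. \<forall>m\<in>xbox N b. xdeg N m = d \<longrightarrow> int p dvd f m - (psum 1 N ^^ (p - a)) g m))"

lemma inverse_mod_prime: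
  assumes "prime (p::nat)" "0 < a" "a < p"
  obtains a' where "int p dvd a' * int a - 1"
proof -
  have "coprime (int a) (int p)"
    using assms by (metis coprime_commute coprime_int_iff nat_dvd_not_less prime_imp_coprime)
  then obtain x where "[int a * x = 1] (mod int p)" using cong_solve_coprime_int by blast
  then have "int p dvd x * int a - 1"
    by (simp add: cong_iff_dvd_diff mult.commute)
  then show ?thesis using that by blast
qed

text \<open>Write T for the linear form and D for df/dx_j. Differentiating T^a f = 0 costs one layer
  of the box and gives T^(a-1) (T D + a f) = 0, to which \<open>K1\<close> applies. Multiplying by T
  gives T^(a+1) D = 0, to which \<open>K2\<close> applies. Together they solve for f in the old box,
  and the Euler operator x_j d/dx_j extends the solution to the new layer m_j = b_j.\<close>

lemma ker_im_box_step:
  assumes p: "prime p" and j: "j < N" and bj: "0 < b j" "b j < p" and a: "0 < a" "a < p"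
    and K1: "ker_im_box p N b (a - 1) d" and K2: "0 < d \<Longrightarrow> ker_im_box p N b (a + 1) (d - 1)"
  shows "ker_im_box p N (b(j := b j + 1)) a d"
  unfolding ker_im_box_def
proof (intro allI impI)
  fix f
  let ?B = "xbox N (b(j := b j + 1))" and ?T = "psum 1 N"
  assume f: "\<forall>m\<in>?B. xdeg N m = d + a \<longrightarrow> int p dvd (?T ^^ a) f m"
  define c where "c = p - a"
  define D where "D = partial_deriv j f"
  have sub: "m \<in> ?B" if "m \<in> xbox N b" for m
    using that by (rule xbox_mono) auto
  have up: "m(j := m j + 1) \<in> ?B" if "m \<in> xbox N b" for m
    using that j by (auto simp: xbox_def)
  have h1: "int p dvd (?T ^^ a) D m + int a * (?T ^^ (a - 1)) f m"
    if m: "m \<in> xbox N b" "xdeg N m + 1 = d + a" for m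
  proof -
    have "int p dvd partial_deriv j ((?T ^^ a) f) m"
      unfolding partial_deriv_def using f up[OF m(1)] xdeg_upd_add[OF j, of m 1] m(2) by (auto intro: dvd_mult)
    then show ?thesis by (simp add: partial_deriv_psum_pow[OF j] D_def del: One_nat_def)
  qed
  have Sa: "(?T ^^ (a - 1)) (?T h) = (?T ^^ a) h" for h
    using a by (metis Suc_pred' funpow_Suc_right o_apply)
  obtain u where u: "\<And>m. m \<in> xbox N b \<Longrightarrow> xdeg N m = d \<Longrightarrow>
      int p dvd (?T D m + int a * f m) - (?T ^^ (p - (a - 1))) u m"
  proof -
    have "\<forall>m\<in>xbox N b. xdeg N m = d + (a - 1) \<longrightarrow> int p dvd (?T ^^ (a - 1)) (\<lambda>m. ?T D m + int a * f m) m"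
      using h1 a by (auto simp: psum_pow_add psum_pow_cmult Sa simp del: One_nat_def)
    then show ?thesis using K1 that unfolding ker_im_box_def by blast
  qed
  obtain w where w: "\<And>m. m \<in> xbox N b \<Longrightarrow> xdeg N m + 1 = d \<Longrightarrow> int p dvd D m - (?T ^^ (c - 1)) w m"
  proof (cases "d = 0")
    case True then show ?thesis using that by auto
  next
    case False
    have "\<forall>m\<in>xbox N b. xdeg N m = (d - 1) + (a + 1) \<longrightarrow> int p dvd (?T ^^ (a + 1)) D m"
    proof (intro ballI impI)
      fix m assume m: "m \<in> xbox N b" "xdeg N m = (d - 1) + (a + 1)"
      have "int p dvd psum 1 N (\<lambda>m. (?T ^^ a) D m + int a * (?T ^^ (a - 1)) f m) m"
        by (rule psum_dvd_local[where b=b and l=1 and e="d + a"]) (use h1 m False in auto)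
      moreover have "psum 1 N (\<lambda>m. (?T ^^ a) D m + int a * (?T ^^ (a - 1)) f m) m
          = (?T ^^ (a + 1)) D m + int a * (?T ^^ a) f m"
        using a by (cases a) (simp_all add: psum_add psum_cmult)
      moreover have "int p dvd (?T ^^ a) f m" using f sub m False by auto
      ultimately show "int p dvd (?T ^^ (a + 1)) D m" by (metis dvd_add_left_iff dvd_mult)
    qed
    then obtain w where "\<forall>m\<in>xbox N b. xdeg N m = d - 1 \<longrightarrow> int p dvd D m - (?T ^^ (p - (a + 1))) w m"
      using K2 False unfolding ker_im_box_def by blast
    then show ?thesis using that[of w] by (auto simp: c_def)
  qed
  obtain a' where a': "int p dvd a' * int a - 1" using inverse_mod_prime[OF p a] .
  obtain b' where b': "int p dvd b' * int (b j) - 1" using inverse_mod_prime[OF p bj] .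
  \<comment> \<open>From T D + a f = T^(c+1) u and D = T^(c-1) w follows a f = T^c (T u -
    w).\<close>
  define v where "v = (\<lambda>m. a' * (?T u m - w m))"
  have Sc: "?T ((?T ^^ (c - 1)) h) = (?T ^^ c) h" "(?T ^^ (c - 1)) (?T h) = (?T ^^ c) h" for h
    using a unfolding c_def
    by (metis Suc_pred' comp_apply funpow.simps(2) zero_less_diff, metis Suc_pred' funpow_Suc_right o_apply zero_less_diff)
  have h4: "int p dvd f m - (?T ^^ c) v m" if m: "m \<in> xbox N b" "xdeg N m = d" for m
  proof -
    have "int p dvd ?T (\<lambda>m. D m - (?T ^^ (c - 1)) w m) m"
      by (rule psum_dvd_local[where b=b and l=1 and e="d"]) (use w m in auto)
    then have 1: "int p dvd ?T D m - (?T ^^ c) w m" by (simp add: psum_diff Sc del: One_nat_def)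
    have "p - (a - 1) = Suc c" using a by (simp add: c_def)
    then have 2: "int p dvd (?T D m + int a * f m) - (?T ^^ c) (?T u) m"
      using u[OF m] by (simp add: funpow_Suc_right del: funpow.simps)
    have "int a * f m - (?T ^^ c) (?T u) m + (?T ^^ c) w m
        = ((?T D m + int a * f m) - (?T ^^ c) (?T u) m) - (?T D m - (?T ^^ c) w m)" by simp
    then have 3: "int p dvd int a * f m - (?T ^^ c) (?T u) m + (?T ^^ c) w m"
      using 1 2 by (metis dvd_diff)
    have "f m - (?T ^^ c) v m = a' * (int a * f m - (?T ^^ c) (?T u) m + (?T ^^ c) w m) - (a' * int a - 1) * f m"
      by (simp add: v_def psum_pow_cmult psum_pow_diff algebra_simps)
    then show ?thesis using 3 a' by (metis dvd_diff dvd_mult dvd_mult2)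
  qed
  \<comment> \<open>The operator x_j d/dx_j multiplies a coefficient by m_j. Hence in b_j (f - T^c
    g) the difference f - T^c v, which vanishes only in the old box, carries the factor b_j - m_j
    and drops out in the new layer. The other terms are x_j times a relation valid in the old box
    (for D) or everywhere (a v = T u - w, with a + c = p).\<close>
  define g where "g = (\<lambda>m. b' * (int (b j) * v m - coord_shift 1 j (partial_deriv j v) m + coord_shift 1 j u m))"
  have "int p dvd f m - (?T ^^ (p - a)) g m" if m: "m \<in> ?B" "xdeg N m = d" for m
  proof -
    have xpt: "coord_shift 1 j (partial_deriv j h) m = int (m j) * h m" for h
      by (auto simp: coord_shift_def partial_deriv_def)
    have mj: "m j \<le> b j" using m(1) j unfolding xbox_def by auto
    have E1: "int p dvd (int (b j) - int (m j)) * (f m - (?T ^^ c) v m)"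
    proof (cases "m j = b j")
      case False
      then have "m \<in> xbox N b" using m(1) mj unfolding xbox_def by (auto split: if_splits)
      then show ?thesis using h4 m(2) by (simp add: dvd_mult)
    qed simp
    have E2: "int p dvd coord_shift 1 j D m - coord_shift 1 j ((?T ^^ (c - 1)) w) m"
    proof (cases "m j = 0")
      case False
      then have "m(j := m j - 1) \<in> xbox N b" using m(1) mj unfolding xbox_def by (auto split: if_splits)
      then show ?thesis using w[of "m(j := m j - 1)"] xdeg_upd_diff[OF j, of 1 m] m(2) False
        by (auto simp: coord_shift_def)
    qed (simp add: coord_shift_def)
    have E3: "int (m j) * (?T ^^ c) v m = coord_shift 1 j ((?T ^^ c) (partial_deriv j v)) m + int c * coord_shift 1 j ((?T ^^ (c - 1)) v) m"
      unfolding xpt[symmetric] by (simp add: coord_shift_def partial_deriv_psum_pow[OF j] del: One_nat_def)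
    have E4: "coord_shift 1 j D m = int (m j) * f m" by (simp add: D_def xpt del: One_nat_def)
    have E5: "(?T ^^ c) (coord_shift 1 j h) m = coord_shift 1 j ((?T ^^ c) h) m" for h by (simp add: coord_shift_psum_pow)
    have E6: "coord_shift 1 j ((?T ^^ c) u) m = coord_shift 1 j ((?T ^^ (c - 1)) (?T u)) m" by (simp add: Sc del: One_nat_def)
    have E7: "int p dvd ((?T ^^ (c - 1)) (?T u) m' - (?T ^^ (c - 1)) w m') + int c * (?T ^^ (c - 1)) v m'" for m'
    proof -
      have "int p dvd (?T u m' - w m') + int c * v m'" for m'
      proof -
        have "(?T u m' - w m') + int c * v m' = int p * v m' - (a' * int a - 1) * (?T u m' - w m')"
          using a by (simp add: c_def v_def algebra_simps of_nat_diff)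
        then show ?thesis using a' by (metis dvd_diff dvd_mult2 dvd_triv_left)
      qed
      then have "int p dvd (?T ^^ (c - 1)) (\<lambda>m. (?T u m - w m) + int c * v m) m'"
        by (rule psum_pow_dvd)
      then show ?thesis by (simp add: psum_pow_add psum_pow_diff psum_pow_cmult)
    qed
    have E8: "int p dvd (coord_shift 1 j ((?T ^^ (c - 1)) (?T u)) m - coord_shift 1 j ((?T ^^ (c - 1)) w) m) + int c * coord_shift 1 j ((?T ^^ (c - 1)) v) m"
      using E7 by (auto simp: coord_shift_def)
    have "f m - (?T ^^ c) g m = b' * ((int (b j) - int (m j)) * (f m - (?T ^^ c) v m)
        + (coord_shift 1 j D m - coord_shift 1 j ((?T ^^ (c - 1)) w) m)
        - ((coord_shift 1 j ((?T ^^ (c - 1)) (?T u)) m - coord_shift 1 j ((?T ^^ (c - 1)) w) m) + int c * coord_shift 1 j ((?T ^^ (c - 1)) v) m))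
        - (b' * int (b j) - 1) * f m"
      unfolding g_def psum_pow_cmult psum_pow_add psum_pow_diff E5 E6 E4
      using E3 by (simp add: algebra_simps)
    then have "int p dvd f m - (?T ^^ c) g m"
      using E1 E2 E8 b' by (metis dvd_add dvd_diff dvd_mult dvd_mult2)
    then show ?thesis by (simp add: c_def)
  qed
  then show "\<exists>g. \<forall>m\<in>?B. xdeg N m = d \<longrightarrow> int p dvd f m - (?T ^^ (p - a)) g m" by blast
qed

text \<open>The step lowers \<open>2 * d + a\<close> by one in both of its hypotheses, just as it
  lowers the sum on the right. That sum is the top degree of the box, so the bound places the
  midpoint of d and d + a at or below the middle degree. In characteristic 0 this is the range where
  a strong Lefschetz element is injective.\<close>

lemma ker_im_box_bound:
  assumes p: "prime p"
  shows "(\<And>i. i < N \<Longrightarrow> 1 \<le> b i \<and> b i \<le> p) \<Longrightarrow> a \<le> p \<Longrightarrow> 2 * d + a \<le> (\<Sum>i<N. b i - 1) \<Longrightarrow> ker_im_box p N b a d"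
proof (induction "\<Sum>i<N. b i - 1" arbitrary: b a d rule: less_induct)
  case less
  consider "a = 0" | "a = p" | "0 < a" "a < p" using less.prems by linarith
  then show ?case
  proof cases
    case 1
    then show ?thesis unfolding ker_im_box_def
      by (auto intro!: exI[of _ "\<lambda>m. 0"] simp: psum_pow_zero)
  next
    case 2
    then show ?thesis unfolding ker_im_box_def by (intro allI impI, rule_tac x=f in exI) simp
  next
    case 3
    then have "(\<Sum>i<N. b i - 1) \<noteq> 0" using less.prems by linarith
    then obtain j where j: "j < N" "b j - 1 \<noteq> 0" by (auto)
    define b0 where "b0 = b(j := b j - 1)"
    have bb: "b = b0(j := b0 j + 1)" using j by (auto simp: b0_def)
    have s: "(\<Sum>i<N. b i - 1) = (\<Sum>i<N. b0 i - 1) + 1"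
    proof -
      have "(\<Sum>i<N. b i - 1) = (b j - 1) + (\<Sum>i\<in>{..<N}-{j}. b i - 1)"
        using j by (simp add: sum.remove[of _ j])
      moreover have "(\<Sum>i<N. b0 i - 1) = (b0 j - 1) + (\<Sum>i\<in>{..<N}-{j}. b0 i - 1)"
        using j by (simp add: sum.remove[of _ j])
      moreover have "(\<Sum>i\<in>{..<N}-{j}. b0 i - 1) = (\<Sum>i\<in>{..<N}-{j}. b i - 1)"
        by (rule sum.cong) (auto simp: b0_def)
      ultimately show ?thesis using j by (simp add: b0_def)
    qed
    have b0: "1 \<le> b0 i \<and> b0 i \<le> p" if "i < N" for i
      using less.prems(1)[OF that] j by (auto simp: b0_def)
    have b0j: "0 < b0 j" "b0 j < p" using b0[OF j(1)] less.prems(1)[OF j(1)] j by (auto simp: b0_def)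
    have "ker_im_box p N b0 (a - 1) d"
      by (rule less.hyps) (use s b0 3 less.prems in auto)
    moreover have "ker_im_box p N b0 (a + 1) (d - 1)" if "0 < d"
      by (rule less.hyps) (use s b0 3 less.prems that in auto)
    ultimately show ?thesis
      using ker_im_box_step[where b=b0 and a=a and d=d, OF p j(1) b0j 3] bb by simp
  qed
qed

section \<open>Linear algebra modulo a prime\<close>

definition dot_on :: "'y set \<Rightarrow> ('y \<Rightarrow> int) \<Rightarrow> ('y \<Rightarrow> int) \<Rightarrow> int" where
  "dot_on V w z = (\<Sum>y\<in>V. w y * z y)"

lemma inverse_mod_prime_int:
  assumes "prime (p::nat)" "\<not> int p dvd a"
  obtains s where "[s * a = 1] (mod int p)"
proof -
  have "coprime a (int p)"
    using assms by (metis coprime_commute prime_imp_coprime prime_nat_int_transfer)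
  then obtain x where "[a * x = 1] (mod int p)" using cong_solve_coprime_int by blast
  then show ?thesis using that by (metis mult.commute)
qed

text \<open>Gaussian elimination modulo p with dual functionals carried along. If the residual of a
  new vector is non-zero at a coordinate \<open>y0\<close>, the vector joins the basis. That
  coordinate of the residual, rescaled, is its functional, and the old functionals are corrected to
  vanish on it.\<close>

lemma dual_basis:
  assumes p: "prime p" and V: "finite V" and U: "finite U"
  obtains B w where "B \<subseteq> U"
    "\<And>b c. b \<in> B \<Longrightarrow> c \<in> B \<Longrightarrow> [dot_on V (w b) (v c) = (if b = c then 1 else 0)] (mod int p)"
    "\<And>x y. x \<in> U \<Longrightarrow> y \<in> V \<Longrightarrow> [v x y = (\<Sum>b\<in>B. dot_on V (w b) (v x) * v b y)] (mod int p)"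
proof -
  let ?P = "\<lambda>U B w. B \<subseteq> U \<and>
    (\<forall>b\<in>B. \<forall>c\<in>B. [dot_on V (w b) (v c) = (if b = c then 1 else 0)] (mod int p)) \<and>
    (\<forall>x\<in>U. \<forall>y\<in>V. [v x y = (\<Sum>b\<in>B. dot_on V (w b) (v x) * v b y)] (mod int p))"
  have "\<exists>B w. ?P U B w" using U
  proof (induction U rule: finite_induct)
    case empty
    show ?case by (rule exI[of _ "{}"]) simp
  next
    case (insert x U)
    then obtain B w where BX: "B \<subseteq> U"
      and dual: "\<And>b c. b \<in> B \<Longrightarrow> c \<in> B \<Longrightarrow> [dot_on V (w b) (v c) = (if b = c then 1 else 0)] (mod int p)"
      and span: "\<And>x y. x \<in> U \<Longrightarrow> y \<in> V \<Longrightarrow> [v x y = (\<Sum>b\<in>B. dot_on V (w b) (v x) * v b y)] (mod int p)"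
      by blast
    have fB: "finite B" using BX insert finite_subset by blast
    define u where "u z y = z y - (\<Sum>b\<in>B. dot_on V (w b) z * v b y)" for z y
    show ?case
    proof (cases "\<forall>y\<in>V. int p dvd u (v x) y")
      case True
      then have "\<forall>y\<in>V. [v x y = (\<Sum>b\<in>B. dot_on V (w b) (v x) * v b y)] (mod int p)"
        by (simp add: u_def cong_iff_dvd_diff)
      then show ?thesis using BX dual span by (intro exI[of _ B] exI[of _ w]) auto
    next
      case False
      then obtain y0 where y0: "y0 \<in> V" "\<not> int p dvd u (v x) y0" by blast
      obtain s where s: "[s * u (v x) y0 = 1] (mod int p)" using inverse_mod_prime_int[OF p y0(2)] .
      define wx where "wx y = s * ((if y = y0 then 1 else 0) - (\<Sum>b\<in>B. w b y * v b y0))" for y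
      define w' where "w' b = (if b = x then wx else (\<lambda>y. w b y - dot_on V (w b) (v x) * wx y))" for b
      have xB: "x \<notin> B" using BX insert by blast
      have dwx: "dot_on V wx z = s * u z y0" for z
      proof -
        have "dot_on V wx z = s * ((\<Sum>y\<in>V. (if y = y0 then 1 else 0) * z y) - (\<Sum>y\<in>V. (\<Sum>b\<in>B. w b y * v b y0) * z y))"
          by (simp add: dot_on_def wx_def sum_distrib_left sum_subtractf algebra_simps)
        also have "(\<Sum>y\<in>V. (\<Sum>b\<in>B. w b y * v b y0) * z y) = (\<Sum>b\<in>B. dot_on V (w b) z * v b y0)"
          unfolding dot_on_def sum_distrib_right by (subst sum.swap) (simp add: mult_ac)
        also have "(\<Sum>y\<in>V. (if y = y0 then 1 else 0) * z y) = z y0"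
        proof -
          have "(\<Sum>y\<in>V. (if y = y0 then 1 else 0) * z y) = (\<Sum>y\<in>V. if y = y0 then z y else 0)"
            by (intro sum.cong) auto
          then show ?thesis using V y0 by simp
        qed
        finally show ?thesis by (simp add: u_def)
      qed
      have dw': "dot_on V (w' b) z = dot_on V (w b) z - dot_on V (w b) (v x) * dot_on V wx z" if "b \<in> B" for b z
      proof -
        have "dot_on V (w' b) z = (\<Sum>y\<in>V. w b y * z y - dot_on V (w b) (v x) * (wx y * z y))"
          unfolding dot_on_def[of V "w' b"] using that xB
          by (intro sum.cong refl) (auto simp: w'_def left_diff_distrib mult.assoc)
        then show ?thesis by (simp add: sum_subtractf sum_distrib_left[symmetric] dot_on_def)
      qed
      have u0: "int p dvd u (v c) y" if "c \<in> U" "y \<in> V" for c y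
        using span[OF that] by (simp add: u_def cong_iff_dvd_diff)
      have wx0: "[dot_on V wx (v c) = 0] (mod int p)" if "c \<in> U" for c
        using u0[OF that y0(1)] by (simp add: dwx cong_0_iff)
      have wxx: "[dot_on V wx (v x) = 1] (mod int p)" using s by (simp add: dwx)
      have wbx: "[dot_on V (w' b) (v x) = 0] (mod int p)" if "b \<in> B" for b
      proof -
        have "[dot_on V (w b) (v x) - dot_on V (w b) (v x) * dot_on V wx (v x)
            = dot_on V (w b) (v x) - dot_on V (w b) (v x) * 1] (mod int p)"
          by (intro cong_diff cong_mult cong_refl wxx)
        then show ?thesis by (simp add: dw'[OF that])
      qed
      have wbc: "[dot_on V (w' b) (v c) = dot_on V (w b) (v c)] (mod int p)" if "b \<in> B" "c \<in> U" for b c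
      proof -
        have "[dot_on V (w b) (v c) - dot_on V (w b) (v x) * dot_on V wx (v c)
            = dot_on V (w b) (v c) - dot_on V (w b) (v x) * 0] (mod int p)"
          by (intro cong_diff cong_mult cong_refl wx0 that)
        then show ?thesis by (simp add: dw'[OF that(1)])
      qed
      have w'x: "w' x = wx" by (simp add: w'_def)
      have "?P (insert x U) (insert x B) w'"
      proof (intro conjI ballI)
        show "insert x B \<subseteq> insert x U" using BX by blast
      next
        fix b c assume bc: "b \<in> insert x B" "c \<in> insert x B"
        show "[dot_on V (w' b) (v c) = (if b = c then 1 else 0)] (mod int p)"
        proof (cases "b = x")
          case True
          then show ?thesis using bc wxx wx0 BX xB w'x by auto
        next
          case False
          then have b: "b \<in> B" using bc by simp
          show ?thesis
          proof (cases "c = x")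
            case True then show ?thesis using wbx[OF b] False by simp
          next
            case False
            then have c: "c \<in> B" using bc by simp
            then have "c \<in> U" using BX by blast
            from cong_trans[OF wbc[OF b this] dual[OF b c]] show ?thesis .
          qed
        qed
      next
        fix x' y assume x': "x' \<in> insert x U" and y: "y \<in> V"
        have e: "(\<Sum>b\<in>insert x B. dot_on V (w' b) (v x') * v b y) = dot_on V wx (v x') * v x y + (\<Sum>b\<in>B. dot_on V (w' b) (v x') * v b y)"
          using fB xB by (simp add: w'x)
        show "[v x' y = (\<Sum>b\<in>insert x B. dot_on V (w' b) (v x') * v b y)] (mod int p)"
        proof (cases "x' = x")
          case True
          have "[(\<Sum>b\<in>B. dot_on V (w' b) (v x) * v b y) = (\<Sum>b\<in>B. 0 * v b y)] (mod int p)"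
            by (rule cong_sum) (rule cong_mult[OF wbx cong_refl])
          then have "[dot_on V wx (v x) * v x y + (\<Sum>b\<in>B. dot_on V (w' b) (v x) * v b y) = 1 * v x y + 0] (mod int p)"
            by (intro cong_add cong_mult wxx cong_refl) simp
          then show ?thesis using True e by (simp add: cong_sym)
        next
          case False
          then have x'U: "x' \<in> U" using x' by blast
          have "[(\<Sum>b\<in>B. dot_on V (w' b) (v x') * v b y) = (\<Sum>b\<in>B. dot_on V (w b) (v x') * v b y)] (mod int p)"
            by (rule cong_sum) (rule cong_mult[OF wbc[OF _ x'U] cong_refl])
          then have "[dot_on V wx (v x') * v x y + (\<Sum>b\<in>B. dot_on V (w' b) (v x') * v b y)
              = 0 * v x y + (\<Sum>b\<in>B. dot_on V (w b) (v x') * v b y)] (mod int p)"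
            by (intro cong_add cong_mult wx0[OF x'U] cong_refl)
          then have "[(\<Sum>b\<in>insert x B. dot_on V (w' b) (v x') * v b y) = (\<Sum>b\<in>B. dot_on V (w b) (v x') * v b y)] (mod int p)"
            unfolding e by simp
          from cong_trans[OF span[OF x'U y] cong_sym[OF this]] show ?thesis .
        qed
      qed
      then show ?thesis by blast
    qed
  qed
  then show ?thesis using that by blast
qed

text \<open>Subspaces over the prime field are finite sets of reduced representatives. Dimensions
  are compared through cardinalities, which are powers of p.\<close>

definition image_mod :: "nat \<Rightarrow> 'x set \<Rightarrow> 'y set \<Rightarrow> ('x \<Rightarrow> 'y \<Rightarrow> int) \<Rightarrow> ('y \<Rightarrow> int) set" where
  "image_mod p U V v = (\<lambda>c. \<lambda>y\<in>V. (\<Sum>x\<in>U. c x * v x y) mod int p) ` UNIV"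

definition kernel_mod :: "nat \<Rightarrow> 'x set \<Rightarrow> 'y set \<Rightarrow> ('x \<Rightarrow> 'y \<Rightarrow> int) \<Rightarrow> ('x \<Rightarrow> int) set" where
  "kernel_mod p U V v = {c \<in> U \<rightarrow>\<^sub>E {0..<int p}. \<forall>y\<in>V. int p dvd (\<Sum>x\<in>U. c x * v x y)}"

lemma card_PiE_mod: "finite U \<Longrightarrow> card (U \<rightarrow>\<^sub>E {0..<int p}) = p ^ card U"
  by (simp add: card_PiE)

lemma dot_on_comb: "dot_on V w (\<lambda>y. \<Sum>x\<in>U. c x * v x y) = (\<Sum>x\<in>U. c x * dot_on V w (v x))"
  unfolding dot_on_def sum_distrib_left by (subst sum.swap) (simp add: mult_ac)

lemma dot_on_cong: "(\<And>y. y \<in> V \<Longrightarrow> [z y = z' y] (mod m)) \<Longrightarrow> [dot_on V w z = dot_on V w z'] (mod m)"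
  unfolding dot_on_def by (intro cong_sum cong_mult cong_refl)

lemma mod_range_cong_eq:
  "a \<in> {0..<int p} \<Longrightarrow> b \<in> {0..<int p} \<Longrightarrow> [a = b] (mod int p) \<Longrightarrow> a = b"
  by (simp add: cong_def)

lemma dot_on_dual:
  assumes "finite B" "\<And>c. c \<in> B \<Longrightarrow> [dot_on V w (v c) = (if b = c then 1 else 0)] (mod int p)" "b \<in> B"
  shows "[dot_on V w (\<lambda>y. \<Sum>c\<in>B. a c * v c y) = a b] (mod int p)"
proof -
  have "[(\<Sum>c\<in>B. a c * dot_on V w (v c)) = (\<Sum>c\<in>B. a c * (if b = c then 1 else 0))] (mod int p)"
    using assms by (intro cong_sum cong_mult cong_refl) auto
  moreover have "(\<Sum>c\<in>B. a c * (if b = c then 1 else 0)) = (\<Sum>c\<in>B. if b = c then a c else 0)"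
    by (intro sum.cong) auto
  ultimately show ?thesis using assms(1,3) by (simp add: dot_on_comb)
qed

text \<open>One basis B serves all claims. Coordinates along B parametrise the image. In the kernel
  the values off B are free and determine those on B. Every row is a combination of the functions
  sending x to the value of the functional \<open>w b\<close> on \<open>v x\<close>, which bounds
  the rank of the transpose.\<close>

lemma rank_exists:
  assumes p: "prime p" and V: "finite V" and U: "finite U"
  obtains B w where "card (image_mod p U V v) = p ^ card B" "card (kernel_mod p U V v) = p ^ (card U - card B)" "B \<subseteq> U"
    "card (image_mod p V U (\<lambda>y x. v x y)) \<le> p ^ card B"
    "\<And>b c. b \<in> B \<Longrightarrow> c \<in> B \<Longrightarrow> [dot_on V (w b) (v c) = (if b = c then 1 else 0)] (mod int p)"
proof -
  obtain B w where BX: "B \<subseteq> U"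
    and dual: "\<And>b c. b \<in> B \<Longrightarrow> c \<in> B \<Longrightarrow> [dot_on V (w b) (v c) = (if b = c then 1 else 0)] (mod int p)"
    and span: "\<And>x y. x \<in> U \<Longrightarrow> y \<in> V \<Longrightarrow> [v x y = (\<Sum>b\<in>B. dot_on V (w b) (v x) * v b y)] (mod int p)"
    using dual_basis[OF p V U, of v] by blast
  have fB: "finite B" using BX U finite_subset by blast
  have p0: "int p > 0" using p prime_gt_0_nat by simp
  have rd: "[dot_on V (w b) (\<lambda>y. \<Sum>c\<in>B. a c * v c y) = a b] (mod int p)" if "b \<in> B" for a b
    by (rule dot_on_dual[OF fB _ that]) (use dual that in auto)
  have expand: "[(\<Sum>x\<in>U. c x * v x y) = (\<Sum>b\<in>B. (\<Sum>x\<in>U. c x * dot_on V (w b) (v x)) * v b y)] (mod int p)"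
    if "y \<in> V" for c y
  proof -
    have "[(\<Sum>x\<in>U. c x * v x y) = (\<Sum>x\<in>U. c x * (\<Sum>b\<in>B. dot_on V (w b) (v x) * v b y))] (mod int p)"
      using span that by (intro cong_sum cong_mult cong_refl) auto
    also have "(\<Sum>x\<in>U. c x * (\<Sum>b\<in>B. dot_on V (w b) (v x) * v b y)) = (\<Sum>b\<in>B. (\<Sum>x\<in>U. c x * dot_on V (w b) (v x)) * v b y)"
      unfolding sum_distrib_left sum_distrib_right by (subst sum.swap) (simp add: mult_ac)
    finally show ?thesis .
  qed
  let ?F = "\<lambda>a. \<lambda>y\<in>V. (\<Sum>b\<in>B. a b * v b y) mod int p"
  have "bij_betw ?F (B \<rightarrow>\<^sub>E {0..<int p}) (image_mod p U V v)"
    unfolding bij_betw_def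
  proof
    show "inj_on ?F (B \<rightarrow>\<^sub>E {0..<int p})"
    proof (rule inj_onI)
      fix a a' assume a: "a \<in> B \<rightarrow>\<^sub>E {0..<int p}" "a' \<in> B \<rightarrow>\<^sub>E {0..<int p}" and eq: "?F a = ?F a'"
      have "[(\<Sum>b\<in>B. a b * v b y) = (\<Sum>b\<in>B. a' b * v b y)] (mod int p)" if "y \<in> V" for y
        using fun_cong[OF eq, of y] that by (simp add: cong_def)
      then have "[dot_on V (w b) (\<lambda>y. \<Sum>c\<in>B. a c * v c y) = dot_on V (w b) (\<lambda>y. \<Sum>c\<in>B. a' c * v c y)] (mod int p)" for b
        by (rule dot_on_cong)
      then have "[a b = a' b] (mod int p)" if "b \<in> B" for b
        by (rule cong_trans[OF cong_sym[OF rd[OF that]] cong_trans[OF _ rd[OF that]]])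
      then show "a = a'" using a by (intro PiE_ext[of a B _ a']) (auto intro!: mod_range_cong_eq)
    qed
  next
    show "?F ` (B \<rightarrow>\<^sub>E {0..<int p}) = image_mod p U V v"
    proof (intro equalityI subsetI)
      fix z assume "z \<in> ?F ` (B \<rightarrow>\<^sub>E {0..<int p})"
      then obtain a where "a \<in> B \<rightarrow>\<^sub>E {0..<int p}" and z: "z = ?F a" by blast
      have "(\<Sum>b\<in>B. a b * v b y) = (\<Sum>x\<in>U. (if x \<in> B then a x else 0) * v x y)" for y
        using BX U by (simp add: sum.mono_neutral_cong_left[of U B])
      then show "z \<in> image_mod p U V v" unfolding image_mod_def z by auto
    next
      fix z assume "z \<in> image_mod p U V v"
      then obtain c where z: "z = (\<lambda>y\<in>V. (\<Sum>x\<in>U. c x * v x y) mod int p)" unfolding image_mod_def by blast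
      define a where "a = (\<lambda>b\<in>B. (\<Sum>x\<in>U. c x * dot_on V (w b) (v x)) mod int p)"
      have q: "[(\<Sum>b\<in>B. a b * v b y) = (\<Sum>x\<in>U. c x * v x y)] (mod int p)" if "y \<in> V" for y
      proof -
        have "[(\<Sum>b\<in>B. a b * v b y) = (\<Sum>b\<in>B. (\<Sum>x\<in>U. c x * dot_on V (w b) (v x)) * v b y)] (mod int p)"
          by (intro cong_sum cong_mult cong_refl) (simp add: a_def cong_def)
        from cong_trans[OF this cong_sym[OF expand[OF that]]] show ?thesis .
      qed
      have "?F a = z" unfolding z by (rule restrict_ext) (rule q[unfolded cong_def])
      moreover have "a \<in> B \<rightarrow>\<^sub>E {0..<int p}" using p0 by (auto simp: a_def)
      ultimately show "z \<in> ?F ` (B \<rightarrow>\<^sub>E {0..<int p})" by blast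
    qed
  qed
  from bij_betw_same_card[OF this] have 1: "card (image_mod p U V v) = p ^ card B"
    by (simp add: card_PiE_mod[OF fB])
  let ?R = "\<lambda>f. restrict f (U - B)"
  have split: "(\<Sum>x\<in>U. f x * v x y) = (\<Sum>x\<in>B. f x * v x y) + (\<Sum>x\<in>U-B. f x * v x y)" for f y
    using sum.subset_diff[OF BX U] by (simp add: add.commute)
  have "bij_betw ?R (kernel_mod p U V v) ((U - B) \<rightarrow>\<^sub>E {0..<int p})"
    unfolding bij_betw_def
  proof
    show "inj_on ?R (kernel_mod p U V v)"
    proof (rule inj_onI)
      fix f g assume f: "f \<in> kernel_mod p U V v" and g: "g \<in> kernel_mod p U V v" and eq: "?R f = ?R g"
      have eq': "f x = g x" if "x \<in> U - B" for x using fun_cong[OF eq, of x] that by simp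
      have "[(\<Sum>x\<in>B. f x * v x y) = (\<Sum>x\<in>B. g x * v x y)] (mod int p)" if "y \<in> V" for y
      proof -
        have "[(\<Sum>x\<in>U. f x * v x y) = (\<Sum>x\<in>U. g x * v x y)] (mod int p)"
          using f g that unfolding kernel_mod_def by (auto simp: cong_def)
        moreover have "(\<Sum>x\<in>U-B. f x * v x y) = (\<Sum>x\<in>U-B. g x * v x y)"
          using eq' by (intro sum.cong) auto
        ultimately show ?thesis by (simp add: split cong_add_rcancel)
      qed
      then have "[dot_on V (w b) (\<lambda>y. \<Sum>c\<in>B. f c * v c y) = dot_on V (w b) (\<lambda>y. \<Sum>c\<in>B. g c * v c y)] (mod int p)" for b
        by (rule dot_on_cong)
      then have c: "[f b = g b] (mod int p)" if "b \<in> B" for b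
        by (rule cong_trans[OF cong_sym[OF rd[OF that]] cong_trans[OF _ rd[OF that]]])
      have "f x = g x" if "x \<in> U" for x
      proof (cases "x \<in> B")
        case True
        then show ?thesis using f g that c[OF True] unfolding kernel_mod_def by (auto intro!: mod_range_cong_eq)
      qed (use eq' that in auto)
      then show "f = g" using f g unfolding kernel_mod_def by (auto intro: PiE_ext)
    qed
  next
    show "?R ` kernel_mod p U V v = (U - B) \<rightarrow>\<^sub>E {0..<int p}"
    proof (intro equalityI subsetI)
      fix z assume "z \<in> ?R ` kernel_mod p U V v"
      then show "z \<in> (U - B) \<rightarrow>\<^sub>E {0..<int p}" unfolding kernel_mod_def by (auto simp: PiE_iff)
    next
      fix h assume h: "h \<in> (U - B) \<rightarrow>\<^sub>E {0..<int p}"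
      define f where "f = (\<lambda>x\<in>U. if x \<in> B then (- (\<Sum>t\<in>U-B. h t * dot_on V (w x) (v t))) mod int p else h x)"
      have "f \<in> U \<rightarrow>\<^sub>E {0..<int p}" using h p0 by (auto simp: f_def)
      moreover have "int p dvd (\<Sum>x\<in>U. f x * v x y)" if y: "y \<in> V" for y
      proof -
        have a: "[(\<Sum>x\<in>B. f x * v x y) = (\<Sum>x\<in>B. (- (\<Sum>t\<in>U-B. h t * dot_on V (w x) (v t))) * v x y)] (mod int p)"
          using BX by (intro cong_sum cong_mult cong_refl) (auto simp: f_def cong_def)
        have b: "[(\<Sum>x\<in>U-B. f x * v x y) = (\<Sum>t\<in>U-B. h t * (\<Sum>b\<in>B. dot_on V (w b) (v t) * v b y))] (mod int p)"
          using span y by (intro cong_sum cong_mult) (auto simp: f_def)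
        have c: "(\<Sum>t\<in>U-B. h t * (\<Sum>b\<in>B. dot_on V (w b) (v t) * v b y)) = (\<Sum>x\<in>B. (\<Sum>t\<in>U-B. h t * dot_on V (w x) (v t)) * v x y)"
          unfolding sum_distrib_left sum_distrib_right by (subst sum.swap) (simp add: mult_ac)
        have "[(\<Sum>x\<in>U. f x * v x y) = 0] (mod int p)"
          using cong_add[OF a b] by (simp add: split c sum_negf)
        then show ?thesis by (simp add: cong_0_iff)
      qed
      ultimately have "f \<in> kernel_mod p U V v" unfolding kernel_mod_def by blast
      moreover have "h = ?R f" using h by (auto simp: f_def fun_eq_iff PiE_iff extensional_def)
      ultimately show "h \<in> ?R ` kernel_mod p U V v" by blast
    qed
  qed
  from bij_betw_same_card[OF this] have "card (kernel_mod p U V v) = p ^ card (U - B)"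
    using U by (simp add: card_PiE_mod)
  then have 2: "card (kernel_mod p U V v) = p ^ (card U - card B)"
    using BX U by (simp add: card_Diff_subset finite_subset)
  let ?H = "\<lambda>a. \<lambda>x\<in>U. (\<Sum>b\<in>B. a b * dot_on V (w b) (v x)) mod int p"
  have "image_mod p V U (\<lambda>y x. v x y) \<subseteq> ?H ` (B \<rightarrow>\<^sub>E {0..<int p})"
  proof
    fix z assume "z \<in> image_mod p V U (\<lambda>y x. v x y)"
    then obtain c where z: "z = (\<lambda>x\<in>U. (\<Sum>y\<in>V. c y * v x y) mod int p)" unfolding image_mod_def by blast
    define a where "a = (\<lambda>b\<in>B. (\<Sum>y\<in>V. c y * v b y) mod int p)"
    have q: "[(\<Sum>y\<in>V. c y * v x y) = (\<Sum>b\<in>B. a b * dot_on V (w b) (v x))] (mod int p)" if "x \<in> U" for x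
    proof -
      have "[(\<Sum>y\<in>V. c y * v x y) = (\<Sum>y\<in>V. c y * (\<Sum>b\<in>B. dot_on V (w b) (v x) * v b y))] (mod int p)"
        using span that by (intro cong_sum cong_mult cong_refl) auto
      also have "(\<Sum>y\<in>V. c y * (\<Sum>b\<in>B. dot_on V (w b) (v x) * v b y)) = (\<Sum>b\<in>B. (\<Sum>y\<in>V. c y * v b y) * dot_on V (w b) (v x))"
        unfolding sum_distrib_left sum_distrib_right by (subst sum.swap) (simp add: mult_ac)
      also have "[(\<Sum>b\<in>B. (\<Sum>y\<in>V. c y * v b y) * dot_on V (w b) (v x)) = (\<Sum>b\<in>B. a b * dot_on V (w b) (v x))] (mod int p)"
        by (intro cong_sum cong_mult cong_refl) (simp add: a_def cong_def)
      finally show ?thesis .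
    qed
    have "z = ?H a" unfolding z by (rule restrict_ext) (rule q[unfolded cong_def])
    moreover have "a \<in> B \<rightarrow>\<^sub>E {0..<int p}" using p0 by (auto simp: a_def)
    ultimately show "z \<in> ?H ` (B \<rightarrow>\<^sub>E {0..<int p})" by blast
  qed
  from card_mono[OF _ this] have "card (image_mod p V U (\<lambda>y x. v x y)) \<le> card (?H ` (B \<rightarrow>\<^sub>E {0..<int p}))"
    by (simp add: fB finite_PiE)
  also have "\<dots> \<le> card (B \<rightarrow>\<^sub>E {0..<int p})"
    by (rule card_image_le) (simp add: fB finite_PiE)
  also have "\<dots> = p ^ card B" by (rule card_PiE_mod[OF fB])
  finally have 3: "card (image_mod p V U (\<lambda>y x. v x y)) \<le> p ^ card B" .
  show ?thesis using that[OF 1 2 BX 3 dual] by blast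
qed

definition rank_mod :: "nat \<Rightarrow> 'x set \<Rightarrow> 'y set \<Rightarrow> ('x \<Rightarrow> 'y \<Rightarrow> int) \<Rightarrow> nat" where
  "rank_mod p U V v = (THE r. card (image_mod p U V v) = p ^ r)"

lemma rank_mod_props:
  assumes "prime p" "finite V" "finite U"
  shows card_image_mod: "card (image_mod p U V v) = p ^ rank_mod p U V v"
    and card_kernel_mod: "card (kernel_mod p U V v) = p ^ (card U - rank_mod p U V v)"
    and rank_mod_le: "rank_mod p U V v \<le> card U"
    and card_image_mod_transpose: "card (image_mod p V U (\<lambda>y x. v x y)) \<le> p ^ rank_mod p U V v"
proof -
  obtain B w where r: "card (image_mod p U V v) = p ^ card B" "card (kernel_mod p U V v) = p ^ (card U - card B)" "B \<subseteq> U"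
    "card (image_mod p V U (\<lambda>y x. v x y)) \<le> p ^ card B"
    using rank_exists[OF assms, of v] by metis
  have "rank_mod p U V v = card B"
    unfolding rank_mod_def using r(1) prime_gt_1_nat[OF assms(1)] by (auto intro!: the_equality)
  then show "card (image_mod p U V v) = p ^ rank_mod p U V v" "card (kernel_mod p U V v) = p ^ (card U - rank_mod p U V v)"
    "rank_mod p U V v \<le> card U" "card (image_mod p V U (\<lambda>y x. v x y)) \<le> p ^ rank_mod p U V v"
    using r card_mono[OF assms(3) r(3)] by auto
qed

lemma rank_mod_basis:
  assumes "prime p" "finite V" "finite U"
  obtains B w where "B \<subseteq> U" "card B = rank_mod p U V v"
    "\<And>b c. b \<in> B \<Longrightarrow> c \<in> B \<Longrightarrow> [dot_on V (w b) (v c) = (if b = c then 1 else 0)] (mod int p)"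
proof -
  obtain B w where r: "card (image_mod p U V v) = p ^ card B" "B \<subseteq> U"
    "\<And>b c. b \<in> B \<Longrightarrow> c \<in> B \<Longrightarrow> [dot_on V (w b) (v c) = (if b = c then 1 else 0)] (mod int p)"
    by (rule rank_exists[OF assms, of v]) blast
  have "p ^ card B = p ^ rank_mod p U V v" using r(1) card_image_mod[OF assms, of v] by simp
  then have "card B = rank_mod p U V v" using prime_gt_1_nat[OF assms(1)] power_inject_exp by blast
  then show ?thesis using that r(2,3) by blast
qed

lemma rank_mod_transpose:
  assumes "prime p" "finite V" "finite U"
  shows "rank_mod p V U (\<lambda>y x. v x y) = rank_mod p U V v"
proof -
  have 1: "p > 1" using assms prime_gt_1_nat by blast
  have "p ^ rank_mod p V U (\<lambda>y x. v x y) \<le> p ^ rank_mod p U V v"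
    using card_image_mod_transpose[OF assms, of v] card_image_mod[OF assms(1) assms(3,2), of "\<lambda>y x. v x y"] by simp
  moreover have "p ^ rank_mod p U V v \<le> p ^ rank_mod p V U (\<lambda>y x. v x y)"
    using card_image_mod_transpose[OF assms(1) assms(3,2), of "\<lambda>y x. v x y"] card_image_mod[OF assms, of v] by simp
  ultimately show ?thesis using 1 by (metis antisym power_le_imp_le_exp)
qed

section \<open>Kernel and image of the quadric\<close>

text \<open>The component f_J in the decomposition of f as the sum over J of x^J f_J(x^r), where J
  runs through \<open>cube N r\<close>.\<close>

definition residue_component :: "nat \<Rightarrow> (nat \<Rightarrow> nat) \<Rightarrow> ((nat \<Rightarrow> nat) \<Rightarrow> int) \<Rightarrow> (nat \<Rightarrow> nat) \<Rightarrow> int" where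
  "residue_component r J f k = f (\<lambda>i. r * k i + J i)"

abbreviation cube :: "nat \<Rightarrow> nat \<Rightarrow> (nat \<Rightarrow> nat) set" where
  "cube N q \<equiv> xbox N (\<lambda>_. q)"

lemma cube_comb: "J \<in> cube N r \<Longrightarrow> k \<in> cube N q \<Longrightarrow> (\<lambda>i. r * k i + J i) \<in> cube N (r * q)"
proof -
  assume J: "J \<in> cube N r" and k: "k \<in> cube N q"
  have "r * k i + J i < r * q" if "i < N" for i
  proof -
    have "J i < r" "k i < q" using J k that by (auto simp: xbox_def)
    then have "r * k i + J i < r * (k i + 1)" by simp
    also have "\<dots> \<le> r * q" using \<open>k i < q\<close> by (intro mult_le_mono) auto
    finally show ?thesis .
  qed
  then show ?thesis using J k by (auto simp: xbox_def)
qed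

lemma cube_mod: "m \<in> cube N q \<Longrightarrow> 0 < r \<Longrightarrow> (\<lambda>i. m i mod r) \<in> cube N r"
  by (auto simp: xbox_def)

lemma cube_div: "m \<in> cube N (r * q) \<Longrightarrow> 0 < r \<Longrightarrow> (\<lambda>i. m i div r) \<in> cube N q"
  by (auto simp: xbox_def less_mult_imp_div_less mult.commute)

lemma xdeg_comb: "xdeg N (\<lambda>i. r * k i + J i) = r * xdeg N k + xdeg N J"
  by (simp add: xdeg_def sum.distrib sum_distrib_left)

lemma residue_component_psum:
  assumes "0 < r" "\<And>i. i < N \<Longrightarrow> J i < r"
  shows "residue_component r J (psum (r * k0) N f) = psum k0 N (residue_component r J f)"
proof
  fix k
  have "coord_shift (r * k0) i f (\<lambda>i. r * k i + J i) = coord_shift k0 i (residue_component r J f) k" if i: "i < N" for i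
  proof -
    have "r * k i + J i < r * k0 \<longleftrightarrow> k i < k0"
    proof
      assume "r * k i + J i < r * k0"
      then have "r * k i < r * k0" by linarith
      then show "k i < k0" using assms by simp
    next
      assume "k i < k0"
      then have "r * (k i + 1) \<le> r * k0" by (intro mult_le_mono) auto
      then show "r * k i + J i < r * k0" using assms(2)[OF i] by simp
    qed
    moreover have "(\<lambda>j. r * k j + J j)(i := r * k i + J i - r * k0) = (\<lambda>j. r * (k(i := k i - k0)) j + J j)"
      if "\<not> k i < k0"
      using that by (auto simp: fun_eq_iff diff_mult_distrib2)
    ultimately show ?thesis by (auto simp: coord_shift_def residue_component_def)
  qed
  then show "residue_component r J (psum (r * k0) N f) k = psum k0 N (residue_component r J f) k"
    by (simp add: residue_component_def[of r J "psum (r * k0) N f"] psum_def)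
qed

lemma residue_component_psum_pow:
  assumes "0 < r" "\<And>i. i < N \<Longrightarrow> J i < r"
  shows "residue_component r J ((psum (r * k0) N ^^ n) f) = (psum k0 N ^^ n) (residue_component r J f)"
  by (induction n) (simp_all add: residue_component_psum[OF assms])

text \<open>Multiplication by \<open>psum (r * k0) N\<close> preserves the residues of exponents
  modulo r, so preimages may be chosen independently for each residue J and then assembled.\<close>

lemma glue:
  assumes r: "0 < r"
    and h: "\<And>J. J \<in> cube N r \<Longrightarrow> \<exists>h. \<forall>k. (\<lambda>i. r * k i + J i) \<in> cube N q \<longrightarrow>
      r * xdeg N k + xdeg N J + l = e \<longrightarrow> int p dvd residue_component r J f k - (psum k0 N ^^ n) h k"
  obtains g where "\<And>m. m \<in> cube N q \<Longrightarrow> xdeg N m + l = e \<Longrightarrow> int p dvd f m - (psum (r * k0) N ^^ n) g m"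
proof -
  obtain H where H: "\<And>J k. J \<in> cube N r \<Longrightarrow> (\<lambda>i. r * k i + J i) \<in> cube N q \<Longrightarrow>
      r * xdeg N k + xdeg N J + l = e \<Longrightarrow> int p dvd residue_component r J f k - (psum k0 N ^^ n) (H J) k"
  proof -
    have "\<forall>J\<in>cube N r. \<exists>h. \<forall>k. (\<lambda>i. r * k i + J i) \<in> cube N q \<longrightarrow>
      r * xdeg N k + xdeg N J + l = e \<longrightarrow> int p dvd residue_component r J f k - (psum k0 N ^^ n) h k"
      using h by blast
    from bchoice[OF this] show ?thesis using that by blast
  qed
  define g where "g m = H (\<lambda>i. m i mod r) (\<lambda>i. m i div r)" for m
  have "int p dvd f m - (psum (r * k0) N ^^ n) g m" if m: "m \<in> cube N q" "xdeg N m + l = e" for m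
  proof -
    define J where "J = (\<lambda>i. m i mod r)"
    define k where "k = (\<lambda>i. m i div r)"
    have mJ: "m = (\<lambda>i. r * k i + J i)" by (simp add: J_def k_def)
    have J: "J \<in> cube N r" unfolding J_def by (rule cube_mod[OF m(1) r])
    have Jr: "J i < r" for i using r by (simp add: J_def)
    have cg: "residue_component r J g = H J" using Jr r by (auto simp: residue_component_def g_def fun_eq_iff)
    have "r * xdeg N k + xdeg N J + l = e" using m(2) mJ xdeg_comb by metis
    then have "int p dvd residue_component r J f k - (psum k0 N ^^ n) (H J) k"
      using H[OF J] m(1) mJ by metis
    moreover have "(psum k0 N ^^ n) (H J) k = (psum (r * k0) N ^^ n) g m"
      using residue_component_psum_pow[where J=J and N=N and n=n and f=g and ?k0.0=k0, OF r Jr] by (simp add: cg residue_component_def mJ fun_eq_iff)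
    moreover have "residue_component r J f k = f m" by (simp add: residue_component_def mJ)
    ultimately show ?thesis by simp
  qed
  then show ?thesis using that by blast
qed

text \<open>The analogue of \<open>ker_im_box\<close> for the quadric in a cube. For q a power of p
  the opposite inclusion is nilpotency, \<open>psum_nilpotent\<close>.\<close>

definition ker_im :: "nat \<Rightarrow> nat \<Rightarrow> nat \<Rightarrow> nat \<Rightarrow> nat \<Rightarrow> bool" where
  "ker_im p N q a e \<longleftrightarrow> (\<forall>f. (\<forall>m\<in>cube N q. xdeg N m = e + 2 * a \<longrightarrow> int p dvd (psum 2 N ^^ a) f m) \<longrightarrow>
     (\<exists>g. \<forall>m\<in>cube N q. xdeg N m = e \<longrightarrow> int p dvd f m - (psum 2 N ^^ (q - a)) g m))"

text \<open>On the component along a parity vector J the quadric acts as the linear form in the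
  squares. Since 2 k_i + J_i < p means k_i < (p+1)/2 - J_i, the box for k has top degree N(p-1)/2 -
  |J|. With e = 2d + |J| the bound of \<open>ker_im_box_bound\<close> becomes e + a <=
  N(p-1)/2.\<close>

lemma ker_im_prime:
  assumes p: "prime p" "odd p" and a: "a \<le> p" and e: "2 * (e + a) \<le> N * (p - 1)"
  shows "ker_im p N p a e"
  unfolding ker_im_def
proof (intro allI impI)
  fix f assume f: "\<forall>m\<in>cube N p. xdeg N m = e + 2 * a \<longrightarrow> int p dvd (psum 2 N ^^ a) f m"
  have p3: "p \<ge> 3" using p by (metis One_nat_def Suc_leI even_numeral le_neq_implies_less numeral_2_eq_2 numeral_3_eq_3 prime_ge_2_nat)
  have "\<exists>h. \<forall>k. (\<lambda>i. 2 * k i + J i) \<in> cube N p \<longrightarrow>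
      2 * xdeg N k + xdeg N J + 0 = e \<longrightarrow> int p dvd residue_component 2 J f k - (psum 1 N ^^ (p - a)) h k"
    if J: "J \<in> cube N 2" for J
  proof (cases "\<exists>d. 2 * d + xdeg N J = e")
    case False
    then show ?thesis by auto
  next
    case True
    then obtain d where d: "2 * d + xdeg N J = e" by blast
    define b where "b i = (p + 1) div 2 - J i" for i
    have J2: "J i < 2" if "i < N" for i using J that by (auto simp: xbox_def)
    have b1: "1 \<le> b i \<and> b i \<le> p" if "i < N" for i
      using J2[OF that] p3 by (auto simp: b_def)
    have iff: "(\<lambda>i. 2 * k i + J i) \<in> cube N p \<longleftrightarrow> k \<in> xbox N b" for k
    proof -
      have "2 * k i + J i < p \<longleftrightarrow> k i < b i" if "i < N" for i
        using J2[OF that] p(2) by (auto simp: b_def elim!: oddE)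
      moreover have "J i = 0" if "i \<ge> N" for i using J that by (auto simp: xbox_def)
      ultimately show ?thesis by (auto simp: xbox_def)
    qed
    have bs: "2 * d + a \<le> (\<Sum>i<N. b i - 1)"
    proof -
      have "(\<Sum>i<N. b i - 1) + xdeg N J = (\<Sum>i<N. (p - 1) div 2)"
        unfolding xdeg_def sum.distrib[symmetric]
      proof (intro sum.cong refl)
        fix i assume "i \<in> {..<N}"
        then have "J i = 0 \<or> J i = 1" using J2[of i] by auto
        then show "b i - 1 + J i = (p - 1) div 2" using p(2) p3 by (auto simp: b_def elim!: oddE)
      qed
      moreover have "2 * (\<Sum>i<N. (p - 1) div 2) = N * (p - 1)"
        using p(2) by (auto elim!: oddE)
      moreover have "2 * d + a \<le> x" if "x + xdeg N J = z" "2 * z = w" "2 * (e + a) \<le> w" for x z w :: nat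
        using that d by arith
      ultimately show ?thesis using e by blast
    qed
    have "ker_im_box p N b a d" by (rule ker_im_box_bound[OF p(1) b1 a bs])
    moreover have "int p dvd (psum 1 N ^^ a) (residue_component 2 J f) k" if k: "k \<in> xbox N b" "xdeg N k = d + a" for k
    proof -
      have "int p dvd (psum 2 N ^^ a) f (\<lambda>i. 2 * k i + J i)"
        using f iff k d by (auto simp: xdeg_comb)
      then show ?thesis using residue_component_psum_pow[where r=2 and N=N and J=J and ?k0.0=1 and n=a and f=f] J2 by (simp add: residue_component_def fun_eq_iff)
    qed
    ultimately obtain g where "\<forall>m\<in>xbox N b. xdeg N m = d \<longrightarrow> int p dvd residue_component 2 J f m - (psum 1 N ^^ (p - a)) g m"
      unfolding ker_im_box_def by blast
    then show ?thesis using iff d by (intro exI[of _ g]) auto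
  qed
  from glue[where r=2 and N=N and q=p and l=0 and e=e and p=p and f=f and ?k0.0=1 and n="p - a", OF _ this]
  obtain g where "\<And>m. m \<in> cube N p \<Longrightarrow> xdeg N m + 0 = e \<Longrightarrow> int p dvd f m - (psum (2 * 1) N ^^ (p - a)) g m"
    by auto
  then show "\<exists>g. \<forall>m\<in>cube N p. xdeg N m = e \<longrightarrow> int p dvd f m - (psum 2 N ^^ (p - a)) g m"
    by (intro exI[of _ g]) simp
qed

section \<open>Binomial expansion and the Frobenius congruence\<close>

lemma psum_pow_binomial:
  "(psum k (Suc N) ^^ n) f m = (\<Sum>j\<le>n. int (n choose j) * (psum k N ^^ j) (coord_shift (k * (n - j)) N f) m)"
proof (induction n arbitrary: m)
  case 0
  then show ?case by (simp add: coord_shift_def)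
next
  case (Suc n)
  define F where "F a b = (psum k N ^^ a) (coord_shift (k * b) N f) m" for a b
  have A: "psum k (Suc N) g m = psum k N g m + coord_shift k N g m" for g by (simp add: psum_def)
  have shsh: "coord_shift k N (coord_shift l N f) = coord_shift (k + l) N f" for l
    by (auto simp: coord_shift_def fun_eq_iff add.commute)
  have "(psum k (Suc N) ^^ Suc n) f m = psum k (Suc N) (\<lambda>m. \<Sum>j\<le>n. int (n choose j) * (psum k N ^^ j) (coord_shift (k * (n - j)) N f) m) m"
  proof -
    have "(psum k (Suc N) ^^ n) f = (\<lambda>m. \<Sum>j\<le>n. int (n choose j) * (psum k N ^^ j) (coord_shift (k * (n - j)) N f) m)"
      using Suc.IH by (rule ext)
    then show ?thesis by simp
  qed
  also have "\<dots> = (\<Sum>j\<le>n. int (n choose j) * psum k (Suc N) ((psum k N ^^ j) (coord_shift (k * (n - j)) N f)) m)"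
  proof -
    have "psum k M (\<lambda>m. \<Sum>j\<in>S. c j * g j m) m = (\<Sum>j\<in>S. c j * psum k M (g j) m)" for M S c and g :: "nat \<Rightarrow> (nat \<Rightarrow> nat) \<Rightarrow> int"
      unfolding psum_def coord_shift_sum sum_distrib_left
      by (subst sum.swap) (simp add: coord_shift_cmult)
    then show ?thesis .
  qed
  also have "\<dots> = (\<Sum>j\<le>n. int (n choose j) * (F (Suc j) (n - j) + F j (Suc n - j)))"
  proof (rule sum.cong[OF refl])
    fix j assume "j \<in> {..n}"
    then have "Suc n - j = Suc (n - j)" by simp
    then have "coord_shift k N ((psum k N ^^ j) (coord_shift (k * (n - j)) N f)) m = F j (Suc n - j)"
      by (simp add: coord_shift_psum_pow shsh F_def)
    then show "int (n choose j) * psum k (Suc N) ((psum k N ^^ j) (coord_shift (k * (n - j)) N f)) m =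
       int (n choose j) * (F (Suc j) (n - j) + F j (Suc n - j))"
      by (simp add: A F_def)
  qed
  also have "\<dots> = (\<Sum>j\<le>n. int (n choose j) * F (Suc j) (n - j)) + (\<Sum>j\<le>Suc n. int (n choose j) * F j (Suc n - j))"
    by (simp add: distrib_left sum.distrib)
  also have "(\<Sum>j\<le>Suc n. int (n choose j) * F j (Suc n - j)) = F 0 (Suc n) + (\<Sum>j\<le>n. int (n choose Suc j) * F (Suc j) (n - j))"
    by (subst sum.atMost_Suc_shift) simp
  also have "(\<Sum>j\<le>n. int (n choose j) * F (Suc j) (n - j)) + (F 0 (Suc n) + (\<Sum>j\<le>n. int (n choose Suc j) * F (Suc j) (n - j)))
      = F 0 (Suc n) + (\<Sum>j\<le>n. int (Suc n choose Suc j) * F (Suc j) (n - j))"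
    by (simp add: sum.distrib distrib_right)
  also have "\<dots> = (\<Sum>j\<le>Suc n. int (Suc n choose j) * F j (Suc n - j))"
    by (simp add: sum.atMost_Suc_shift del: sum.atMost_Suc)
  finally show ?case by (simp add: F_def)
qed

lemma psum_frobenius:
  assumes p: "prime p"
  shows "int p dvd (psum k N ^^ p) f m - psum (k * p) N f m"
proof (induction N arbitrary: f m)
  case 0
  have "(psum k 0 ^^ p) f m = 0" using prime_gt_0_nat[OF p] by (cases p) (simp_all add: psum_def[of k 0])
  then show ?case by (simp add: psum_def[of "k * p" 0])
next
  case (Suc N)
  have p1: "p > 1" using p by (rule prime_gt_1_nat)
  let ?g = "\<lambda>j. int (p choose j) * (psum k N ^^ j) (coord_shift (k * (p - j)) N f) m"
  have "(\<Sum>j\<le>p. ?g j) = ?g 0 + ?g p + (\<Sum>j\<in>{0<..<p}. ?g j)"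
  proof -
    have "{..p} = insert 0 (insert p {0<..<p})" using p1 by auto
    then show ?thesis using p1 by simp
  qed
  moreover have d: "int p dvd (\<Sum>j\<in>{0<..<p}. ?g j)"
  proof (rule dvd_sum)
    fix j assume "j \<in> {0<..<p}"
    then have "p dvd (p choose j)" using p by (intro dvd_choose_prime) auto
    then show "int p dvd ?g j" by (simp add: dvd_mult2)
  qed
  moreover have "?g 0 = coord_shift (k * p) N f m" by simp
  moreover have "?g p = (psum k N ^^ p) f m"
  proof -
    have "coord_shift 0 N f = f" by (simp add: coord_shift_def fun_eq_iff)
    then show ?thesis by simp
  qed
  moreover have "psum (k * p) (Suc N) f m = psum (k * p) N f m + coord_shift (k * p) N f m" by (simp add: psum_def)
  moreover note psum_pow_binomial[where n=p and k=k and N=N and f=f and m=m] Suc.IH[of f m]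
  ultimately have e: "(psum k (Suc N) ^^ p) f m - psum (k * p) (Suc N) f m
     = ((psum k N ^^ p) f m - psum (k * p) N f m) + (\<Sum>j\<in>{0<..<p}. ?g j)" by simp
  show ?case unfolding e by (rule dvd_add[OF Suc.IH d])
qed

lemma psum_frobenius_pow:
  assumes p: "prime p"
  shows "int p dvd (psum k N ^^ (p * n)) f m - (psum (k * p) N ^^ n) f m"
proof (induction n arbitrary: m)
  case (Suc n)
  have 1: "(psum k N ^^ (p * Suc n)) f = (psum k N ^^ p) ((psum k N ^^ (p * n)) f)"
    by (simp add: funpow_add)
  have 2: "int p dvd (psum k N ^^ p) ((psum k N ^^ (p * n)) f) m - (psum k N ^^ p) ((psum (k * p) N ^^ n) f) m"
    using psum_pow_dvd[of "int p" "\<lambda>m. (psum k N ^^ (p * n)) f m - (psum (k * p) N ^^ n) f m" p k N] Suc.IH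
    by (simp add: psum_pow_diff)
  have 3: "int p dvd (psum k N ^^ p) ((psum (k * p) N ^^ n) f) m - (psum (k * p) N ^^ Suc n) f m"
    using psum_frobenius[OF p, of k N "(psum (k * p) N ^^ n) f" m] by simp
  from dvd_add[OF 2 3] show ?case unfolding 1 by simp
qed simp

lemma psum_expand: "psum k N F m = (\<Sum>i<N. if m i < k then 0 else F (m(i := m i - k)))"
  by (simp add: psum_def coord_shift_def)

lemma finite_cube: "finite (cube N q)"
proof -
  have "cube N q \<subseteq> (\<lambda>f i. if i < N then f i else 0) ` ({..<N} \<rightarrow>\<^sub>E {..<q})"
  proof
    fix m assume m: "m \<in> cube N q"
    then have "m = (\<lambda>i. if i < N then restrict m {..<N} i else 0)" "restrict m {..<N} \<in> {..<N} \<rightarrow>\<^sub>E {..<q}"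
      by (auto simp: xbox_def fun_eq_iff)
    then show "m \<in> (\<lambda>f i. if i < N then f i else 0) ` ({..<N} \<rightarrow>\<^sub>E {..<q})" by blast
  qed
  then show ?thesis by (rule finite_subset) (simp add: finite_PiE)
qed

text \<open>Injectivity makes the columns of Q independent, so the dual functional of the column J
  reads off the coefficient at J. The weights \<open>w\<close> do not depend on F;
  \<open>propagate\<close> applies them to a whole family of F, one for each exponent k.\<close>

lemma left_inverse:
  assumes p: "prime p"
    and inj: "\<forall>F. (\<forall>m\<in>cube N q. xdeg N m = t + 2 \<longrightarrow> int p dvd psum 2 N F m) \<longrightarrow>
      (\<forall>m\<in>cube N q. xdeg N m = t \<longrightarrow> int p dvd F m)"
    and J: "J \<in> cube N q" "xdeg N J = t"
  obtains w where "\<And>F. int p dvd (\<Sum>M\<in>{M\<in>cube N q. xdeg N M = t + 2}. w M * psum 2 N F M) - F J"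
proof -
  define U where "U = {m\<in>cube N q. xdeg N m = t}"
  define Y where "Y = {m\<in>cube N q. xdeg N m = t + 2}"
  have fX: "finite U" and fY: "finite Y" by (simp_all add: U_def Y_def finite_cube)
  define v where "v x = psum 2 N (\<lambda>m. if m = x then 1 else 0)" for x
  have expand: "psum 2 N F y = (\<Sum>x\<in>U. F x * v x y)" if y: "y \<in> Y" for F y
  proof -
    have "psum 2 N F y = (\<Sum>i<N. if y i < 2 then 0 else (\<Sum>x\<in>U. F x * (if y(i := y i - 2) = x then 1 else 0)))"
      unfolding psum_expand
    proof (intro sum.cong refl if_cong)
      fix i assume i: "i \<in> {..<N}" "\<not> y i < 2"
      have "y(i := y i - 2) \<in> U"
        using y i xdeg_upd_diff[of i N 2 y] xbox_upd_diff[of y N "\<lambda>_. q" i 2] by (simp add: U_def Y_def)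
      then show "F (y(i := y i - 2)) = (\<Sum>x\<in>U. F x * (if y(i := y i - 2) = x then 1 else 0))"
        using fX by (simp add: if_distrib[of "\<lambda>c. _ * c"] sum.delta cong: if_cong)
    qed
    also have "\<dots> = (\<Sum>i<N. \<Sum>x\<in>U. F x * (if y i < 2 then 0 else if y(i := y i - 2) = x then 1 else 0))"
      by (intro sum.cong) auto
    also have "\<dots> = (\<Sum>x\<in>U. F x * v x y)"
      unfolding v_def psum_expand sum_distrib_left by (rule sum.swap)
    finally show ?thesis .
  qed
  obtain B w where BX: "B \<subseteq> U"
    and dual: "\<And>b c. b \<in> B \<Longrightarrow> c \<in> B \<Longrightarrow> [dot_on Y (w b) (v c) = (if b = c then 1 else 0)] (mod int p)"
    and span: "\<And>x y. x \<in> U \<Longrightarrow> y \<in> Y \<Longrightarrow> [v x y = (\<Sum>b\<in>B. dot_on Y (w b) (v x) * v b y)] (mod int p)"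
    using dual_basis[OF p fY fX, of v] by blast
  have "B = U"
  proof (rule ccontr)
    assume "B \<noteq> U"
    then obtain x where x: "x \<in> U" "x \<notin> B" using BX by blast
    \<comment> \<open>A monomial outside the basis yields a linear relation among the columns, hence
      a kernel element with coefficient 1 at x.\<close>
    define F where "F m = (if m = x then 1 else if m \<in> B then - dot_on Y (w m) (v x) else 0)" for m
    have Fx: "F x = 1" by (simp add: F_def)
    have "int p dvd psum 2 N F m" if "m \<in> cube N q" "xdeg N m = t + 2" for m
    proof -
      have m: "m \<in> Y" using that by (simp add: Y_def)
      have "psum 2 N F m = F x * v x m + (\<Sum>y\<in>U - {x}. F y * v y m)"
        unfolding expand[OF m] by (rule sum.remove[OF fX x(1)])
      also have "(\<Sum>y\<in>U - {x}. F y * v y m) = (\<Sum>y\<in>B. F y * v y m)"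
        using BX x fX by (intro sum.mono_neutral_right) (auto simp: F_def)
      also have "\<dots> = - (\<Sum>b\<in>B. dot_on Y (w b) (v x) * v b m)"
        unfolding sum_negf[symmetric] using x by (intro sum.cong) (auto simp: F_def)
      finally have "psum 2 N F m = v x m - (\<Sum>b\<in>B. dot_on Y (w b) (v x) * v b m)" by (simp add: Fx)
      then show ?thesis using span[OF x(1) m] by (simp add: cong_iff_dvd_diff)
    qed
    then have "int p dvd F x" using inj x(1) unfolding U_def by blast
    then show False using prime_gt_1_nat[OF p] by (simp add: F_def)
  qed
  have JX: "J \<in> U" using J by (simp add: U_def)
  show ?thesis
  proof (rule that[of "w J"])
    fix F
    have "(\<Sum>M\<in>Y. w J M * psum 2 N F M) = dot_on Y (w J) (\<lambda>y. \<Sum>x\<in>U. F x * v x y)"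
      unfolding dot_on_def by (intro sum.cong) (auto simp: expand)
    moreover have "[dot_on Y (w J) (\<lambda>y. \<Sum>x\<in>U. F x * v x y) = F J] (mod int p)"
      by (rule dot_on_dual[OF fX _ JX]) (use dual \<open>B = U\<close> JX in auto)
    ultimately show "int p dvd (\<Sum>M\<in>{M\<in>cube N q. xdeg N M = t + 2}. w J M * psum 2 N F M) - F J"
      by (simp add: cong_iff_dvd_diff Y_def)
  qed
qed

text \<open>Meant for the component along a residue of degree r of a polynomial of degree E: its
  exponents k satisfy p |k| + r = E. When no degree |k| solves this equation, the condition is
  void.\<close>

definition in_image :: "nat \<Rightarrow> nat \<Rightarrow> nat \<Rightarrow> nat \<Rightarrow> nat \<Rightarrow> nat \<Rightarrow> ((nat \<Rightarrow> nat) \<Rightarrow> int) \<Rightarrow> bool" where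
  "in_image p N q j r E h \<longleftrightarrow> (\<exists>g. \<forall>k\<in>cube N q. p * xdeg N k + r = E \<longrightarrow> int p dvd h k - (psum 2 N ^^ j) g k)"

lemma in_image_zero: "in_image p N q j r E (\<lambda>_. 0)"
  unfolding in_image_def by (rule exI[of _ "\<lambda>_. 0"]) (simp add: psum_pow_zero)

lemma in_image_add: "in_image p N q j r E f \<Longrightarrow> in_image p N q j r E g \<Longrightarrow> in_image p N q j r E (\<lambda>m. f m + g m)"
proof -
  assume "in_image p N q j r E f" "in_image p N q j r E g"
  then obtain f' g' where
    "\<forall>k\<in>cube N q. p * xdeg N k + r = E \<longrightarrow> int p dvd f k - (psum 2 N ^^ j) f' k"
    "\<forall>k\<in>cube N q. p * xdeg N k + r = E \<longrightarrow> int p dvd g k - (psum 2 N ^^ j) g' k"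
    unfolding in_image_def by blast
  then have "\<forall>k\<in>cube N q. p * xdeg N k + r = E \<longrightarrow>
      int p dvd (f k - (psum 2 N ^^ j) f' k) + (g k - (psum 2 N ^^ j) g' k)"
    by (auto intro: dvd_add)
  then show ?thesis unfolding in_image_def
    by (intro exI[of _ "\<lambda>m. f' m + g' m"]) (simp add: psum_pow_add algebra_simps)
qed

lemma in_image_cmult: "in_image p N q j r E f \<Longrightarrow> in_image p N q j r E (\<lambda>m. c * f m)"
proof -
  assume "in_image p N q j r E f"
  then obtain f' where
    "\<forall>k\<in>cube N q. p * xdeg N k + r = E \<longrightarrow> int p dvd f k - (psum 2 N ^^ j) f' k"
    unfolding in_image_def by blast
  then have "\<forall>k\<in>cube N q. p * xdeg N k + r = E \<longrightarrow> int p dvd c * (f k - (psum 2 N ^^ j) f' k)"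
    by (auto intro: dvd_mult)
  then show ?thesis unfolding in_image_def
    by (intro exI[of _ "\<lambda>m. c * f' m"]) (simp add: psum_pow_cmult right_diff_distrib)
qed

lemma in_image_sum: "(\<And>i. i \<in> A \<Longrightarrow> in_image p N q j r E (f i)) \<Longrightarrow> in_image p N q j r E (\<lambda>m. \<Sum>i\<in>A. f i m)"
proof (induction A rule: infinite_finite_induct)
  case (insert x F)
  then show ?case using in_image_add[of p N q j r E "f x" "\<lambda>m. \<Sum>i\<in>F. f i m"] by simp
qed (simp_all add: in_image_zero)

lemma in_image_cong:
  assumes "in_image p N q j r E f"
    and "\<And>k. k \<in> cube N q \<Longrightarrow> p * xdeg N k + r = E \<Longrightarrow> int p dvd g k - f k"
  shows "in_image p N q j r E g"
proof -
  from assms(1) obtain f' where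
    f': "\<And>k. k \<in> cube N q \<Longrightarrow> p * xdeg N k + r = E \<Longrightarrow> int p dvd f k - (psum 2 N ^^ j) f' k"
    unfolding in_image_def by blast
  have "int p dvd g k - (psum 2 N ^^ j) f' k" if "k \<in> cube N q" "p * xdeg N k + r = E" for k
    using dvd_add[OF assms(2)[OF that] f'[OF that]] by simp
  then show ?thesis unfolding in_image_def by blast
qed

text \<open>A variable at the level of components stands for x_i^p, so it trades residue degree r +
  p for r at fixed total degree.\<close>

lemma in_image_shift:
  assumes "in_image p N q j (r + p) E f" "i < N"
  shows "in_image p N q j r E (coord_shift 1 i f)"
proof -
  from assms(1) obtain f' where
    f': "\<And>k. k \<in> cube N q \<Longrightarrow> p * xdeg N k + (r + p) = E \<Longrightarrow> int p dvd f k - (psum 2 N ^^ j) f' k"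
    unfolding in_image_def by blast
  have "int p dvd coord_shift 1 i f k - (psum 2 N ^^ j) (coord_shift 1 i f') k" if k: "k \<in> cube N q" "p * xdeg N k + r = E" for k
  proof (cases "k i < 1")
    case True
    then show ?thesis by (simp add: coord_shift_psum_pow[symmetric] coord_shift_def)
  next
    case False
    have "xdeg N (k(i := k i - 1)) + 1 = xdeg N k" using False by (intro xdeg_upd_diff[OF assms(2)]) simp
    then have "p * xdeg N (k(i := k i - 1)) + p = p * xdeg N k" by (metis distrib_left mult.right_neutral)
    then have "p * xdeg N (k(i := k i - 1)) + (r + p) = E" using k(2) by simp
    from f'[OF xbox_upd_diff[OF k(1)] this] show ?thesis using False
      by (simp add: coord_shift_psum_pow[symmetric] coord_shift_def)
  qed
  then show ?thesis unfolding in_image_def by blast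
qed

text \<open>Subtracting 2 from an exponent with residue below 2 borrows from the quotient: the
  residue becomes M_i + p - 2 and the quotient drops by one. These wrap-around terms form the second
  sum.\<close>

lemma residue_component_psum2:
  assumes p: "2 \<le> p" and M: "M \<in> cube N p"
  shows "residue_component p M (psum 2 N f) k = psum 2 N (\<lambda>J. residue_component p J f k) M
    + (\<Sum>i | i < N \<and> M i < 2. coord_shift 1 i (residue_component p (M(i := M i + p - 2)) f) k)"
proof -
  have "residue_component p M (psum 2 N f) k = (\<Sum>i<N. coord_shift 2 i f (\<lambda>i. p * k i + M i))"
    by (simp add: residue_component_def psum_def)
  also have "\<dots> = (\<Sum>i<N. (if M i < 2 then 0 else residue_component p (M(i := M i - 2)) f k)
      + (if M i < 2 then coord_shift 1 i (residue_component p (M(i := M i + p - 2)) f) k else 0))"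
  proof (rule sum.cong[OF refl])
    fix i assume "i \<in> {..<N}"
    show "coord_shift 2 i f (\<lambda>i. p * k i + M i) = (if M i < 2 then 0 else residue_component p (M(i := M i - 2)) f k)
      + (if M i < 2 then coord_shift 1 i (residue_component p (M(i := M i + p - 2)) f) k else 0)"
    proof (cases "M i < 2")
      case False
      then have "(\<lambda>i. p * k i + M i)(i := p * k i + M i - 2) = (\<lambda>j. p * k j + (M(i := M i - 2)) j)"
        by (auto simp: fun_eq_iff)
      then show ?thesis using False by (simp add: coord_shift_def residue_component_def)
    next
      case True
      show ?thesis
      proof (cases "k i = 0")
        case False
        then have "p * k i = p * (k i - 1) + p" by (cases "k i") auto
        moreover have "p * k i \<ge> 2" using False p by (cases "k i") auto
        ultimately have "(\<lambda>i. p * k i + M i)(i := p * k i + M i - 2) = (\<lambda>j. p * (k(i := k i - 1)) j + (M(i := M i + p - 2)) j)"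
          using p by (auto simp: fun_eq_iff)
        then show ?thesis using True False \<open>p * k i \<ge> 2\<close> by (simp add: coord_shift_def residue_component_def)
      qed (use True in \<open>simp add: coord_shift_def\<close>)
    qed
  qed
  also have "\<dots> = psum 2 N (\<lambda>J. residue_component p J f k) M
    + (\<Sum>i | i < N \<and> M i < 2. coord_shift 1 i (residue_component p (M(i := M i + p - 2)) f) k)"
    by (simp add: sum.distrib psum_expand sum.inter_filter[symmetric] lessThan_def)
  finally show ?thesis .
qed

text \<open>Downward induction on |J|. Below degree 2(p-1), multiplication by Q on
  \<open>cube N p\<close> is injective: its kernel is an image of Q^(p-1), which starts in degree
  2(p-1), and \<open>4 \<le> N\<close> keeps these degrees in the range of
  \<open>ker_im_prime\<close>. The left inverse expresses f_J through components of Qf and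
  wrap-around terms, whose residues have the larger degree |J| + p.\<close>

lemma propagate:
  assumes p: "prime p" "odd p" and N: "4 \<le> N"
    and Q: "\<And>M. M \<in> cube N p \<Longrightarrow> in_image p N q j (xdeg N M) (E + 2) (residue_component p M (psum 2 N f))"
    and top: "\<And>J. J \<in> cube N p \<Longrightarrow> 2 * (p - 1) \<le> xdeg N J \<Longrightarrow> in_image p N q j (xdeg N J) E (residue_component p J f)"
    and J: "J \<in> cube N p"
  shows "in_image p N q j (xdeg N J) E (residue_component p J f)"
  using J
proof (induction "2 * p - xdeg N J" arbitrary: J rule: less_induct)
  case less
  have p2: "2 \<le> p" using p(1) by (rule prime_ge_2_nat)
  show ?case
  proof (cases "2 * (p - 1) \<le> xdeg N J")
    case True
    then show ?thesis using top less.prems by blast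
  next
    case False
    define t where "t = xdeg N J"
    have ki: "ker_im p N p 1 t"
    proof (rule ker_im_prime[OF p])
      have "2 * (t + 1) \<le> 4 * (p - 1)" using False p2 by (simp add: t_def)
      also have "\<dots> \<le> N * (p - 1)" using N by (rule mult_le_mono1)
      finally show "2 * (t + 1) \<le> N * (p - 1)" .
    qed (use p2 in simp)
    have inj: "\<forall>F. (\<forall>m\<in>cube N p. xdeg N m = t + 2 \<longrightarrow> int p dvd psum 2 N F m) \<longrightarrow>
      (\<forall>m\<in>cube N p. xdeg N m = t \<longrightarrow> int p dvd F m)"
    proof (intro allI impI ballI)
      fix F m assume F: "\<forall>m\<in>cube N p. xdeg N m = t + 2 \<longrightarrow> int p dvd psum 2 N F m"
        and m: "m \<in> cube N p" "xdeg N m = t"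
      have "\<forall>m\<in>cube N p. xdeg N m = t + 2 * 1 \<longrightarrow> int p dvd (psum 2 N ^^ 1) F m" using F by simp
      then obtain g where "\<forall>m\<in>cube N p. xdeg N m = t \<longrightarrow> int p dvd F m - (psum 2 N ^^ (p - 1)) g m"
        using ki unfolding ker_im_def by blast
      moreover have "(psum 2 N ^^ (p - 1)) g m = 0"
        by (rule psum_pow_low) (use False m in \<open>simp add: t_def\<close>)
      ultimately show "int p dvd F m" using m by auto
    qed
    define Y where "Y = {M\<in>cube N p. xdeg N M = t + 2}"
    obtain w where w: "\<And>F. int p dvd (\<Sum>M\<in>Y. w M * psum 2 N F M) - F J"
      using left_inverse[where q=p and N=N and t=t and J=J and p=p, OF p(1) inj less.prems t_def[symmetric]]
      unfolding Y_def by blast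
    define R where "R M k = (\<Sum>i | i < N \<and> M i < 2. coord_shift 1 i (residue_component p (M(i := M i + p - 2)) f) k)" for M k
    have "in_image p N q j t E (\<lambda>k. (\<Sum>M\<in>Y. w M * residue_component p M (psum 2 N f) k) + (\<Sum>M\<in>Y. (- w M) * R M k))"
    proof (intro in_image_add in_image_sum in_image_cmult)
      fix M assume "M \<in> Y"
      then have M: "M \<in> cube N p" "xdeg N M = t + 2" by (auto simp: Y_def)
      show "in_image p N q j t E (residue_component p M (psum 2 N f))"
        using Q[OF M(1)] unfolding in_image_def M(2) by simp
      show "in_image p N q j t E (R M)"
        unfolding R_def[abs_def]
      proof (intro in_image_sum)
        fix i assume "i \<in> {i. i < N \<and> M i < 2}"
        then have i: "i < N" "M i < 2" by auto
        let ?M = "M(i := M i + p - 2)"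
        have "?M = M(i := M i + (p - 2))" using p2 by simp
        then have d: "xdeg N ?M = t + p" using xdeg_upd_add[OF i(1), of M "p - 2"] M(2) p2 by simp
        have "?M \<in> cube N p" using M(1) i p2 by (auto simp: xbox_def)
        moreover have "2 * p - xdeg N ?M < 2 * p - xdeg N J"
          using d False p2 by (simp add: t_def)
        ultimately have "in_image p N q j (t + p) E (residue_component p ?M f)" using less.hyps d by metis
        then show "in_image p N q j t E (coord_shift 1 i (residue_component p ?M f))" by (rule in_image_shift[OF _ i(1)])
      qed
    qed
    then show ?thesis
      unfolding t_def
    proof (rule in_image_cong)
      fix k
      have "(\<Sum>M\<in>Y. w M * residue_component p M (psum 2 N f) k) + (\<Sum>M\<in>Y. (- w M) * R M k)
        = (\<Sum>M\<in>Y. w M * psum 2 N (\<lambda>J. residue_component p J f k) M)"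
        unfolding sum.distrib[symmetric]
        by (intro sum.cong refl) (auto simp: Y_def residue_component_psum2[OF p2] R_def algebra_simps)
      then show "int p dvd residue_component p J f k - ((\<Sum>M\<in>Y. w M * residue_component p M (psum 2 N f) k) + (\<Sum>M\<in>Y. (- w M) * R M k))"
        using w[of "\<lambda>J. residue_component p J f k"] by (simp add: dvd_diff_commute)
    qed
  qed
qed

text \<open>Modulo p, Q^(pa) is the a-th power of the sum of the x_i^(2p), which acts on each
  component as Q^a. So the hypothesis descends to f_J, where the property at level q
  applies.\<close>

lemma comp_ker:
  assumes p: "prime p" and J: "J \<in> cube N p"
    and f: "\<And>m. m \<in> cube N (p * q) \<Longrightarrow> xdeg N m = E + 2 * p * a \<Longrightarrow> int p dvd (psum 2 N ^^ (p * a)) f m"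
    and k: "\<And>r. p * r + xdeg N J = E \<Longrightarrow> ker_im p N q a r"
  shows "in_image p N q (q - a) (xdeg N J) E (residue_component p J f)"
proof (cases "\<exists>r. p * r + xdeg N J = E")
  case False
  then show ?thesis unfolding in_image_def by auto
next
  case True
  then obtain r where r: "p * r + xdeg N J = E" by blast
  have p0: "0 < p" using p by (rule prime_gt_0_nat)
  have Jp: "J i < p" if "i < N" for i using J that by (auto simp: xbox_def)
  have "int p dvd (psum 2 N ^^ a) (residue_component p J f) m" if m: "m \<in> cube N q" "xdeg N m = r + 2 * a" for m
  proof -
    let ?m = "\<lambda>i. p * m i + J i"
    have "int p dvd (psum 2 N ^^ (p * a)) f ?m"
    proof (rule f[OF cube_comb[OF J m(1)]])
      show "xdeg N ?m = E + 2 * p * a" unfolding xdeg_comb using r m(2) by (simp add: algebra_simps)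
    qed
    moreover note psum_frobenius_pow[where k=2 and N=N and n=a and f=f and m="?m", OF p]
    ultimately have "int p dvd (psum (2 * p) N ^^ a) f ?m" by (simp add: dvd_diff_right_iff)
    moreover have "(psum 2 N ^^ a) (residue_component p J f) m = (psum (p * 2) N ^^ a) f ?m"
      using residue_component_psum_pow[where r=p and N=N and J=J and ?k0.0=2 and n=a and f=f, OF p0 Jp] by (simp add: residue_component_def fun_eq_iff)
    ultimately show ?thesis by (simp add: mult.commute)
  qed
  then obtain g where g: "\<forall>m\<in>cube N q. xdeg N m = r \<longrightarrow> int p dvd residue_component p J f m - (psum 2 N ^^ (q - a)) g m"
    using k[OF r] unfolding ker_im_def by blast
  have "xdeg N m = r" if "p * xdeg N m + xdeg N J = E" for m
    using that r p0 by (metis add_right_imp_eq mult_cancel1 neq0_conv)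
  then show ?thesis using g unfolding in_image_def by blast
qed

lemma glue_in_image:
  assumes p: "prime p" and im: "\<And>J. J \<in> cube N p \<Longrightarrow> in_image p N q j (xdeg N J) E (residue_component p J f)"
  obtains g where "\<And>m. m \<in> cube N (p * q) \<Longrightarrow> xdeg N m = E \<Longrightarrow> int p dvd f m - (psum 2 N ^^ (p * j)) g m"
proof -
  have p0: "0 < p" using p by (rule prime_gt_0_nat)
  have "\<exists>h. \<forall>k. (\<lambda>i. p * k i + J i) \<in> cube N (p * q) \<longrightarrow>
      p * xdeg N k + xdeg N J + 0 = E \<longrightarrow> int p dvd residue_component p J f k - (psum 2 N ^^ j) h k" if J: "J \<in> cube N p" for J
  proof -
    have "k \<in> cube N q" if "(\<lambda>i. p * k i + J i) \<in> cube N (p * q)" for k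
    proof -
      have "k i < q" if "i < N" for i
      proof -
        have "p * k i + J i < p * q" using \<open>(\<lambda>i. p * k i + J i) \<in> cube N (p * q)\<close> that by (auto simp: xbox_def)
        then have "p * k i < p * q" by linarith
        then show ?thesis by simp
      qed
      moreover have "k i = 0" if "i \<ge> N" for i
      proof -
        have "p * k i + J i = 0" using \<open>(\<lambda>i. p * k i + J i) \<in> cube N (p * q)\<close> that by (auto simp: xbox_def)
        then show ?thesis using p0 by simp
      qed
      ultimately show ?thesis by (simp add: xbox_def)
    qed
    then show ?thesis using im[OF J] unfolding in_image_def by fastforce
  qed
  from glue[where r=p and N=N and q="p * q" and l=0 and e=E and p=p and f=f and ?k0.0=2 and n=j, OF p0 this]
  obtain g where g: "\<And>m. m \<in> cube N (p * q) \<Longrightarrow> xdeg N m = E \<Longrightarrow> int p dvd f m - (psum (p * 2) N ^^ j) g m"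
    by auto
  have "int p dvd f m - (psum 2 N ^^ (p * j)) g m" if "m \<in> cube N (p * q)" "xdeg N m = E" for m
    using dvd_diff[OF g[OF that] psum_frobenius_pow[where k=2 and N=N and n=j and f=g and m=m, OF p]] by (simp add: mult.commute)
  then show ?thesis using that by blast
qed

section \<open>Passage from q to pq\<close>

lemma funpow_pred: "0 < n \<Longrightarrow> (F ^^ (n - 1)) (F x) = (F ^^ n) x"
  by (cases n) (simp_all add: funpow_swap1)

lemma funpow_comp: "(F ^^ a) ((F ^^ b) x) = (F ^^ (a + b)) x"
  by (simp add: funpow_add)

text \<open>If |J| >= 2(p-1), then Q kills f_J because Q^p f = 0, and p(r+2) <= e+2 is exactly what
  the threshold b requires. The remaining components follow by \<open>propagate\<close>, since those
  of Qf vanish. This gives f = Q^(p(q-1)) b1, which is p-1 powers short. Now Q^(p(q-1)) kills Q b1,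
  so the property of Q^(q-1) gives Q b1 = Q^p b2, and f = Q^(pq-1) b2.\<close>

lemma ker_im_step1:
  assumes p: "prime p" "odd p" and N: "4 \<le> N" and q: "2 \<le> q" and bc: "c + 2 * q = b"
    and H1: "\<And>e. 2 * (e + 2) < b \<Longrightarrow> ker_im p N q 1 e"
    and H2: "\<And>e. 2 * e < c \<Longrightarrow> ker_im p N q (q - 1) e"
    and e: "2 * (e + 2) < p * b"
  shows "ker_im p N (p * q) 1 e"
  unfolding ker_im_def
proof (intro allI impI)
  fix f
  let ?Q = "psum 2 N"
  assume "\<forall>m\<in>cube N (p * q). xdeg N m = e + 2 * 1 \<longrightarrow> int p dvd (?Q ^^ 1) f m"
  then have f: "\<And>m. m \<in> cube N (p * q) \<Longrightarrow> xdeg N m = e + 2 \<Longrightarrow> int p dvd ?Q f m" by simp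
  have p2: "2 \<le> p" using p(1) by (rule prime_ge_2_nat)
  have top: "in_image p N q (q - 1) (xdeg N J) e (residue_component p J f)" if J: "J \<in> cube N p" "2 * (p - 1) \<le> xdeg N J" for J
  proof (rule comp_ker[OF p(1) J(1)])
    fix m assume m: "m \<in> cube N (p * q)" "xdeg N m = e + 2 * p * 1"
    have "int p dvd (?Q ^^ (p - 1)) (?Q f) m"
      by (rule psum_pow_dvd_local[where b="\<lambda>_. p * q" and l=0 and e="e + 2"])
        (use f m p2 in \<open>auto simp: right_diff_distrib'\<close>)
    then show "int p dvd (?Q ^^ (p * 1)) f m" using p2 by (simp add: funpow_pred del: One_nat_def)
  next
    fix r assume r: "p * r + xdeg N J = e"
    have "p * (2 * (r + 2)) \<le> 2 * (e + 2)" using r J(2) p2 by (simp add: algebra_simps)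
    then have "p * (2 * (r + 2)) < p * b" using e by linarith
    then show "ker_im p N q 1 r" by (intro H1) (simp only: mult_less_cancel1)
  qed
  have "in_image p N q (q - 1) (xdeg N J) e (residue_component p J f)" if J: "J \<in> cube N p" for J
  proof (rule propagate[OF p N _ top J])
    fix M assume M: "M \<in> cube N p"
    show "in_image p N q (q - 1) (xdeg N M) (e + 2) (residue_component p M (?Q f))"
    proof (rule in_image_cong[OF in_image_zero])
      fix k assume "k \<in> cube N q" "p * xdeg N k + xdeg N M = e + 2"
      then show "int p dvd residue_component p M (?Q f) k - 0"
        using f[OF cube_comb[OF M, of k]] by (simp add: residue_component_def xdeg_comb)
    qed
  qed
  from glue_in_image[OF p(1) this] obtain b1 where
    b1: "\<And>m. m \<in> cube N (p * q) \<Longrightarrow> xdeg N m = e \<Longrightarrow> int p dvd f m - (?Q ^^ (p * (q - 1))) b1 m"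
    by blast
  define l where "l = 2 * (p * (q - 1))"
  have pq: "p * q = p * (q - 1) + p" using q by (cases q) auto
  show "\<exists>g. \<forall>m\<in>cube N (p * q). xdeg N m = e \<longrightarrow> int p dvd f m - (?Q ^^ (p * q - 1)) g m"
  proof (cases "e + 2 < l")
    \<comment> \<open>The degree is too low for a multiple of Q^(p(q-1)), so f itself vanishes
      there.\<close>
    case True
    have "int p dvd f m - (?Q ^^ (p * q - 1)) (\<lambda>_. 0) m" if "m \<in> cube N (p * q)" "xdeg N m = e" for m
    proof -
      have "(?Q ^^ (p * (q - 1))) b1 m = 0" by (rule psum_pow_low) (use True that in \<open>simp add: l_def\<close>)
      then show ?thesis using b1[OF that] by (simp add: psum_pow_zero)
    qed
    then show ?thesis by blast
  next
    case False
    define E where "E = e + 2 - l"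
    have El: "E + l = e + 2" using False by (simp add: E_def)
    have "in_image p N q (q - (q - 1)) (xdeg N J) E (residue_component p J (?Q b1))" if J: "J \<in> cube N p" for J
    proof (rule comp_ker[OF p(1) J])
      fix m assume m: "m \<in> cube N (p * q)" "xdeg N m = E + 2 * p * (q - 1)"
      then have m2: "xdeg N m = e + 2" using El by (simp add: l_def)
      have "int p dvd psum 2 N (\<lambda>m. f m - (?Q ^^ (p * (q - 1))) b1 m) m"
        by (rule psum_dvd_local[where b="\<lambda>_. p * q" and l=0 and e=e]) (use b1 m m2 in auto)
      then have "int p dvd ?Q f m - (?Q ^^ (p * (q - 1))) (?Q b1) m"
        by (simp add: psum_diff funpow_swap1)
      then show "int p dvd (?Q ^^ (p * (q - 1))) (?Q b1) m"
        using f[OF m(1) m2] by (simp add: dvd_diff_right_iff)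
    next
      fix r assume r: "p * r + xdeg N J = E"
      have "p * (2 * r) + 2 * l \<le> 2 * (e + 2)" using r El by simp
      then have "p * (2 * r) + 2 * l < p * c + 2 * (p * q)" using e bc by (simp add: algebra_simps flip: bc)
      moreover have "2 * (p * q) \<le> 2 * l" using q p2 by (simp add: l_def)
      ultimately have "p * (2 * r) < p * c" by linarith
      then show "ker_im p N q (q - 1) r" by (intro H2) simp
    qed
    then have "in_image p N q 1 (xdeg N J) E (residue_component p J (?Q b1))" if J: "J \<in> cube N p" for J
      using J q by simp
    from glue_in_image[OF p(1) this] obtain b2 where
      b2: "\<And>m. m \<in> cube N (p * q) \<Longrightarrow> xdeg N m = E \<Longrightarrow> int p dvd ?Q b1 m - (?Q ^^ (p * 1)) b2 m" by blast
    have "int p dvd f m - (?Q ^^ (p * q - 1)) b2 m" if m: "m \<in> cube N (p * q)" "xdeg N m = e" for m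
    proof -
      have pos: "0 < p * (q - 1)" using p2 q by simp
      have "e = E + 2 * (U - 1)" if "E + 2 * U = e + 2" "0 < U" for U using that by arith
      from this[OF El[unfolded l_def] pos] have ee: "e = E + 2 * (p * (q - 1) - 1)" .
      have "int p dvd (?Q ^^ (p * (q - 1) - 1)) (\<lambda>m. ?Q b1 m - (?Q ^^ (p * 1)) b2 m) m"
        by (rule psum_pow_dvd_local[where b="\<lambda>_. p * q" and l=0 and e=E])
          (use b2 m ee in auto)
      then have "int p dvd (?Q ^^ (p * (q - 1))) b1 m - (?Q ^^ (p * q - 1)) b2 m"
        using pos pq by (simp add: psum_pow_diff funpow_pred funpow_comp del: One_nat_def)
      from dvd_add[OF b1[OF m] this] show ?thesis by simp
    qed
    then show ?thesis by blast
  qed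
qed

text \<open>Put g = Q^(p-1) f. The components of Qg = Q^p f are Q times those of f, and the
  components of g with |J| >= 2(p-1) are killed by Q^(q-1), hence are images of Q. So
  \<open>propagate\<close> yields g = Q^p h. Then f' = f - Qh is killed by Q^p, the property of Q
  applies to its components, and f' = Q^(p(q-1)) g2. Thus f is a multiple of Q.\<close>

lemma ker_im_step2:
  assumes p: "prime p" "odd p" and N: "4 \<le> N" and q: "2 \<le> q" and bc: "c + 2 * q = b"
    and H1: "\<And>e. 2 * (e + 2) < b \<Longrightarrow> ker_im p N q 1 e"
    and H2: "\<And>e. 2 * e < c \<Longrightarrow> ker_im p N q (q - 1) e"
    and e: "2 * e < p * c"
  shows "ker_im p N (p * q) (p * q - 1) e"
  unfolding ker_im_def
proof (intro allI impI)
  fix f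
  let ?Q = "psum 2 N"
  assume f: "\<forall>m\<in>cube N (p * q). xdeg N m = e + 2 * (p * q - 1) \<longrightarrow> int p dvd (?Q ^^ (p * q - 1)) f m"
  have p2: "2 \<le> p" using p(1) by (rule prime_ge_2_nat)
  have pq: "p * q = p * (q - 1) + p" using q by (cases q) auto
  define g where "g = (?Q ^^ (p - 1)) f"
  define E where "E = e + 2 * (p - 1)"
  have top: "in_image p N q 1 (xdeg N J) E (residue_component p J g)" if J: "J \<in> cube N p" "2 * (p - 1) \<le> xdeg N J" for J
  proof -
    have "in_image p N q (q - (q - 1)) (xdeg N J) E (residue_component p J g)"
    proof (rule comp_ker[OF p(1) J(1)])
      fix m assume m: "m \<in> cube N (p * q)" "xdeg N m = E + 2 * p * (q - 1)"
      have "xdeg N m = e + 2 * (p * q - 1)" using m(2) p2 pq by (simp add: E_def)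
      then have "int p dvd (?Q ^^ (p * q - 1)) f m" using f m(1) by blast
      moreover have "(?Q ^^ (p * (q - 1))) g = (?Q ^^ (p * q - 1)) f"
        using p2 pq by (simp add: g_def funpow_comp)
      ultimately show "int p dvd (?Q ^^ (p * (q - 1))) g m" by simp
    next
      fix r assume r: "p * r + xdeg N J = E"
      have "p * (2 * r) \<le> 2 * e" using r J(2) by (simp add: E_def)
      then have "p * (2 * r) < p * c" using e by linarith
      then show "ker_im p N q (q - 1) r" by (intro H2) simp
    qed
    then show ?thesis using q by simp
  qed
  have "in_image p N q 1 (xdeg N J) E (residue_component p J g)" if J: "J \<in> cube N p" for J
  proof (rule propagate[OF p N _ top J])
    fix M assume M: "M \<in> cube N p"
    have Mp: "M i < p" if "i < N" for i using M that by (auto simp: xbox_def)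
    have Qg: "?Q g = (?Q ^^ p) f" unfolding g_def using p2 by (metis Suc_pred' funpow.simps(2) comp_apply less_le_trans pos2)
    have "int p dvd residue_component p M (?Q g) k - (psum 2 N ^^ 1) (residue_component p M f) k" for k
    proof -
      have "(psum 2 N ^^ 1) (residue_component p M f) k = residue_component p M (psum (p * 2) N f) k"
        using p2 by (simp add: residue_component_psum[where r=p and N=N and J=M, OF _ Mp])
      moreover have "int p dvd (?Q ^^ p) f (\<lambda>i. p * k i + M i) - psum (2 * p) N f (\<lambda>i. p * k i + M i)"
        by (rule psum_frobenius[OF p(1)])
      ultimately show ?thesis unfolding Qg by (simp add: residue_component_def mult.commute)
    qed
    then show "in_image p N q 1 (xdeg N M) (E + 2) (residue_component p M (?Q g))" unfolding in_image_def by blast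
  qed
  from glue_in_image[OF p(1) this] obtain h where
    h: "\<And>m. m \<in> cube N (p * q) \<Longrightarrow> xdeg N m = E \<Longrightarrow> int p dvd g m - (?Q ^^ (p * 1)) h m" by blast
  define f' where "f' m = f m - ?Q h m" for m
  have f': "int p dvd (?Q ^^ (p - 1)) f' m" if "m \<in> cube N (p * q)" "xdeg N m = E" for m
    using h[OF that] p2 by (simp add: f'_def[abs_def] psum_pow_diff funpow_pred g_def del: One_nat_def)
  have "in_image p N q (q - 1) (xdeg N J) e (residue_component p J f')" if J: "J \<in> cube N p" for J
  proof (rule comp_ker[OF p(1) J])
    fix m assume m: "m \<in> cube N (p * q)" "xdeg N m = e + 2 * p * 1"
    have "int p dvd ?Q ((?Q ^^ (p - 1)) f') m"
      by (rule psum_dvd_local[where b="\<lambda>_. p * q" and l=0 and e=E]) (use f' m p2 in \<open>auto simp: E_def\<close>)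
    moreover have "?Q ((?Q ^^ (p - 1)) f') = (?Q ^^ (p * 1)) f'"
      using p2 by (metis Suc_pred' funpow.simps(2) comp_apply less_le_trans mult.right_neutral pos2)
    ultimately show "int p dvd (?Q ^^ (p * 1)) f' m" by simp
  next
    fix r assume r: "p * r + xdeg N J = e"
    have "p * (2 * r) \<le> 2 * e" using r by simp
    then have "p * (2 * r) < p * c" using e by linarith
    then have "2 * r < c" by simp
    then show "ker_im p N q 1 r" using q bc by (intro H1) simp
  qed
  from glue_in_image[OF p(1) this] obtain g2 where
    g2: "\<And>m. m \<in> cube N (p * q) \<Longrightarrow> xdeg N m = e \<Longrightarrow> int p dvd f' m - (?Q ^^ (p * (q - 1))) g2 m" by blast
  have "int p dvd f m - (?Q ^^ (p * q - (p * q - 1))) (\<lambda>m. h m + (?Q ^^ (p * (q - 1) - 1)) g2 m) m"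
    if m: "m \<in> cube N (p * q)" "xdeg N m = e" for m
  proof -
    have pos: "0 < p * (q - 1)" using p2 q by simp
    have 1: "p * q - (p * q - 1) = 1" using p2 q by simp
    have 2: "?Q ((?Q ^^ (p * (q - 1) - 1)) g2) = (?Q ^^ (p * (q - 1))) g2"
      using pos by (metis Suc_pred' funpow.simps(2) comp_apply)
    have "?Q (\<lambda>m. h m + (?Q ^^ (p * (q - 1) - 1)) g2 m) m = ?Q h m + (?Q ^^ (p * (q - 1))) g2 m"
      by (simp only: psum_add 2)
    then show ?thesis using g2[OF m] unfolding 1 by (simp add: f'_def diff_diff_eq)
  qed
  then show "\<exists>g. \<forall>m\<in>cube N (p * q). xdeg N m = e \<longrightarrow> int p dvd f m - (?Q ^^ (p * q - (p * q - 1))) g m"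
    by blast
qed

text \<open>With q = p^(s+1) the thresholds are b = (n+2)q - (n-2)p^s and c = nq - (n-2)p^s. They
  satisfy c + 2q = b and are multiplied by p at each step. For s = 0, since p-1 is even, the strict
  inequalities give the bound 2(e+a) <= (n+2)(p-1) of \<open>ker_im_prime\<close> for a = 1 and a =
  p-1.\<close>

theorem ker_im_power:
  assumes p: "prime p" "odd p" and n: "2 \<le> n"
  shows "(\<forall>e. 2 * (e + 2) + (n - 2) * p ^ s < (n + 2) * p ^ Suc s \<longrightarrow> ker_im p (n + 2) (p ^ Suc s) 1 e) \<and>
    (\<forall>e. 2 * e + (n - 2) * p ^ s < n * p ^ Suc s \<longrightarrow> ker_im p (n + 2) (p ^ Suc s) (p ^ Suc s - 1) e)"
proof (induction s)
  case 0
  have p2: "2 \<le> p" using p(1) by (rule prime_ge_2_nat)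
  obtain k where k: "p = 2 * k + 1" using p(2) by (elim oddE)
  obtain m where m: "n = m + 2" using n by (metis add.commute le_Suc_ex)
  have "ker_im p (n + 2) p 1 e" if "2 * (e + 2) + (n - 2) < (n + 2) * p" for e
  proof (rule ker_im_prime[OF p])
    have "e < m * k + 4 * k" using that k m by (simp add: algebra_simps)
    then show "2 * (e + 1) \<le> (n + 2) * (p - 1)" by (simp add: k m algebra_simps)
  qed (use p2 in simp)
  moreover have "ker_im p (n + 2) p (p - 1) e" if "2 * e + (n - 2) < n * p" for e
  proof (rule ker_im_prime[OF p])
    have "2 * e + m < (m + 2) * (2 * k + 1)" using that k m by simp
    then have "e < m * k + 2 * k + 1" by (simp add: algebra_simps)
    then show "2 * (e + (p - 1)) \<le> (n + 2) * (p - 1)" by (simp add: k m algebra_simps)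
  qed (use p2 in simp)
  ultimately show ?case by simp
next
  case (Suc s)
  have p2: "2 \<le> p" using p(1) by (rule prime_ge_2_nat)
  define q where "q = p ^ Suc s"
  define b where "b = (n + 2) * q - (n - 2) * p ^ s"
  define c where "c = n * q - (n - 2) * p ^ s"
  have "p ^ s \<le> q" unfolding q_def using p2 by (intro power_increasing) auto
  then have le: "(n - 2) * p ^ s \<le> n * q" by (intro mult_le_mono) auto
  have bc: "c + 2 * q = b" using le by (simp add: b_def c_def algebra_simps)
  have "2 ^ 1 \<le> p ^ Suc s" using p2 by (intro power_mono order_trans[OF _ self_le_power]) auto
  then have q2: "2 \<le> q" by (simp add: q_def)
  have pb: "p * b = (n + 2) * p ^ Suc (Suc s) - (n - 2) * p ^ Suc s"
    by (simp add: b_def q_def diff_mult_distrib2 mult_ac)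
  have pc: "p * c = n * p ^ Suc (Suc s) - (n - 2) * p ^ Suc s"
    by (simp add: c_def q_def diff_mult_distrib2 mult_ac)
  have H1: "ker_im p (n + 2) q 1 e" if "2 * (e + 2) < b" for e
    using Suc.IH that unfolding b_def q_def by (simp add: less_diff_conv)
  have H2: "ker_im p (n + 2) q (q - 1) e" if "2 * e < c" for e
    using Suc.IH that unfolding c_def q_def by (simp add: less_diff_conv)
  have N: "4 \<le> n + 2" using n by simp
  have "ker_im p (n + 2) (p * q) 1 e" if "2 * (e + 2) + (n - 2) * p ^ Suc s < (n + 2) * p ^ Suc (Suc s)" for e
    by (rule ker_im_step1[OF p N q2 bc H1 H2]) (use that pb in \<open>auto simp: less_diff_conv\<close>)
  moreover have "ker_im p (n + 2) (p * q) (p * q - 1) e" if "2 * e + (n - 2) * p ^ Suc s < n * p ^ Suc (Suc s)" for e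
    by (rule ker_im_step2[OF p N q2 bc H1 H2]) (use that pc in \<open>auto simp: less_diff_conv\<close>)
  ultimately show ?case by (simp add: q_def)
qed

section \<open>Cokernel and kernel dimensions of the quadric\<close>

definition box_mons :: "nat \<Rightarrow> nat \<Rightarrow> nat \<Rightarrow> (nat \<Rightarrow> nat) set" where
  "box_mons N q e = {m \<in> cube N q. xdeg N m = e}"

lemma finite_box_mons: "finite (box_mons N q e)"
  by (simp add: box_mons_def finite_cube)

text \<open>Column x of the integer matrix of Q^a in the monomial bases.\<close>

definition quad_power :: "nat \<Rightarrow> nat \<Rightarrow> (nat \<Rightarrow> nat) \<Rightarrow> (nat \<Rightarrow> nat) \<Rightarrow> int" where
  "quad_power N a x = (psum 2 N ^^ a) (\<lambda>m. if m = x then 1 else 0)"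

lemma psum_pow_sum: "(psum k N ^^ n) (\<lambda>m. \<Sum>j\<in>A. c j * g j m) m = (\<Sum>j\<in>A. c j * (psum k N ^^ n) (g j) m)"
proof (induction A rule: infinite_finite_induct)
  case (insert x F)
  have "(psum k N ^^ n) (\<lambda>m. \<Sum>j\<in>insert x F. c j * g j m) m
    = (psum k N ^^ n) (\<lambda>m. c x * g x m + (\<Sum>j\<in>F. c j * g j m)) m"
    using insert by simp
  also have "\<dots> = c x * (psum k N ^^ n) (g x) m + (psum k N ^^ n) (\<lambda>m. \<Sum>j\<in>F. c j * g j m) m"
    by (simp add: psum_pow_add psum_pow_cmult)
  finally show ?case using insert by simp
qed (simp_all add: psum_pow_zero)

lemma psum_pow_eq_local:
  assumes "\<And>m. m \<in> box_mons N q e \<Longrightarrow> f m = g m" "y \<in> box_mons N q (e + k * n)"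
  shows "(psum k N ^^ n) f y = (psum k N ^^ n) g y"
proof -
  have "0 dvd (psum k N ^^ n) (\<lambda>m. f m - g m) y"
    by (rule psum_pow_dvd_local[where b="\<lambda>_. q" and l=0 and e=e]) (use assms in \<open>auto simp: box_mons_def\<close>)
  then show ?thesis by (simp add: psum_pow_diff)
qed

lemma quad_power_expand:
  assumes "y \<in> box_mons N q (e + 2 * a)"
  shows "(\<Sum>x\<in>box_mons N q e. F x * quad_power N a x y) = (psum 2 N ^^ a) F y"
proof -
  have "(\<Sum>x\<in>box_mons N q e. F x * quad_power N a x y) = (psum 2 N ^^ a) (\<lambda>m. \<Sum>x\<in>box_mons N q e. F x * (if m = x then 1 else 0)) y"
    unfolding quad_power_def psum_pow_sum ..
  also have "\<dots> = (psum 2 N ^^ a) F y"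
  proof (rule psum_pow_eq_local[OF _ assms])
    fix m assume "m \<in> box_mons N q e"
    then show "(\<Sum>x\<in>box_mons N q e. F x * (if m = x then 1 else 0)) = F m"
      using finite_box_mons by (simp add: if_distrib[of "\<lambda>c. _ * c"] sum.delta cong: if_cong)
  qed
  finally show ?thesis .
qed

definition quad_image :: "nat \<Rightarrow> nat \<Rightarrow> nat \<Rightarrow> nat \<Rightarrow> nat \<Rightarrow> ((nat \<Rightarrow> nat) \<Rightarrow> int) set" where
  "quad_image p N q a e = (\<lambda>F. \<lambda>y\<in>box_mons N q (e + 2 * a). (psum 2 N ^^ a) F y mod int p) ` UNIV"

definition quad_kernel :: "nat \<Rightarrow> nat \<Rightarrow> nat \<Rightarrow> nat \<Rightarrow> nat \<Rightarrow> ((nat \<Rightarrow> nat) \<Rightarrow> int) set" where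
  "quad_kernel p N q a e = {F \<in> box_mons N q e \<rightarrow>\<^sub>E {0..<int p}. \<forall>y\<in>box_mons N q (e + 2 * a). int p dvd (psum 2 N ^^ a) F y}"

definition quad_rank :: "nat \<Rightarrow> nat \<Rightarrow> nat \<Rightarrow> nat \<Rightarrow> nat \<Rightarrow> nat" where
  "quad_rank p N q a e = rank_mod p (box_mons N q e) (box_mons N q (e + 2 * a)) (quad_power N a)"

definition ker_dim :: "nat \<Rightarrow> nat \<Rightarrow> nat \<Rightarrow> nat \<Rightarrow> nat" where
  "ker_dim p N q e = card (box_mons N q e) - quad_rank p N q 1 e"

text \<open>The dimension of the cokernel of Q in degree d of the box algebra; nothing maps into
  degrees below 2.\<close>

definition hilb_box :: "nat \<Rightarrow> nat \<Rightarrow> nat \<Rightarrow> nat \<Rightarrow> nat" where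
  "hilb_box p N q d = card (box_mons N q d) - (if d < 2 then 0 else quad_rank p N q 1 (d - 2))"

lemma quad_image_eq: "quad_image p N q a e = image_mod p (box_mons N q e) (box_mons N q (e + 2 * a)) (quad_power N a)"
  unfolding quad_image_def image_mod_def
  by (intro image_cong refl restrict_ext) (simp add: quad_power_expand)

lemma quad_kernel_eq: "quad_kernel p N q a e = kernel_mod p (box_mons N q e) (box_mons N q (e + 2 * a)) (quad_power N a)"
  unfolding quad_kernel_def kernel_mod_def using quad_power_expand by auto

lemma card_quad_image: "prime p \<Longrightarrow> card (quad_image p N q a e) = p ^ quad_rank p N q a e"
  by (simp add: quad_image_eq quad_rank_def card_image_mod finite_box_mons)

lemma card_quad_kernel: "prime p \<Longrightarrow> card (quad_kernel p N q a e) = p ^ (card (box_mons N q e) - quad_rank p N q a e)"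
  by (simp add: quad_kernel_eq quad_rank_def card_kernel_mod finite_box_mons)

lemma quad_rank_le: "prime p \<Longrightarrow> quad_rank p N q a e \<le> card (box_mons N q e)"
  by (simp add: quad_rank_def rank_mod_le finite_box_mons)

lemma card_quad_kernel1: "prime p \<Longrightarrow> card (quad_kernel p N q 1 e) = p ^ ker_dim p N q e"
  by (simp add: card_quad_kernel ker_dim_def)

lemma finite_quad_kernel: "finite (quad_kernel p N q a e)"
  unfolding quad_kernel_def by (rule finite_subset[of _ "box_mons N q e \<rightarrow>\<^sub>E {0..<int p}"]) (auto simp: finite_box_mons finite_PiE)

lemma power_prime_inj: "prime (p::nat) \<Longrightarrow> p ^ a = p ^ b \<Longrightarrow> a = b"
  using prime_gt_1_nat power_inject_exp by blast

lemma power_prime_le: "prime (p::nat) \<Longrightarrow> p ^ a \<le> p ^ b \<Longrightarrow> a \<le> b"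
  using prime_gt_1_nat power_le_imp_le_exp by blast

lemma psum_frobenius_iter:
  assumes p: "prime p"
  shows "int p dvd (psum k N ^^ (p ^ s)) f m - psum (k * p ^ s) N f m"
proof (induction s arbitrary: k)
  case (Suc s)
  have "int p dvd (psum k N ^^ (p * p ^ s)) f m - (psum (k * p) N ^^ (p ^ s)) f m"
    by (rule psum_frobenius_pow[OF p])
  from dvd_add[OF this Suc.IH[of "k * p"]] show ?case by (simp add: mult_ac)
qed simp

text \<open>Modulo p the q-th power of Q is the sum of the x_i^(2q), and no exponent in the cube
  reaches 2q.\<close>

lemma psum_nilpotent:
  assumes p: "prime p" and y: "y \<in> cube N (p ^ s)"
  shows "int p dvd (psum 2 N ^^ (p ^ s)) f y"
proof -
  have "psum (2 * p ^ s) N f y = 0"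
    unfolding psum_expand using y by (intro sum.neutral) (auto simp: xbox_def)
  then show ?thesis using psum_frobenius_iter[where k=2 and N=N and s=s and f=f and m=y, OF p] by simp
qed

text \<open>One inclusion is \<open>ker_im\<close>, read in reduced representatives; the other is
  nilpotency of Q.\<close>

lemma quad_kernel_eq_quad_image:
  assumes p: "prime p" and q: "q = p ^ s" and a: "a \<le> q" and k: "ker_im p N q a (e + 2 * (q - a))"
  shows "quad_kernel p N q a (e + 2 * (q - a)) = quad_image p N q (q - a) e"
proof (intro equalityI subsetI)
  fix F assume F: "F \<in> quad_kernel p N q a (e + 2 * (q - a))"
  then have "\<forall>m\<in>cube N q. xdeg N m = e + 2 * (q - a) + 2 * a \<longrightarrow> int p dvd (psum 2 N ^^ a) F m"
    by (auto simp: quad_kernel_def box_mons_def)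
  then obtain g where g: "\<forall>m\<in>cube N q. xdeg N m = e + 2 * (q - a) \<longrightarrow> int p dvd F m - (psum 2 N ^^ (q - a)) g m"
    using k unfolding ker_im_def by blast
  have "F = (\<lambda>y\<in>box_mons N q (e + 2 * (q - a)). (psum 2 N ^^ (q - a)) g y mod int p)"
  proof
    fix y
    have FP: "F \<in> box_mons N q (e + 2 * (q - a)) \<rightarrow>\<^sub>E {0..<int p}" using F by (simp add: quad_kernel_def)
    show "F y = (\<lambda>y\<in>box_mons N q (e + 2 * (q - a)). (psum 2 N ^^ (q - a)) g y mod int p) y"
    proof (cases "y \<in> box_mons N q (e + 2 * (q - a))")
      case True
      then have "int p dvd F y - (psum 2 N ^^ (q - a)) g y" using g by (simp add: box_mons_def)
      then have "F y mod int p = (psum 2 N ^^ (q - a)) g y mod int p"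
        by (simp add: mod_eq_dvd_iff)
      moreover have "F y mod int p = F y" using FP True by (auto simp: PiE_iff)
      ultimately show ?thesis using True by simp
    qed (use FP in \<open>auto simp: PiE_iff extensional_def\<close>)
  qed
  then show "F \<in> quad_image p N q (q - a) e" by (auto simp: quad_image_def)
next
  fix F assume "F \<in> quad_image p N q (q - a) e"
  then obtain g where F: "F = (\<lambda>y\<in>box_mons N q (e + 2 * (q - a)). (psum 2 N ^^ (q - a)) g y mod int p)"
    by (auto simp: quad_image_def)
  have p0: "int p > 0" using prime_gt_0_nat[OF p] by simp
  have "int p dvd (psum 2 N ^^ a) F y" if y: "y \<in> box_mons N q (e + 2 * (q - a) + 2 * a)" for y
  proof -
    have "int p dvd (psum 2 N ^^ a) (\<lambda>m. F m - (psum 2 N ^^ (q - a)) g m) y"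
    proof (rule psum_pow_dvd_local[where b="\<lambda>_. q" and l=0 and e="e + 2 * (q - a)"])
      fix m assume "m \<in> cube N q" "xdeg N m + 0 = e + 2 * (q - a)"
      then have "m \<in> box_mons N q (e + 2 * (q - a))" by (simp add: box_mons_def)
      then show "int p dvd F m - (psum 2 N ^^ (q - a)) g m"
        by (simp add: F mod_eq_dvd_iff[symmetric])
    qed (use y in \<open>auto simp: box_mons_def\<close>)
    moreover have "int p dvd (psum 2 N ^^ a) ((psum 2 N ^^ (q - a)) g) y"
      using psum_nilpotent[OF p, of y N s g] y a by (simp add: funpow_comp q box_mons_def)
    ultimately show ?thesis by (simp add: psum_pow_diff dvd_diff_left_iff)
  qed
  then show "F \<in> quad_kernel p N q a (e + 2 * (q - a))"
    using p0 by (auto simp: quad_kernel_def F)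
qed

text \<open>A kernel element is a multiple of Q^(q-a), whose degree 2(q-a) exceeds e.\<close>

lemma quad_kernel_trivial:
  assumes p: "prime p" and k: "ker_im p N q a e" and e: "e < 2 * (q - a)"
  shows "card (box_mons N q e) = quad_rank p N q a e"
proof -
  have "F = (\<lambda>y\<in>box_mons N q e. 0)" if F: "F \<in> quad_kernel p N q a e" for F
  proof -
    have "\<forall>m\<in>cube N q. xdeg N m = e + 2 * a \<longrightarrow> int p dvd (psum 2 N ^^ a) F m"
      using F by (auto simp: quad_kernel_def box_mons_def)
    then obtain g where g: "\<forall>m\<in>cube N q. xdeg N m = e \<longrightarrow> int p dvd F m - (psum 2 N ^^ (q - a)) g m"
      using k unfolding ker_im_def by blast
    have FP: "F \<in> box_mons N q e \<rightarrow>\<^sub>E {0..<int p}" using F by (simp add: quad_kernel_def)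
    have "F y = 0" if y: "y \<in> box_mons N q e" for y
    proof -
      have "(psum 2 N ^^ (q - a)) g y = 0" by (rule psum_pow_low) (use y e in \<open>simp add: box_mons_def\<close>)
      then have "int p dvd F y" using g y by (auto simp: box_mons_def)
      moreover have "0 \<le> F y" "F y < int p" using FP y by (auto simp: PiE_iff)
      ultimately show ?thesis using zdvd_not_zless[of "F y" "int p"] by linarith
    qed
    then show ?thesis using FP by (auto simp: fun_eq_iff PiE_iff extensional_def)
  qed
  then have "quad_kernel p N q a e \<subseteq> {\<lambda>y\<in>box_mons N q e. 0}" by blast
  from card_mono[OF _ this] have "card (quad_kernel p N q a e) \<le> 1" by simp
  then have "p ^ (card (box_mons N q e) - quad_rank p N q a e) \<le> p ^ 0" by (simp add: card_quad_kernel[OF p])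
  then have "card (box_mons N q e) - quad_rank p N q a e \<le> 0" by (rule power_prime_le[OF p])
  then show ?thesis using quad_rank_le[OF p, of N q a e] by simp
qed

text \<open>The kernel of Q^(q-1) in degree e is the image of Q from degree e-2, so the rank of
  Q^(q-1) is the codimension of that image.\<close>

lemma quad_rank_power:
  assumes p: "prime p" and q: "q = p ^ s" and k: "ker_im p N q (q - 1) e"
  shows "quad_rank p N q (q - 1) e = hilb_box p N q e"
proof -
  have q1: "1 \<le> q" using prime_gt_0_nat[OF p] by (simp add: q Suc_leI)
  then have qq: "q - (q - 1) = 1" by simp
  show ?thesis
  proof (cases "e < 2")
    case True
    then show ?thesis using quad_kernel_trivial[OF p k] q1 by (simp add: hilb_box_def qq)
  next
    case False
    then have ee: "e = e - 2 + 2 * (q - (q - 1))" unfolding qq by simp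
    have "quad_kernel p N q (q - 1) e = quad_image p N q 1 (e - 2)"
      using quad_kernel_eq_quad_image[OF p q, of "q - 1" N "e - 2"] k ee qq by simp
    then have "p ^ (card (box_mons N q e) - quad_rank p N q (q - 1) e) = p ^ quad_rank p N q 1 (e - 2)"
      by (metis card_quad_image card_quad_kernel p)
    then have "card (box_mons N q e) - quad_rank p N q (q - 1) e = quad_rank p N q 1 (e - 2)" by (rule power_prime_inj[OF p])
    then show ?thesis using False quad_rank_le[OF p, of N q "q - 1" e] by (simp add: hilb_box_def)
  qed
qed

lemma ker_dim_eq_hilb_box:
  assumes p: "prime p" and q: "q = p ^ s" and k1: "ker_im p N q 1 (e + 2 * (q - 1))" and k2: "ker_im p N q (q - 1) e"
  shows "ker_dim p N q (e + 2 * (q - 1)) = hilb_box p N q e"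
proof -
  have q1: "1 \<le> q" using prime_gt_0_nat[OF p] by (simp add: q Suc_leI)
  have "quad_kernel p N q 1 (e + 2 * (q - 1)) = quad_image p N q (q - 1) e"
    by (rule quad_kernel_eq_quad_image[OF p q q1 k1])
  then have "p ^ ker_dim p N q (e + 2 * (q - 1)) = p ^ quad_rank p N q (q - 1) e"
    by (metis card_quad_image card_quad_kernel1 p)
  then show ?thesis using power_prime_inj[OF p] quad_rank_power[OF p q k2] by metis
qed

text \<open>The image of Q^(q-1) lies in the kernel of Q by nilpotency. This half persists beyond
  the range of the property for Q itself and produces the inequality inside the window.\<close>

lemma ker_dim_ge_hilb_box:
  assumes p: "prime p" and q: "q = p ^ s" and k2: "ker_im p N q (q - 1) e"
  shows "hilb_box p N q e \<le> ker_dim p N q (e + 2 * (q - 1))"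
proof -
  have q1: "1 \<le> q" using prime_gt_0_nat[OF p] by (simp add: q Suc_leI)
  have p0: "int p > 0" using prime_gt_0_nat[OF p] by simp
  have "quad_image p N q (q - 1) e \<subseteq> quad_kernel p N q 1 (e + 2 * (q - 1))"
  proof
    fix F assume "F \<in> quad_image p N q (q - 1) e"
    then obtain g where F: "F = (\<lambda>y\<in>box_mons N q (e + 2 * (q - 1)). (psum 2 N ^^ (q - 1)) g y mod int p)"
      by (auto simp: quad_image_def)
    have "int p dvd (psum 2 N ^^ 1) F y" if y: "y \<in> box_mons N q (e + 2 * (q - 1) + 2 * 1)" for y
    proof -
      have "int p dvd (psum 2 N ^^ 1) (\<lambda>m. F m - (psum 2 N ^^ (q - 1)) g m) y"
      proof (rule psum_pow_dvd_local[where b="\<lambda>_. q" and l=0 and e="e + 2 * (q - 1)"])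
        fix m assume "m \<in> cube N q" "xdeg N m + 0 = e + 2 * (q - 1)"
        then have "m \<in> box_mons N q (e + 2 * (q - 1))" by (simp add: box_mons_def)
        then show "int p dvd F m - (psum 2 N ^^ (q - 1)) g m"
          by (simp add: F mod_eq_dvd_iff[symmetric])
      qed (use y in \<open>auto simp: box_mons_def\<close>)
      moreover have "int p dvd (psum 2 N ^^ 1) ((psum 2 N ^^ (q - 1)) g) y"
      proof -
        have e1: "1 + (q - 1) = p ^ s" using q1 q by simp
        show ?thesis unfolding funpow_comp e1 by (rule psum_nilpotent[OF p]) (use y q in \<open>simp add: box_mons_def\<close>)
      qed
      ultimately show ?thesis unfolding psum_pow_diff by (simp add: dvd_diff_left_iff)
    qed
    then show "F \<in> quad_kernel p N q 1 (e + 2 * (q - 1))"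
      using p0 by (auto simp: quad_kernel_def F)
  qed
  then have "p ^ quad_rank p N q (q - 1) e \<le> p ^ ker_dim p N q (e + 2 * (q - 1))"
    using card_mono[OF finite_quad_kernel] by (metis card_quad_image card_quad_kernel1 p)
  then show ?thesis using power_prime_le[OF p] quad_rank_power[OF p q k2] by metis
qed

lemma ker_dim_eq_0:
  assumes p: "prime p" and k1: "ker_im p N q 1 e" and e: "e < 2 * (q - 1)"
  shows "ker_dim p N q e = 0"
  using quad_kernel_trivial[OF p k1 e] by (simp add: ker_dim_def)

text \<open>Rank-nullity for Q from degree d-2 to degree d, where both the cokernel and the kernel
  lose the same rank.\<close>

lemma hilb_box_ker_dim:
  assumes p: "prime p" and d: "2 \<le> d"
  shows "int (hilb_box p N q d) - int (ker_dim p N q (d - 2)) = int (card (box_mons N q d)) - int (card (box_mons N q (d - 2)))"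
proof -
  have "d - 2 + 2 * 1 = d" using d by simp
  then have "quad_image p N q 1 (d - 2) \<subseteq> box_mons N q d \<rightarrow>\<^sub>E {0..<int p}"
    using prime_gt_0_nat[OF p] unfolding quad_image_def by auto
  then have "card (quad_image p N q 1 (d - 2)) \<le> card (box_mons N q d \<rightarrow>\<^sub>E {0..<int p})"
    by (intro card_mono) (auto simp: finite_box_mons finite_PiE)
  then have "p ^ quad_rank p N q 1 (d - 2) \<le> p ^ card (box_mons N q d)"
    by (simp add: card_quad_image[OF p, simplified] card_PiE_mod[OF finite_box_mons])
  then have "quad_rank p N q 1 (d - 2) \<le> card (box_mons N q d)" by (rule power_prime_le[OF p])
  then show ?thesis using d quad_rank_le[OF p, of N q 1 "d - 2"] by (simp add: hilb_box_def ker_dim_def)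
qed

lemma card_image_mod_reindex:
  assumes a: "bij_betw a U U'" and b: "bij_betw b Y Y'"
  shows "card (image_mod p U Y (\<lambda>x y. v (a x) (b y))) = card (image_mod p U' Y' v)"
proof -
  let ?F = "\<lambda>z. \<lambda>y\<in>Y. z (b y)"
  have bY: "b y \<in> Y'" if "y \<in> Y" for y using b that by (auto simp: bij_betw_def)
  have eq: "?F (\<lambda>y\<in>Y'. (\<Sum>x\<in>U'. c x * v x y) mod int p) = (\<lambda>y\<in>Y. (\<Sum>x\<in>U. c (a x) * v (a x) (b y)) mod int p)" for c
    using bY by (intro restrict_ext) (simp add: sum.reindex_bij_betw[OF a, of "\<lambda>x. c x * v x (b _)"])
  have "inj_on ?F (image_mod p U' Y' v)"
  proof (rule inj_onI)
    fix z z' assume z: "z \<in> image_mod p U' Y' v" "z' \<in> image_mod p U' Y' v" and e: "?F z = ?F z'"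
    have "z y' = z' y'" if "y' \<in> Y'" for y'
    proof -
      obtain y where "y \<in> Y" "y' = b y" using b \<open>y' \<in> Y'\<close> by (auto simp: bij_betw_def)
      then show ?thesis using fun_cong[OF e, of y] by simp
    qed
    then show "z = z'" using z by (auto simp: image_mod_def fun_eq_iff)
  qed
  moreover have "?F ` image_mod p U' Y' v = image_mod p U Y (\<lambda>x y. v (a x) (b y))"
  proof (intro equalityI subsetI)
    fix z assume "z \<in> ?F ` image_mod p U' Y' v"
    then show "z \<in> image_mod p U Y (\<lambda>x y. v (a x) (b y))" unfolding image_mod_def using eq by auto
  next
    fix z assume "z \<in> image_mod p U Y (\<lambda>x y. v (a x) (b y))"
    then obtain c where z: "z = (\<lambda>y\<in>Y. (\<Sum>x\<in>U. c x * v (a x) (b y)) mod int p)" unfolding image_mod_def by blast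
    define c' where "c' = (\<lambda>x'. c (inv_into U a x'))"
    have "c' (a x) = c x" if "x \<in> U" for x
      using a that by (simp add: c'_def bij_betw_def inv_into_f_f)
    then have "z = ?F (\<lambda>y\<in>Y'. (\<Sum>x\<in>U'. c' x * v x y) mod int p)"
      unfolding eq z by (intro restrict_ext arg_cong[of _ _ "\<lambda>t. t mod int p"] sum.cong) auto
    then show "z \<in> ?F ` image_mod p U' Y' v" unfolding image_mod_def by blast
  qed
  ultimately show ?thesis by (metis card_image)
qed

section \<open>Monomial duality in the cube\<close>

definition complement_exp :: "nat \<Rightarrow> nat \<Rightarrow> (nat \<Rightarrow> nat) \<Rightarrow> nat \<Rightarrow> nat" where
  "complement_exp N q m = (\<lambda>i. if i < N then q - 1 - m i else 0)"

lemma complement_exp_cube: "0 < q \<Longrightarrow> complement_exp N q m \<in> cube N q"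
  by (auto simp: complement_exp_def xbox_def)

lemma complement_exp_complement_exp: "m \<in> cube N q \<Longrightarrow> complement_exp N q (complement_exp N q m) = m"
  by (force simp: complement_exp_def xbox_def fun_eq_iff)

lemma xdeg_complement_exp: "m \<in> cube N q \<Longrightarrow> xdeg N (complement_exp N q m) + xdeg N m = N * (q - 1)"
proof -
  assume m: "m \<in> cube N q"
  have "xdeg N (complement_exp N q m) + xdeg N m = (\<Sum>i<N. q - 1)"
    unfolding xdeg_def sum.distrib[symmetric] using m
    by (intro sum.cong) (force simp: complement_exp_def xbox_def)+
  then show ?thesis by simp
qed

lemma bij_complement_exp: "0 < q \<Longrightarrow> e \<le> N * (q - 1) \<Longrightarrow> bij_betw (complement_exp N q) (box_mons N q e) (box_mons N q (N * (q - 1) - e))"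
proof (rule bij_betw_byWitness[where f'="complement_exp N q"])
  assume q: "0 < q" and e: "e \<le> N * (q - 1)"
  show "\<forall>a\<in>box_mons N q e. complement_exp N q (complement_exp N q a) = a" by (simp add: box_mons_def complement_exp_complement_exp)
  show "\<forall>a'\<in>box_mons N q (N * (q - 1) - e). complement_exp N q (complement_exp N q a') = a'" by (simp add: box_mons_def complement_exp_complement_exp)
  show "complement_exp N q ` box_mons N q e \<subseteq> box_mons N q (N * (q - 1) - e)"
    using xdeg_complement_exp complement_exp_cube[OF q] by (force simp: box_mons_def)
  show "complement_exp N q ` box_mons N q (N * (q - 1) - e) \<subseteq> box_mons N q e"
  proof
    fix z assume "z \<in> complement_exp N q ` box_mons N q (N * (q - 1) - e)"
    then obtain m where "m \<in> cube N q" "xdeg N m = N * (q - 1) - e" "z = complement_exp N q m" by (auto simp: box_mons_def)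
    then show "z \<in> box_mons N q e" using xdeg_complement_exp[of m N q] complement_exp_cube[OF q] e by (auto simp: box_mons_def)
  qed
qed

text \<open>Complementation reverses divisibility: y arises from x by adding 2 to one exponent
  exactly when the complement of x arises so from the complement of y. The matrix of Q is therefore
  sent to its transpose.\<close>

lemma quad_power_complement_exp:
  assumes "x \<in> cube N q" "y \<in> cube N q" "0 < q"
  shows "quad_power N 1 (complement_exp N q y) (complement_exp N q x) = quad_power N 1 x y"
proof -
  have "(\<not> complement_exp N q x i < 2 \<and> (complement_exp N q x)(i := complement_exp N q x i - 2) = complement_exp N q y) \<longleftrightarrow> (\<not> y i < 2 \<and> y(i := y i - 2) = x)"
    if i: "i < N" for i
  proof -
    have xb: "x j < q" "y j < q" if "j < N" for j using assms that by (auto simp: xbox_def)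
    have x0: "x j = 0" "y j = 0" if "j \<ge> N" for j using assms that by (auto simp: xbox_def)
    have "(\<not> complement_exp N q x i < 2 \<and> (complement_exp N q x)(i := complement_exp N q x i - 2) = complement_exp N q y) \<longleftrightarrow>
      (\<forall>j<N. y j = (if j = i then x j + 2 else x j))"
    proof
      assume L: "\<not> complement_exp N q x i < 2 \<and> (complement_exp N q x)(i := complement_exp N q x i - 2) = complement_exp N q y"
      show "\<forall>j<N. y j = (if j = i then x j + 2 else x j)"
      proof (intro allI impI)
        fix j assume j: "j < N"
        have "((complement_exp N q x)(i := complement_exp N q x i - 2)) j = complement_exp N q y j" using L by simp
        then show "y j = (if j = i then x j + 2 else x j)"
          using L j xb[OF j] by (auto simp: complement_exp_def split: if_splits)
      qed
    next
      assume R: "\<forall>j<N. y j = (if j = i then x j + 2 else x j)"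
      then show "\<not> complement_exp N q x i < 2 \<and> (complement_exp N q x)(i := complement_exp N q x i - 2) = complement_exp N q y"
        using xb[OF i] i xb by (auto simp: complement_exp_def fun_eq_iff)
    qed
    also have "\<dots> \<longleftrightarrow> (\<not> y i < 2 \<and> y(i := y i - 2) = x)"
    proof
      assume R: "\<forall>j<N. y j = (if j = i then x j + 2 else x j)"
      have "y(i := y i - 2) = x"
      proof
        fix j show "(y(i := y i - 2)) j = x j" using R i x0[of j] by (cases "j < N") auto
      qed
      then show "\<not> y i < 2 \<and> y(i := y i - 2) = x" using R i by auto
    next
      assume R: "\<not> y i < 2 \<and> y(i := y i - 2) = x"
      show "\<forall>j<N. y j = (if j = i then x j + 2 else x j)"
      proof (intro allI impI)
        fix j assume "j < N"
        have "(y(i := y i - 2)) j = x j" using R by simp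
        then show "y j = (if j = i then x j + 2 else x j)" using R by (auto split: if_splits)
      qed
    qed
    finally show ?thesis .
  qed
  then show ?thesis
    unfolding quad_power_def by (simp add: psum_expand) (intro sum.cong; auto)
qed

text \<open>With D = N(q-1), complementation identifies Q from degree D-2-e to D-e with the
  transpose of Q from e to e+2.\<close>

lemma quad_rank_dual:
  assumes p: "prime p" and q: "0 < q" and e: "e + 2 \<le> N * (q - 1)"
  shows "quad_rank p N q 1 (N * (q - 1) - 2 - e) = quad_rank p N q 1 e"
proof -
  let ?D = "N * (q - 1)"
  let ?U = "box_mons N q e" and ?Y = "box_mons N q (e + 2)"
  have "?D - 2 - e + 2 = ?D - e" using e by linarith
  then have bX: "bij_betw (complement_exp N q) ?U (box_mons N q (?D - 2 - e + 2))"
    using bij_complement_exp[OF q, of e N] e by simp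
  have bY: "bij_betw (complement_exp N q) ?Y (box_mons N q (?D - 2 - e))"
    using bij_complement_exp[OF q, of "e + 2" N] e by (simp add: diff_diff_left add.commute)
  have "card (image_mod p ?Y ?U (\<lambda>y x. quad_power N 1 (complement_exp N q y) (complement_exp N q x))) = card (image_mod p (box_mons N q (?D - 2 - e)) (box_mons N q (?D - 2 - e + 2)) (quad_power N 1))"
    by (rule card_image_mod_reindex[OF bY bX])
  moreover have "image_mod p ?Y ?U (\<lambda>y x. quad_power N 1 (complement_exp N q y) (complement_exp N q x)) = image_mod p ?Y ?U (\<lambda>y x. quad_power N 1 x y)"
    unfolding image_mod_def using q
    by (intro image_cong refl restrict_ext arg_cong[of _ _ "\<lambda>t. t mod int p"] sum.cong)
       (auto simp: box_mons_def quad_power_complement_exp[simplified])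
  ultimately have "card (image_mod p ?Y ?U (\<lambda>y x. quad_power N 1 x y)) = card (image_mod p (box_mons N q (?D - 2 - e)) (box_mons N q (?D - 2 - e + 2)) (quad_power N 1))"
    by (simp only:)
  then have "p ^ rank_mod p ?Y ?U (\<lambda>y x. quad_power N 1 x y) = p ^ quad_rank p N q 1 (?D - 2 - e)"
    by (simp add: card_image_mod[OF p finite_box_mons finite_box_mons] quad_rank_def)
  then have "rank_mod p ?Y ?U (\<lambda>y x. quad_power N 1 x y) = quad_rank p N q 1 (?D - 2 - e)" by (rule power_prime_inj[OF p])
  then show ?thesis using rank_mod_transpose[where U="box_mons N q e" and V="box_mons N q (e + 2)" and v="quad_power N 1", OF p finite_box_mons finite_box_mons] by (simp add: quad_rank_def)
qed

lemma box_mons_empty: "N * (q - 1) < e \<Longrightarrow> box_mons N q e = {}"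
proof -
  assume e: "N * (q - 1) < e"
  have "m \<notin> box_mons N q e" for m
  proof
    assume "m \<in> box_mons N q e"
    then have "m \<in> cube N q" "xdeg N m = e" by (auto simp: box_mons_def)
    then show False using xdeg_complement_exp[of m N q] e by simp
  qed
  then show ?thesis by blast
qed

lemma hilb_box_dual:
  assumes p: "prime p" and q: "0 < q" and d: "d \<le> N * (q - 1)"
  shows "hilb_box p N q d = ker_dim p N q (N * (q - 1) - d)"
proof -
  have c: "card (box_mons N q d) = card (box_mons N q (N * (q - 1) - d))"
    using bij_betw_same_card[OF bij_complement_exp[OF q d]] .
  show ?thesis
  proof (cases "d < 2")
    case True
    then have "box_mons N q (N * (q - 1) - d + 2) = {}" using d by (intro box_mons_empty) simp
    then have "quad_image p N q 1 (N * (q - 1) - d) = {\<lambda>y\<in>{}. undefined}"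
      by (auto simp: quad_image_def restrict_def)
    then have "p ^ quad_rank p N q 1 (N * (q - 1) - d) = p ^ 0"
      using card_quad_image[OF p, of N q 1 "N * (q - 1) - d"] by simp
    then have "quad_rank p N q 1 (N * (q - 1) - d) = 0" by (rule power_prime_inj[OF p])
    then show ?thesis using True c by (simp add: hilb_box_def ker_dim_def)
  next
    case False
    have 1: "d - 2 + 2 = d" "N * (q - 1) - 2 - (d - 2) = N * (q - 1) - d" using False by linarith+
    have "quad_rank p N q 1 (d - 2) = quad_rank p N q 1 (N * (q - 1) - d)"
      using quad_rank_dual[OF p q, of "d - 2" N] d unfolding 1 by simp
    then show ?thesis using False c by (simp add: hilb_box_def ker_dim_def)
  qed
qed

lemma hilb_box_eq_0: "N * (q - 1) < d \<Longrightarrow> hilb_box p N q d = 0"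
  by (simp add: hilb_box_def box_mons_empty)

section \<open>Growth of the kernel dimension\<close>

lemma xdeg_Suc: "xdeg (Suc M) m = xdeg M m + m M"
  by (simp add: xdeg_def)

lemma restrict_eqD: "restrict f A = restrict g A \<Longrightarrow> x \<in> A \<Longrightarrow> f x = g x"
  by (metis restrict_apply')

text \<open>Two exponents are prescribed up to the choice in S, and the degree fixes the last one;
  N-3 remain free.\<close>

lemma card_slice_le:
  assumes N: "3 \<le> N" and S: "finite S"
  shows "card {m \<in> box_mons N q e. m 0 = a \<and> m 1 \<in> S} \<le> card S * q ^ (N - 3)"
proof -
  let ?A = "{m \<in> box_mons N q e. m 0 = a \<and> m 1 \<in> S}"
  let ?F = "\<lambda>m::nat\<Rightarrow>nat. (m 1, restrict m {2..<N-1})"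
  have "inj_on ?F ?A"
  proof (rule inj_onI)
    fix m m' assume m: "m \<in> ?A" "m' \<in> ?A" and eq: "?F m = ?F m'"
    have lt: "m i = m' i" if "i < N - 1" for i
    proof -
      consider "i = 0" | "i = 1" | "2 \<le> i" by linarith
      then show ?thesis
      proof cases
        case 3
        have "restrict m {2..<N-1} = restrict m' {2..<N-1}" using eq by simp
        from restrict_eqD[OF this, of i] show ?thesis using 3 that by simp
      qed (use m eq in auto)
    qed
    have "xdeg (N - 1) m = xdeg (N - 1) m'" unfolding xdeg_def using lt by (intro sum.cong) auto
    moreover have "xdeg N m = xdeg N m'" using m by (auto simp: box_mons_def)
    ultimately have "m (N - 1) = m' (N - 1)" using N xdeg_Suc[of "N - 1" m] xdeg_Suc[of "N - 1" m'] by simp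
    moreover have "m i = 0" "m' i = 0" if "i \<ge> N" for i using m that by (auto simp: box_mons_def xbox_def)
    ultimately show "m = m'"
      using lt by (metis ext less_antisym linorder_not_less Suc_diff_1 N le_0_eq less_le_trans zero_less_numeral)
  qed
  moreover have "?F ` ?A \<subseteq> S \<times> ({2..<N-1} \<rightarrow>\<^sub>E {..<q})"
    by (auto simp: box_mons_def xbox_def)
  moreover have "finite (S \<times> ({2..<N-1} \<rightarrow>\<^sub>E {..<q}))" using S by (simp add: finite_PiE)
  ultimately have "card ?A \<le> card (S \<times> ({2..<N-1} \<rightarrow>\<^sub>E {..<q}))" by (rule card_inj_on_le)
  also have "\<dots> = card S * q ^ (N - 3)" by (simp add: card_cartesian_product card_PiE numeral_3_eq_3 numeral_2_eq_2)
  finally show ?thesis .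
qed

lemma quad_kernelD:
  assumes "f \<in> quad_kernel p N q 1 e" "g \<in> quad_kernel p N q 1 e" "y \<in> box_mons N q (e + 2)"
  shows "int p dvd psum 2 N (\<lambda>m. f m - g m) y"
  using assms by (auto simp: quad_kernel_def psum_diff intro: dvd_diff)

lemma quad_kernel_range_eq:
  assumes "f \<in> quad_kernel p N q a e" "g \<in> quad_kernel p N q a e" "m \<in> box_mons N q e" "int p dvd f m - g m"
  shows "f m = g m"
  using assms by (intro mod_range_cong_eq[of _ p]) (auto simp: quad_kernel_def PiE_iff cong_iff_dvd_diff)

text \<open>One equation of the system Qh = 0 determines its last unknown coefficient. Both
  embeddings of kernels below prove injectivity by ordering the monomials so that this
  applies.\<close>

lemma psum_solve:
  assumes Q: "int p dvd psum 2 N h y" and i: "i < N" "2 \<le> y i"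
    and z: "\<And>j. j < N \<Longrightarrow> j \<noteq> i \<Longrightarrow> 2 \<le> y j \<Longrightarrow> int p dvd h (y(j := y j - 2))"
  shows "int p dvd h (y(i := y i - 2))"
proof -
  have "psum 2 N h y = h (y(i := y i - 2)) + (\<Sum>j\<in>{..<N}-{i}. if y j < 2 then 0 else h (y(j := y j - 2)))"
    unfolding psum_expand using i by (subst sum.remove[of _ i]) auto
  moreover have "int p dvd (\<Sum>j\<in>{..<N}-{i}. if y j < 2 then 0 else h (y(j := y j - 2)))"
    using z by (intro dvd_sum) auto
  ultimately show ?thesis using Q by (simp add: dvd_add_left_iff)
qed

lemma box_mons_upd2:
  assumes "m \<in> box_mons N q e" "i < N" "m i + k < q"
  shows "m(i := m i + k) \<in> box_mons N q (e + k)"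
  using assms xdeg_upd_add[of i N m k] by (auto simp: box_mons_def xbox_def)

lemma box_mons_diff:
  assumes "m \<in> box_mons N q (e + k)" "i < N" "k \<le> m i"
  shows "m(i := m i - k) \<in> box_mons N q e"
  using assms xdeg_upd_diff[of i N k m] xbox_upd_diff[of m N "\<lambda>_. q" i k] by (auto simp: box_mons_def)

text \<open>Multiplication by x_0 maps the kernel into the next degree and loses exactly the
  coefficients with m_0 = q-1. By the equation at m + 2e_1 and descending induction on m_1, those
  are determined by the ones with m_1 >= q-2, which make up W.\<close>

lemma ker_dim_step:
  assumes p: "prime p" and N: "3 \<le> N" and q: "3 \<le> q"
  shows "ker_dim p N q e \<le> ker_dim p N q (e + 1) + 2 * q ^ (N - 3)"
proof -
  define W where "W = {m \<in> box_mons N q e. m 0 = q - 1 \<and> m 1 \<in> {q - 2, q - 1}}"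
  have fW: "finite W" by (simp add: W_def finite_box_mons)
  have cW: "card W \<le> 2 * q ^ (N - 3)"
    using card_slice_le[OF N, of "{q - 2, q - 1}" q e "q - 1"] q unfolding W_def by (auto simp: card_insert_if)
  let ?F = "\<lambda>f. (restrict (coord_shift 1 0 f) (box_mons N q (e + 1)), restrict f W)"
  have N0: "0 < N" "1 < N" using N by auto
  have "inj_on ?F (quad_kernel p N q 1 e)"
  proof (rule inj_onI)
    fix f g assume f: "f \<in> quad_kernel p N q 1 e" and g: "g \<in> quad_kernel p N q 1 e" and eq: "?F f = ?F g"
    have W: "f m = g m" if "m \<in> W" for m
      by (rule restrict_eqD[OF _ that]) (use eq in simp)
    have 0: "f m = g m" if m: "m \<in> box_mons N q e" "m 0 < q - 1" for m
    proof -
      have "m(0 := m 0 + 1) \<in> box_mons N q (e + 1)" by (rule box_mons_upd2[OF m(1) N0(1)]) (use m in simp)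
      then have "coord_shift 1 0 f (m(0 := m 0 + 1)) = coord_shift 1 0 g (m(0 := m 0 + 1))"
        by (rule restrict_eqD[rotated]) (use eq in simp)
      then show ?thesis by (simp add: coord_shift_def)
    qed
    have 1: "f m = g m" if "m \<in> box_mons N q e" "m 0 = q - 1" for m
      using that
    proof (induction "q - m 1" arbitrary: m rule: less_induct)
      case less
      have m1: "m 1 < q" using less.prems N0 by (auto simp: box_mons_def xbox_def)
      show ?case
      proof (cases "m 1 \<in> {q - 2, q - 1}")
        case True
        then show ?thesis using W less.prems by (simp add: W_def)
      next
        case False
        then have m12: "m 1 + 2 < q" using m1 by auto
        let ?y = "m(1 := m 1 + 2)"
        have y: "?y \<in> box_mons N q (e + 2)" by (rule box_mons_upd2[OF less.prems(1) N0(2) m12])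
        have "int p dvd (\<lambda>m. f m - g m) (?y(1 := ?y 1 - 2))"
        proof (rule psum_solve[OF quad_kernelD[OF f g y] N0(2)])
          show "2 \<le> ?y 1" by simp
        next
          fix j assume j: "j < N" "j \<noteq> 1" "2 \<le> ?y j"
          let ?z = "?y(j := ?y j - 2)"
          have z: "?z \<in> box_mons N q e" by (rule box_mons_diff[OF y j(1,3)])
          have "f ?z = g ?z"
          proof (cases "j = 0")
            case True
            then show ?thesis using 0[OF z] j less.prems q by auto
          next
            case False
            have "?z 1 = m 1 + 2" using j by simp
            then have "q - ?z 1 < q - m 1" using m12 by simp
            moreover have "?z 0 = q - 1" using False less.prems by simp
            ultimately show ?thesis using less.hyps z by blast
          qed
          then show "int p dvd f ?z - g ?z" by simp
        qed
        then have "int p dvd f m - g m" by simp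
        then show ?thesis by (rule quad_kernel_range_eq[OF f g less.prems(1)])
      qed
    qed
    have "f m = g m" if m: "m \<in> box_mons N q e" for m
    proof -
      have "m 0 < q" using m N0 by (auto simp: box_mons_def xbox_def)
      then show ?thesis using 0[OF m] 1[OF m] by linarith
    qed
    moreover have "f \<in> extensional (box_mons N q e)" "g \<in> extensional (box_mons N q e)"
      using f g by (auto simp: quad_kernel_def PiE_iff)
    ultimately show "f = g" by (auto intro: extensionalityI)
  qed
  moreover have "?F ` quad_kernel p N q 1 e \<subseteq> quad_kernel p N q 1 (e + 1) \<times> (W \<rightarrow>\<^sub>E {0..<int p})"
  proof
    fix z assume "z \<in> ?F ` quad_kernel p N q 1 e"
    then obtain f where f: "f \<in> quad_kernel p N q 1 e" and z: "z = ?F f" by blast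
    have fr: "f m \<in> {0..<int p}" if "m \<in> box_mons N q e" for m using f that by (auto simp: quad_kernel_def PiE_iff)
    have "restrict (coord_shift 1 0 f) (box_mons N q (e + 1)) \<in> quad_kernel p N q 1 (e + 1)"
      unfolding quad_kernel_def
    proof (intro CollectI conjI ballI)
      have p0: "0 < p" using p by (rule prime_gt_0_nat)
      show "restrict (coord_shift 1 0 f) (box_mons N q (e + 1)) \<in> box_mons N q (e + 1) \<rightarrow>\<^sub>E {0..<int p}"
      proof (rule restrict_PiE_iff[THEN iffD2], intro ballI)
        fix m assume m: "m \<in> box_mons N q (e + 1)"
        show "coord_shift 1 0 f m \<in> {0..<int p}"
          using fr[of "m(0 := m 0 - 1)"] box_mons_diff[of m N q e 1 0] m p0 N0(1) by (auto simp: coord_shift_def)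
      qed
      fix y assume y: "y \<in> box_mons N q (e + 1 + 2 * 1)"
      have "psum 2 N (restrict (coord_shift 1 0 f) (box_mons N q (e + 1))) y = psum 2 N (coord_shift 1 0 f) y"
        using psum_pow_eq_local[of N q "e + 1" "restrict (coord_shift 1 0 f) (box_mons N q (e + 1))" "coord_shift 1 0 f" y 2 1] y by simp
      also have "\<dots> = coord_shift 1 0 (psum 2 N f) y" by (simp add: coord_shift_psum)
      also have "int p dvd coord_shift 1 0 (psum 2 N f) y"
      proof (cases "y 0 < 1")
        case False
        then have "y(0 := y 0 - 1) \<in> box_mons N q (e + 2)" using y by (intro box_mons_diff[OF _ N0(1)]) (auto simp: add.commute)
        then show ?thesis using f False by (auto simp: coord_shift_def quad_kernel_def)
      qed (simp add: coord_shift_def)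
      finally show "int p dvd (psum 2 N ^^ 1) (restrict (coord_shift 1 0 f) (box_mons N q (e + 1))) y" by simp
    qed
    moreover have "restrict f W \<in> W \<rightarrow>\<^sub>E {0..<int p}" using fr by (auto simp: W_def)
    ultimately show "z \<in> quad_kernel p N q 1 (e + 1) \<times> (W \<rightarrow>\<^sub>E {0..<int p})" unfolding z by blast
  qed
  moreover have "finite (quad_kernel p N q 1 (e + 1) \<times> (W \<rightarrow>\<^sub>E {0..<int p}))"
    by (intro finite_cartesian_product finite_quad_kernel finite_PiE fW) auto
  ultimately have "card (quad_kernel p N q 1 e) \<le> card (quad_kernel p N q 1 (e + 1) \<times> (W \<rightarrow>\<^sub>E {0..<int p}))"
    by (rule card_inj_on_le)
  also have "\<dots> = p ^ (ker_dim p N q (e + 1) + card W)"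
    unfolding card_cartesian_product card_quad_kernel1[OF p] card_PiE_mod[OF fW] by (simp add: power_add)
  finally have "p ^ ker_dim p N q e \<le> p ^ (ker_dim p N q (e + 1) + card W)"
    unfolding card_quad_kernel1[OF p] .
  then have "ker_dim p N q e \<le> ker_dim p N q (e + 1) + card W" by (rule power_prime_le[OF p])
  then show ?thesis using cW by linarith
qed

lemma ker_dim_steps:
  assumes p: "prime p" and N: "3 \<le> N" and q: "3 \<le> q"
  shows "ker_dim p N q e \<le> ker_dim p N q (e + k) + k * (2 * q ^ (N - 3))"
proof (induction k)
  case (Suc k)
  then show ?case using ker_dim_step[OF p N q, of "e + k"] by simp
qed simp

text \<open>Residues modulo p with J_0 = p-1 that occur in degree e; the component along J lives in
  degree (e - |J|)/p.\<close>

definition residue_exps :: "nat \<Rightarrow> nat \<Rightarrow> nat \<Rightarrow> (nat \<Rightarrow> nat) set" where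
  "residue_exps p N e = {J \<in> cube N p. J 0 = p - 1 \<and> xdeg N J \<le> e \<and> p dvd e - xdeg N J}"

text \<open>J_0 is fixed, and J_1 is determined by the degree modulo p.\<close>

lemma card_residue_exps:
  assumes N: "2 \<le> N" and p: "0 < p"
  shows "card (residue_exps p N e) \<le> p ^ (N - 2)"
proof -
  let ?F = "\<lambda>J::nat\<Rightarrow>nat. restrict J {2..<N}"
  have "inj_on ?F (residue_exps p N e)"
  proof (rule inj_onI)
    fix m m' assume m: "m \<in> residue_exps p N e" "m' \<in> residue_exps p N e" and eq: "?F m = ?F m'"
    have ge2: "m i = m' i" if "2 \<le> i" for i
    proof (cases "i < N")
      case True
      then show ?thesis using fun_cong[OF eq, of i] that by simp
    next
      case False
      then show ?thesis using m by (auto simp: residue_exps_def xbox_def)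
    qed
    have 0: "m 0 = m' 0" using m by (auto simp: residue_exps_def)
    have s: "xdeg N f = f 1 + (\<Sum>i\<in>{..<N}-{1}. f i)" for f
      unfolding xdeg_def using N by (subst sum.remove[of _ 1]) auto
    have "(\<Sum>i\<in>{..<N}-{1}. m i) = (\<Sum>i\<in>{..<N}-{1}. m' i)"
    proof (rule sum.cong[OF refl])
      fix i assume "i \<in> {..<N} - {1}"
      then have "i = 0 \<or> 2 \<le> i" by auto
      then show "m i = m' i" using 0 ge2 by auto
    qed
    then have d: "xdeg N m + m' 1 = xdeg N m' + m 1" using s[of m] s[of m'] by simp
    have "[xdeg N m = xdeg N m'] (mod p)"
    proof -
      have "[e = xdeg N m] (mod p)" "[e = xdeg N m'] (mod p)"
        using m by (auto simp: residue_exps_def cong_def mod_eq_dvd_iff_nat)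
      then show ?thesis by (simp add: cong_def)
    qed
    moreover have "[xdeg N m + m' 1 = xdeg N m' + m 1] (mod p)" using d by simp
    ultimately have "[m' 1 = m 1] (mod p)" by (metis cong_add_lcancel_nat cong_trans cong_add cong_refl cong_sym)
    moreover have "m 1 < p" "m' 1 < p" using m N by (auto simp: residue_exps_def xbox_def)
    ultimately have "m 1 = m' 1" by (simp add: cong_def)
    then show "m = m'" using 0 ge2 by (metis ext One_nat_def Suc_1 Suc_leI less_one nat_neq_iff)
  qed
  moreover have "?F ` residue_exps p N e \<subseteq> {2..<N} \<rightarrow>\<^sub>E {..<p}"
    by (auto simp: residue_exps_def xbox_def)
  moreover have "finite ({2..<N} \<rightarrow>\<^sub>E {..<p})" by (simp add: finite_PiE)
  ultimately have "card (residue_exps p N e) \<le> card ({2..<N} \<rightarrow>\<^sub>E {..<p})" by (rule card_inj_on_le)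
  also have "\<dots> = p ^ (N - 2)" by (simp add: card_PiE)
  finally show ?thesis .
qed

lemma finite_residue_exps: "finite (residue_exps p N e)"
  by (rule finite_subset[OF _ finite_cube[of N p]]) (auto simp: residue_exps_def)

lemma cube_decomp:
  assumes m: "m \<in> cube N (p * q)" and p: "0 < p"
  obtains J k where "J \<in> cube N p" "k \<in> cube N q" "m = (\<lambda>i. p * k i + J i)" "\<And>i. J i = m i mod p"
  using that[of "\<lambda>i. m i mod p" "\<lambda>i. m i div p"] cube_mod[OF m p] cube_div[OF m p] by simp

text \<open>A kernel element is determined by its coefficients with m_0 = -1 modulo p and those in
  W. The equation at m + 2e_0 carries vanishing from row m_0 = t to row t-2, so row pq-1 settles all
  even m_0 and row pq-2 all odd ones. In row pq-2 only the slice m_1 >= pq-(p-1) is prescribed, and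
  a staircase settles the rest. The retained components lie in kernels for q because Q^p kills
  f.\<close>

lemma ker_dim_frobenius:
  assumes p: "prime p" "odd p" and N: "3 \<le> N" and q: "q = p ^ s" "3 \<le> q"
  shows "ker_dim p N (p * q) e \<le> (\<Sum>J\<in>residue_exps p N e. ker_dim p N q ((e - xdeg N J) div p)) + (p - 1) * (p * q) ^ (N - 3)"
proof -
  have p2: "2 \<le> p" using p(1) by (rule prime_ge_2_nat)
  then have p3: "3 \<le> p" using p(2) by (cases "p = 2") auto
  have p0: "0 < p" using p2 by simp
  have N0: "0 < N" "1 < N" using N by auto
  define W where "W = {m \<in> box_mons N (p * q) e. m 0 = p * q - 2 \<and> m 1 \<in> {p * q - (p - 1)..<p * q}}"
  have fW: "finite W" by (simp add: W_def finite_box_mons)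
  have pqp: "3 * p \<le> p * q" using q(2) by simp
  have cW: "card W \<le> (p - 1) * (p * q) ^ (N - 3)"
    using card_slice_le[OF N, of "{p * q - (p - 1)..<p * q}" "p * q" e "p * q - 2"] pqp p2 unfolding W_def by simp
  define r where "r J = (e - xdeg N J) div p" for J
  have rJ: "p * r J + xdeg N J = e" if "J \<in> residue_exps p N e" for J
    using that by (auto simp: r_def residue_exps_def)
  let ?J = "residue_exps p N e"
  let ?F = "\<lambda>f. (\<lambda>J\<in>?J. restrict (residue_component p J f) (box_mons N q (r J)), restrict f W)"
  have cbx: "(\<lambda>i. p * k i + J i) \<in> box_mons N (p * q) e" if "J \<in> ?J" "k \<in> box_mons N q (r J)" for J k
    using cube_comb[of J N p k q] that rJ[of J] by (auto simp: box_mons_def residue_exps_def xdeg_comb)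
  have "inj_on ?F (quad_kernel p N (p * q) 1 e)"
  proof (rule inj_onI)
    fix f g assume f: "f \<in> quad_kernel p N (p * q) 1 e" and g: "g \<in> quad_kernel p N (p * q) 1 e" and eq: "?F f = ?F g"
    let ?h = "\<lambda>m. f m - g m"
    have eq1: "(\<lambda>J\<in>?J. restrict (residue_component p J f) (box_mons N q (r J))) = (\<lambda>J\<in>?J. restrict (residue_component p J g) (box_mons N q (r J)))"
      and eq2: "restrict f W = restrict g W" using eq by auto
    have zW: "int p dvd ?h m" if "m \<in> W" for m using restrict_eqD[OF eq2 that] by simp
    have zJ: "int p dvd ?h m" if m: "m \<in> box_mons N (p * q) e" "m 0 mod p = p - 1" for m
    proof -
      have mc: "m \<in> cube N (p * q)" using m by (simp add: box_mons_def)
      obtain J k where Jk: "J \<in> cube N p" "k \<in> cube N q" "m = (\<lambda>i. p * k i + J i)" "\<And>i. J i = m i mod p"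
        using cube_decomp[OF mc p0] by blast
      have d: "p * xdeg N k + xdeg N J = e" using m(1) Jk(3) by (auto simp: box_mons_def xdeg_comb)
      have J: "J \<in> ?J" using Jk d m(2) by (auto simp: residue_exps_def)
      have "xdeg N k = r J" using d p0 by (auto simp: r_def)
      then have k: "k \<in> box_mons N q (r J)" using Jk(2) by (simp add: box_mons_def)
      have "restrict (residue_component p J f) (box_mons N q (r J)) = restrict (residue_component p J g) (box_mons N q (r J))"
        by (rule restrict_eqD[OF eq1 J])
      from restrict_eqD[OF this k] show ?thesis by (simp add: residue_component_def Jk(3))
    qed
    have solve: "int p dvd ?h m"
      if m: "m \<in> box_mons N (p * q) e" and i: "i < N" "m i + 2 < p * q"
        and z: "\<And>j. j < N \<Longrightarrow> j \<noteq> i \<Longrightarrow> 2 \<le> m j \<Longrightarrow> (m(i := m i + 2))(j := m j - 2) \<in> box_mons N (p * q) e \<Longrightarrow>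
          int p dvd ?h ((m(i := m i + 2))(j := m j - 2))" for m i
    proof -
      let ?y = "m(i := m i + 2)"
      have y: "?y \<in> box_mons N (p * q) (e + 2)" by (rule box_mons_upd2[OF m i])
      have "int p dvd ?h (?y(i := ?y i - 2))"
      proof (rule psum_solve[OF quad_kernelD[OF f g y] i(1)])
        fix j assume j: "j < N" "j \<noteq> i" "2 \<le> ?y j"
        have "?y(j := ?y j - 2) \<in> box_mons N (p * q) e" by (rule box_mons_diff[OF y j(1,3)])
        then show "int p dvd ?h (?y(j := ?y j - 2))" using z[OF j(1,2)] j by simp
      qed simp
      then show ?thesis by simp
    qed
    have row: "int p dvd ?h m" if top: "\<And>m. m \<in> box_mons N (p * q) e \<Longrightarrow> m 0 = t \<Longrightarrow> int p dvd ?h m" and t: "t < p * q"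
      and m: "m \<in> box_mons N (p * q) e" "m 0 + 2 * k = t" for t k m
      using m
    proof (induction k arbitrary: m)
      case 0 then show ?case using top by simp
    next
      case (Suc k)
      show ?case
      proof (rule solve[OF Suc.prems(1) N0(1)])
        show "m 0 + 2 < p * q" using Suc.prems(2) t by simp
        fix j assume j: "j < N" "j \<noteq> 0" "2 \<le> m j" "(m(0 := m 0 + 2))(j := m j - 2) \<in> box_mons N (p * q) e"
        have "((m(0 := m 0 + 2))(j := m j - 2)) 0 + 2 * k = t" using j Suc.prems(2) by simp
        then show "int p dvd ?h ((m(0 := m 0 + 2))(j := m j - 2))" using Suc.IH[OF j(4)] by blast
      qed
    qed
    have oddq: "odd q" using p(2) q(1) by simp
    have pqmod: "(p * q - 1) mod p = p - 1"
    proof -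
      have "p * q - 1 = (p - 1) + p * (q - 1)" using q(2) p2 by (cases q) auto
      then have "(p * q - 1) mod p = (p - 1) mod p" by (simp only: mod_mult_self2)
      then show ?thesis using p2 by simp
    qed
    have Q0: "p * (q - 1) + p = p * q" using q(2) by (cases q) auto
    have even: "int p dvd ?h m" if m: "m \<in> box_mons N (p * q) e" "even (m 0)" for m
    proof -
      have "m 0 < p * q" using m N0 by (auto simp: box_mons_def xbox_def)
      moreover have "even (p * q - 1)" using oddq p(2) by simp
      ultimately obtain k where "m 0 + 2 * k = p * q - 1"
        using m(2) by (metis Suc_diff_1 Suc_leI diff_Suc_1 dvdE dvd_diff_nat gr_implies_not0 le_add_diff_inverse less_Suc_eq_le neq0_conv)
      then show ?thesis
        by (intro row[where t="p * q - 1", OF _ _ m(1)]) (use zJ pqmod p2 pqp in auto)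
    qed
    text \<open>The staircase argument: values at \<open>m\<^sub>0 = pq - 2\<close> propagate along \<open>m\<^sub>0 - 2s\<close>, \<open>m\<^sub>1 + 2s\<close>
      to a row \<open>m\<^sub>0 = -1\<close> modulo \<open>p\<close>, where everything vanishes.\<close>
    have stair: "int p dvd ?h m" if hi: "\<And>m. m \<in> box_mons N (p * q) e \<Longrightarrow> m 0 = p * q - 2 \<Longrightarrow> j < m 1 \<Longrightarrow> int p dvd ?h m"
      and m: "m \<in> box_mons N (p * q) e" "m 0 + 2 * k = p * q - 2" "j + 2 * k < m 1" for j k m
      using m
    proof (induction k arbitrary: m)
      case 0 then show ?case using hi by simp
    next
      case (Suc k)
      show ?case
      proof (rule solve[OF Suc.prems(1) N0(1)])
        show "m 0 + 2 < p * q" using Suc.prems(2) pqp p2 by simp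
        fix i assume i: "i < N" "i \<noteq> 0" "2 \<le> m i" "(m(0 := m 0 + 2))(i := m i - 2) \<in> box_mons N (p * q) e"
        show "int p dvd ?h ((m(0 := m 0 + 2))(i := m i - 2))"
          by (rule Suc.IH[OF i(4)]) (use i Suc.prems in auto)
      qed
    qed
    have diag: "int p dvd ?h m"
      if hi: "\<And>m. m \<in> box_mons N (p * q) e \<Longrightarrow> m 0 = p * q - 2 \<Longrightarrow> j < m 1 \<Longrightarrow> int p dvd ?h m"
      and m: "m \<in> box_mons N (p * q) e" "m 0 + 2 * k = p * q - 2" "j + 2 * k = m 1"
        "2 * (k + t) = p - 1" "j + (p - 1) < p * q" for j k t m
      using m
    proof (induction t arbitrary: m k)
      case 0
      have "m 0 + (p - 1) = p * q - 2" using 0 by simp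
      then have "m 0 = (p - 1) + p * (q - 2)" using q(2) pqp p2 by (cases q; cases "q - 1") (auto simp: algebra_simps)
      then have "m 0 mod p = (p - 1) mod p" by (simp only: mod_mult_self2)
      then have "m 0 mod p = p - 1" using p2 by simp
      then show ?case using zJ 0 by blast
    next
      case (Suc t)
      have pk: "2 * k + 2 * t + 3 = p" using Suc.prems(4) p3 by simp
      have "2 \<le> x" if "x + 2 * k = U - 2" "3 * p \<le> U" for x U using that pk by arith
      from this[OF Suc.prems(2) pqp] have m02: "2 \<le> m 0" .
      have m12: "m 1 + 2 < p * q" using Suc.prems(3,5) pk by linarith
      show ?case
      proof (rule solve[OF Suc.prems(1) N0(2) m12])
        fix i assume i: "i < N" "i \<noteq> 1" "2 \<le> m i" "(m(1 := m 1 + 2))(i := m i - 2) \<in> box_mons N (p * q) e"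
        show "int p dvd ?h ((m(1 := m 1 + 2))(i := m i - 2))"
        proof (cases "i = 0")
          case True
          show ?thesis
            by (rule Suc.IH[OF i(4), of "Suc k"]) (use True Suc.prems m02 in auto)
        next
          case False
          show ?thesis
            by (rule stair[where j=j and k=k, OF hi i(4)]) (use False i Suc.prems in auto)
        qed
      qed
    qed
    have top: "int p dvd ?h m" if m: "m \<in> box_mons N (p * q) e" "m 0 = p * q - 2" for m
      using m
    proof (induction "p * q - m 1" arbitrary: m rule: less_induct)
      case less
      have m1: "m 1 < p * q" using less.prems N0 by (auto simp: box_mons_def xbox_def)
      show ?case
      proof (cases "m 1 \<in> {p * q - (p - 1)..<p * q}")
        case True
        then show ?thesis using less.prems by (intro zW) (simp add: W_def)
      next
        case False
        \<comment> \<open>The number of steps from row pq-2 down to row pq-2-(p-1) = p(q-1)-1, which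
          is -1 modulo p.\<close>
        obtain t where t: "2 * t = p - 1" using p(2) by (metis dvd_def odd_two_times_div_two_nat even_diff_nat)
        show ?thesis
        proof (rule diag[of "m 1" m 0 t])
          fix m' assume "m' \<in> box_mons N (p * q) e" "m' 0 = p * q - 2" "m 1 < m' 1"
          then show "int p dvd ?h m'" using less.hyps[of m'] m1 by simp
        qed (use less.prems False m1 t in auto)
      qed
    qed
    have odd: "int p dvd ?h m" if m: "m \<in> box_mons N (p * q) e" "odd (m 0)" for m
    proof -
      have lt: "m 0 < p * q" using m N0 by (auto simp: box_mons_def xbox_def)
      have "2 \<le> p * q" using pqp p2 by linarith
      then have "odd (p * q - 2)" using oddq p(2) by simp
      have "even (p * q - 1)" using oddq p(2) by simp
      then have "m 0 \<noteq> p * q - 1" using m(2) by metis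
      then have "m 0 \<le> p * q - 2" using lt by linarith
      then have "even (p * q - 2 - m 0)" using \<open>odd (p * q - 2)\<close> m(2) by simp
      then obtain k where "p * q - 2 - m 0 = 2 * k" by blast
      then have "m 0 + 2 * k = p * q - 2" using \<open>m 0 \<le> p * q - 2\<close> by simp
      then show ?thesis
        by (intro row[where t="p * q - 2", OF _ _ m(1)]) (use top pqp p2 in auto)
    qed
    have "f m = g m" if m: "m \<in> box_mons N (p * q) e" for m
      by (rule quad_kernel_range_eq[OF f g m]) (use even[OF m] odd[OF m] in blast)
    moreover have "f \<in> extensional (box_mons N (p * q) e)" "g \<in> extensional (box_mons N (p * q) e)"
      using f g by (auto simp: quad_kernel_def PiE_iff)
    ultimately show "f = g" by (auto intro: extensionalityI)
  qed
  moreover have "?F ` quad_kernel p N (p * q) 1 e \<subseteq> (\<Pi>\<^sub>E J\<in>?J. quad_kernel p N q 1 (r J)) \<times> (W \<rightarrow>\<^sub>E {0..<int p})"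
  proof
    fix z assume "z \<in> ?F ` quad_kernel p N (p * q) 1 e"
    then obtain f where f: "f \<in> quad_kernel p N (p * q) 1 e" and z: "z = ?F f" by blast
    have fr: "f m \<in> {0..<int p}" if "m \<in> box_mons N (p * q) e" for m using f that by (auto simp: quad_kernel_def PiE_iff)
    have "restrict (residue_component p J f) (box_mons N q (r J)) \<in> quad_kernel p N q 1 (r J)" if J: "J \<in> ?J" for J
      unfolding quad_kernel_def
    proof (intro CollectI conjI ballI)
      show "restrict (residue_component p J f) (box_mons N q (r J)) \<in> box_mons N q (r J) \<rightarrow>\<^sub>E {0..<int p}"
      proof (rule restrict_PiE_iff[THEN iffD2], intro ballI)
        fix k assume "k \<in> box_mons N q (r J)"
        then show "residue_component p J f k \<in> {0..<int p}" unfolding residue_component_def by (intro fr cbx[OF J])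
      qed
      fix y assume y: "y \<in> box_mons N q (r J + 2 * 1)"
      let ?m = "\<lambda>i. p * y i + J i"
      have Jc: "J \<in> cube N p" using J by (simp add: residue_exps_def)
      have Jp: "J i < p" if "i < N" for i using Jc that by (auto simp: xbox_def)
      have "psum 2 N (restrict (residue_component p J f) (box_mons N q (r J))) y = psum 2 N (residue_component p J f) y"
        using psum_pow_eq_local[of N q "r J" "restrict (residue_component p J f) (box_mons N q (r J))" "residue_component p J f" y 2 1] y by simp
      also have "\<dots> = psum (p * 2) N f ?m"
        using fun_cong[OF residue_component_psum[where r=p and N=N and J=J and ?k0.0=2 and f=f, OF p0 Jp], of y] by (simp add: residue_component_def)
      also have "int p dvd psum (p * 2) N f ?m"
      proof -
        have "int p dvd (psum 2 N ^^ (p - 1)) (psum 2 N f) ?m"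
        proof (rule psum_pow_dvd_local[where b="\<lambda>_. p * q" and l=0 and e="e + 2"])
          fix m assume "m \<in> cube N (p * q)" "xdeg N m + 0 = e + 2"
          then show "int p dvd psum 2 N f m" using f by (auto simp: quad_kernel_def box_mons_def)
        next
          show "?m \<in> cube N (p * q)" using cube_comb[OF Jc, of y q] y by (simp add: box_mons_def)
          have "xdeg N y = r J + 2" using y by (simp add: box_mons_def)
          then show "xdeg N ?m + 0 = e + 2 + 2 * (p - 1)"
            unfolding xdeg_comb using rJ[OF J] p2 by (simp add: algebra_simps)
        qed
        then have "int p dvd (psum 2 N ^^ p) f ?m" using p0 by (simp add: funpow_pred del: One_nat_def)
        moreover have "int p dvd (psum 2 N ^^ p) f ?m - psum (2 * p) N f ?m" by (rule psum_frobenius[OF p(1)])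
        ultimately show ?thesis by (simp add: dvd_diff_right_iff mult.commute)
      qed
      finally show "int p dvd (psum 2 N ^^ 1) (restrict (residue_component p J f) (box_mons N q (r J))) y" by simp
    qed
    moreover have "restrict f W \<in> W \<rightarrow>\<^sub>E {0..<int p}" using fr by (auto simp: W_def)
    ultimately show "z \<in> (\<Pi>\<^sub>E J\<in>?J. quad_kernel p N q 1 (r J)) \<times> (W \<rightarrow>\<^sub>E {0..<int p})" unfolding z by auto
  qed
  moreover have "finite ((\<Pi>\<^sub>E J\<in>?J. quad_kernel p N q 1 (r J)) \<times> (W \<rightarrow>\<^sub>E {0..<int p}))"
    by (intro finite_cartesian_product finite_quad_kernel finite_PiE fW finite_residue_exps) auto
  ultimately have "card (quad_kernel p N (p * q) 1 e) \<le> card ((\<Pi>\<^sub>E J\<in>?J. quad_kernel p N q 1 (r J)) \<times> (W \<rightarrow>\<^sub>E {0..<int p}))"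
    by (rule card_inj_on_le)
  also have "\<dots> = (\<Prod>J\<in>?J. p ^ ker_dim p N q (r J)) * p ^ card W"
    unfolding card_cartesian_product card_PiE[OF finite_residue_exps] card_quad_kernel1[OF p(1)] card_PiE_mod[OF fW] ..
  also have "\<dots> = p ^ ((\<Sum>J\<in>?J. ker_dim p N q (r J)) + card W)"
    by (simp add: power_add power_sum)
  finally have "p ^ ker_dim p N (p * q) e \<le> p ^ ((\<Sum>J\<in>?J. ker_dim p N q (r J)) + card W)"
    unfolding card_quad_kernel1[OF p(1)] .
  then have "ker_dim p N (p * q) e \<le> (\<Sum>J\<in>?J. ker_dim p N q (r J)) + card W" by (rule power_prime_le[OF p(1)])
  then show ?thesis using cW unfolding r_def by linarith
qed

text \<open>All components live in degrees at most N below \<open>e div p\<close>. Moving each of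
  them to \<open>e div p\<close> costs 2q^(N-3) per degree, whence 2N; the last unit of 2N+1 bounds
  the contribution of W.\<close>

lemma ker_dim_frobenius':
  assumes p: "prime p" "odd p" and N: "3 \<le> N" and q: "q = p ^ s" "3 \<le> q"
  shows "ker_dim p N (p * q) e \<le> p ^ (N - 2) * ker_dim p N q (e div p) + (2 * N + 1) * p ^ (N - 2) * q ^ (N - 3)"
proof -
  have p2: "2 \<le> p" using p(1) by (rule prime_ge_2_nat)
  let ?M = "ker_dim p N q (e div p) + N * (2 * q ^ (N - 3))"
  have le: "ker_dim p N q ((e - xdeg N J) div p) \<le> ?M" if J: "J \<in> residue_exps p N e" for J
  proof -
    have Jc: "J \<in> cube N p" and Je: "xdeg N J \<le> e" using J by (auto simp: residue_exps_def)
    have "xdeg N J \<le> N * (p - 1)" using xdeg_complement_exp[OF Jc] by simp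
    also have "\<dots> \<le> p * N" by (metis diff_le_self mult.commute mult_le_mono2)
    finally have d: "xdeg N J div p \<le> N" by (metis div_le_mono nonzero_mult_div_cancel_left p2 not_numeral_le_zero)
    define a where "a = (e - xdeg N J) div p"
    have "e - xdeg N J = p * a" using J by (auto simp: residue_exps_def a_def)
    then have "e = p * a + xdeg N J" using Je by simp
    then have e: "e div p = a + xdeg N J div p" using p2 by simp
    have "ker_dim p N q a \<le> ker_dim p N q (e div p) + (xdeg N J div p) * (2 * q ^ (N - 3))"
      unfolding e by (rule ker_dim_steps[OF p(1) N q(2)])
    also have "\<dots> \<le> ?M" using d by (intro add_left_mono mult_le_mono1)
    finally show ?thesis by (simp add: a_def)
  qed
  have "(\<Sum>J\<in>residue_exps p N e. ker_dim p N q ((e - xdeg N J) div p)) \<le> card (residue_exps p N e) * ?M"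
    using sum_bounded_above[of "residue_exps p N e" _ ?M] le by simp
  also have "\<dots> \<le> p ^ (N - 2) * ?M"
    by (intro mult_le_mono1 card_residue_exps) (use N p2 in auto)
  finally have 1: "(\<Sum>J\<in>residue_exps p N e. ker_dim p N q ((e - xdeg N J) div p)) \<le> p ^ (N - 2) * ?M" .
  have "N - 2 = Suc (N - 3)" using N by simp
  then have "(p - 1) * (p * q) ^ (N - 3) \<le> p ^ (N - 2) * q ^ (N - 3)"
    by (simp add: power_mult_distrib mult_le_mono)
  then show ?thesis using ker_dim_frobenius[OF p N q, of e] 1 by (simp add: algebra_simps)
qed

section \<open>Descent to the prime field\<close>

context ring
begin

lemma of_int_sum: "finite A \<Longrightarrow> \<guillemotleft>\<Sum>x\<in>A. f x\<guillemotright> = (\<Oplus>x\<in>A. \<guillemotleft>f x\<guillemotright>)"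
  by (induction A rule: finite_induct) simp_all

lemma add_pow_one_eq_of_nat: "[n] \<cdot> \<one> = \<guillemotleft>n\<guillemotright>\<^sub>\<nat>"
  by (induction n) (simp_all add: add.nat_pow_Suc a_comm)

end

context cring
begin

lemma finsum_swap_mult:
  assumes "finite B" "finite M" "\<And>m. m \<in> M \<Longrightarrow> g m \<in> carrier R" "\<And>b. b \<in> B \<Longrightarrow> d b \<in> carrier R"
    "\<And>b m. b \<in> B \<Longrightarrow> m \<in> M \<Longrightarrow> h b m \<in> carrier R"
  shows "(\<Oplus>m\<in>M. g m \<otimes> (\<Oplus>b\<in>B. d b \<otimes> h b m)) = (\<Oplus>b\<in>B. d b \<otimes> (\<Oplus>m\<in>M. g m \<otimes> h b m))"
  using assms(1,4,5)
proof (induction B rule: finite_induct)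
  case empty
  have "(\<Oplus>m\<in>M. g m \<otimes> \<zero>) = (\<Oplus>m\<in>M. \<zero>)"
    using assms(3) by (intro add.finprod_cong') auto
  then show ?case by simp
next
  case (insert b B)
  have 1: "(\<Oplus>m\<in>M. g m \<otimes> (\<Oplus>b\<in>insert b B. d b \<otimes> h b m))
    = (\<Oplus>m\<in>M. d b \<otimes> (g m \<otimes> h b m) \<oplus> g m \<otimes> (\<Oplus>b\<in>B. d b \<otimes> h b m))"
  proof (intro add.finprod_cong')
    fix m assume m: "m \<in> M"
    have "(\<Oplus>b\<in>insert b B. d b \<otimes> h b m) = d b \<otimes> h b m \<oplus> (\<Oplus>b\<in>B. d b \<otimes> h b m)"
      using insert m by (intro finsum_insert) auto
    moreover have "(\<Oplus>b\<in>B. d b \<otimes> h b m) \<in> carrier R" using insert m by (intro finsum_closed) auto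
    moreover have "g m \<in> carrier R" "d b \<in> carrier R" "h b m \<in> carrier R" using assms(3) insert m by auto
    ultimately show "g m \<otimes> (\<Oplus>b\<in>insert b B. d b \<otimes> h b m) = d b \<otimes> (g m \<otimes> h b m) \<oplus> g m \<otimes> (\<Oplus>b\<in>B. d b \<otimes> h b m)"
      by (simp add: r_distr m_lcomm)
  qed (use assms(3) insert in \<open>auto intro!: finsum_closed\<close>)
  have "(\<Oplus>m\<in>M. d b \<otimes> (g m \<otimes> h b m) \<oplus> g m \<otimes> (\<Oplus>b\<in>B. d b \<otimes> h b m))
    = (\<Oplus>m\<in>M. d b \<otimes> (g m \<otimes> h b m)) \<oplus> (\<Oplus>m\<in>M. g m \<otimes> (\<Oplus>b\<in>B. d b \<otimes> h b m))"
    using assms(3) insert by (intro finsum_addf) (auto intro!: finsum_closed)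
  also have "(\<Oplus>m\<in>M. d b \<otimes> (g m \<otimes> h b m)) = d b \<otimes> (\<Oplus>m\<in>M. g m \<otimes> h b m)"
    using assms(2,3) insert by (intro finsum_rdistr[symmetric]) auto
  also have "(\<Oplus>m\<in>M. g m \<otimes> (\<Oplus>b\<in>B. d b \<otimes> h b m)) = (\<Oplus>b\<in>B. d b \<otimes> (\<Oplus>m\<in>M. g m \<otimes> h b m))"
    using insert by auto
  also have "d b \<otimes> (\<Oplus>m\<in>M. g m \<otimes> h b m) \<oplus> (\<Oplus>b\<in>B. d b \<otimes> (\<Oplus>m\<in>M. g m \<otimes> h b m))
     = (\<Oplus>b\<in>insert b B. d b \<otimes> (\<Oplus>m\<in>M. g m \<otimes> h b m))"
    using insert assms(3) by (intro finsum_insert[symmetric]) (auto intro!: finsum_closed)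
  finally show ?case using 1 by simp
qed

end

locale char_field = field K for K (structure) +
  fixes p :: nat
  assumes p: "Factorial_Ring.prime p" and char: "[p] \<cdot> \<one> = \<zero>"
begin

lemma of_int_eq_0_iff: "\<guillemotleft>i\<guillemotright> = \<zero> \<longleftrightarrow> int p dvd i"
proof -
  have p0: "\<guillemotleft>int p\<guillemotright> = \<zero>" using char by (simp add: add_pow_one_eq_of_nat of_integer_def)
  have mult0: "\<guillemotleft>int p * j\<guillemotright> = \<zero>" for j using p0 by simp
  show ?thesis
  proof
    assume "int p dvd i"
    then show "\<guillemotleft>i\<guillemotright> = \<zero>" using mult0 by (auto simp: dvd_def)
  next
    assume i: "\<guillemotleft>i\<guillemotright> = \<zero>"
    show "int p dvd i"
    proof (rule ccontr)
      assume "\<not> int p dvd i"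
      then obtain s where "[s * i = 1] (mod int p)" using inverse_mod_prime_int[OF p] by blast
      then obtain t where "s * i = 1 + int p * t" by (metis cong_iff_lin cong_sym)
      then have "\<guillemotleft>s\<guillemotright> \<otimes> \<guillemotleft>i\<guillemotright> = \<one> \<oplus> \<guillemotleft>int p * t\<guillemotright>" by (metis of_int_1 of_int_add of_int_mult)
      then have "\<zero> = \<one>" unfolding mult0 using i by simp
      then show False by simp
    qed
  qed
qed

lemma of_int_eq_iff: "\<guillemotleft>i\<guillemotright> = \<guillemotleft>j\<guillemotright> \<longleftrightarrow> [i = j] (mod int p)"
proof -
  have "\<guillemotleft>i\<guillemotright> = \<guillemotleft>j\<guillemotright> \<longleftrightarrow> \<guillemotleft>i - j\<guillemotright> = \<zero>" by (simp add: r_right_minus_eq)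
  then show ?thesis by (simp only: of_int_eq_0_iff cong_iff_dvd_diff)
qed

text \<open>Rank is unchanged on passing from the prime field to K. An independent set over K has
  pairwise distinct integer combinations modulo p, which bounds its size. Conversely, functionals
  dual modulo p remain dual over K, so the basis stays independent.\<close>

lemma span_dim_of_int:
  assumes M: "finite M" and E: "finite E"
  shows "span_dim K M ((\<lambda>e m. \<guillemotleft>v e m\<guillemotright>) ` E) = rank_mod p E M v"
proof -
  let ?vec = "\<lambda>e m. \<guillemotleft>v e m\<guillemotright>"
  let ?S = "?vec ` E"
  have upper: "card T \<le> rank_mod p E M v" if T: "T \<subseteq> ?S" "finite T" "lin_indep K M T" for T
  proof -
    obtain E' where E': "E' \<subseteq> E" "inj_on ?vec E'" "T = ?vec ` E'"
      using T(1) by (auto simp: subset_image_inj)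
    have fE': "finite E'" using E' E finite_subset by blast
    let ?F = "\<lambda>c. \<lambda>m\<in>M. (\<Sum>e\<in>E'. c e * v e m) mod int p"
    have "inj_on ?F (E' \<rightarrow>\<^sub>E {0..<int p})"
    proof (rule inj_onI)
      fix c c' assume c: "c \<in> E' \<rightarrow>\<^sub>E {0..<int p}" "c' \<in> E' \<rightarrow>\<^sub>E {0..<int p}" and eq: "?F c = ?F c'"
      define d where "d t = \<guillemotleft>c (inv_into E' ?vec t) - c' (inv_into E' ?vec t)\<guillemotright>" for t
      have dv: "d (?vec e) = \<guillemotleft>c e - c' e\<guillemotright>" if "e \<in> E'" for e
        using inv_into_f_f[OF E'(2) that] by (simp add: d_def)
      have "(\<Oplus>t\<in>T. d t \<otimes> t m) = \<zero>" if m: "m \<in> M" for m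
      proof -
        have "(\<Oplus>t\<in>T. d t \<otimes> t m) = (\<Oplus>e\<in>E'. d (?vec e) \<otimes> ?vec e m)"
          unfolding E'(3) by (rule finsum_reindex) (use E'(2) in \<open>auto simp: d_def\<close>)
        also have "\<dots> = (\<Oplus>e\<in>E'. \<guillemotleft>(c e - c' e) * v e m\<guillemotright>)"
          by (intro add.finprod_cong') (auto simp: dv simp del: of_int_diff)
        also have "\<dots> = \<guillemotleft>\<Sum>e\<in>E'. (c e - c' e) * v e m\<guillemotright>"
          by (rule of_int_sum[OF fE', symmetric])
        also have "\<dots> = \<zero>"
        proof -
          have "(\<Sum>e\<in>E'. c e * v e m) mod int p = (\<Sum>e\<in>E'. c' e * v e m) mod int p"
            using restrict_eqD[OF eq m] .
          then have "int p dvd (\<Sum>e\<in>E'. (c e - c' e) * v e m)"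
            by (simp add: left_diff_distrib sum_subtractf mod_eq_dvd_iff)
          then show ?thesis unfolding of_int_eq_0_iff .
        qed
        finally show ?thesis .
      qed
      moreover have "d \<in> T \<rightarrow> carrier K" by (simp add: d_def)
      ultimately have "\<forall>t\<in>T. d t = \<zero>" using T(3) unfolding lin_indep_def by blast
      then have "\<guillemotleft>c e - c' e\<guillemotright> = \<zero>" if "e \<in> E'" for e using dv[OF that] that E'(3) by auto
      then have "[c e = c' e] (mod int p)" if "e \<in> E'" for e
        using that unfolding of_int_eq_0_iff cong_iff_dvd_diff by blast
      then show "c = c'" using c by (intro PiE_ext[of c E' _ c']) (auto intro!: mod_range_cong_eq)
    qed
    moreover have "?F ` (E' \<rightarrow>\<^sub>E {0..<int p}) \<subseteq> image_mod p E M v"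
    proof
      fix z assume "z \<in> ?F ` (E' \<rightarrow>\<^sub>E {0..<int p})"
      then obtain c where z: "z = ?F c" by blast
      have "(\<Sum>e\<in>E'. c e * v e m) = (\<Sum>e\<in>E. (if e \<in> E' then c e else 0) * v e m)" for m
        using E'(1) E by (intro sum.mono_neutral_cong_left) auto
      then show "z \<in> image_mod p E M v" unfolding image_mod_def z by auto
    qed
    moreover have "finite (image_mod p E M v)"
      using card_image_mod[OF p M E, of v] prime_gt_0_nat[OF p] by (intro card_ge_0_finite) simp
    ultimately have "card (E' \<rightarrow>\<^sub>E {0..<int p}) \<le> card (image_mod p E M v)" by (rule card_inj_on_le)
    then have "p ^ card E' \<le> p ^ rank_mod p E M v" by (simp add: card_image_mod[OF p M E] card_PiE_mod[OF fE'])
    then have "card E' \<le> rank_mod p E M v" by (rule power_prime_le[OF p])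
    then show ?thesis using E' card_image by fastforce
  qed
  obtain B w where B: "B \<subseteq> E" "card B = rank_mod p E M v"
    "\<And>b c. b \<in> B \<Longrightarrow> c \<in> B \<Longrightarrow> [dot_on M (w b) (v c) = (if b = c then 1 else 0)] (mod int p)"
    by (rule rank_mod_basis[OF p M E, of v]) blast
  have fB: "finite B" using B(1) E finite_subset by blast
  have inj: "inj_on ?vec B"
  proof (rule inj_onI)
    fix b c assume b: "b \<in> B" and c: "c \<in> B" and eq: "?vec b = ?vec c"
    have "[v b m = v c m] (mod int p)" for m using fun_cong[OF eq, of m] by (simp only: of_int_eq_iff)
    then have 1: "[dot_on M (w b) (v b) = dot_on M (w b) (v c)] (mod int p)" by (rule dot_on_cong)
    show "b = c"
    proof (rule ccontr)
      assume "b \<noteq> c"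
      then have "[dot_on M (w b) (v c) = 0] (mod int p)" using B(3)[OF b c] by simp
      moreover have "[dot_on M (w b) (v b) = 1] (mod int p)" using B(3)[OF b b] by simp
      ultimately have "[1 = 0] (mod int p)" using 1 by (meson cong_sym cong_trans)
      then show False using prime_gt_1_nat[OF p] by (simp add: cong_0_iff)
    qed
  qed
  have indep: "lin_indep K M (?vec ` B)"
    unfolding lin_indep_def
  proof (intro ballI impI)
    fix c t assume c: "c \<in> ?vec ` B \<rightarrow> carrier K" and z: "\<forall>m\<in>M. (\<Oplus>v\<in>?vec ` B. c v \<otimes> v m) = \<zero>"
      and t: "t \<in> ?vec ` B"
    then obtain b where b: "b \<in> B" "t = ?vec b" by blast
    define d where "d e = c (?vec e)" for e
    have dc: "d e \<in> carrier K" if "e \<in> B" for e using c that by (auto simp: d_def)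
    have z': "(\<Oplus>e\<in>B. d e \<otimes> \<guillemotleft>v e m\<guillemotright>) = \<zero>" if m: "m \<in> M" for m
    proof -
      have "(\<Oplus>v\<in>?vec ` B. c v \<otimes> v m) = (\<Oplus>e\<in>B. d e \<otimes> \<guillemotleft>v e m\<guillemotright>)"
        unfolding d_def by (rule finsum_reindex) (use inj dc[unfolded d_def] in auto)
      then show ?thesis using z m by simp
    qed
    have "(\<Oplus>m\<in>M. \<guillemotleft>w b m\<guillemotright> \<otimes> (\<Oplus>e\<in>B. d e \<otimes> \<guillemotleft>v e m\<guillemotright>)) = (\<Oplus>m\<in>M. \<zero>)"
      by (intro add.finprod_cong') (auto simp: z')
    then have "\<zero> = (\<Oplus>m\<in>M. \<guillemotleft>w b m\<guillemotright> \<otimes> (\<Oplus>e\<in>B. d e \<otimes> \<guillemotleft>v e m\<guillemotright>))" by simp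
    also have "\<dots> = (\<Oplus>e\<in>B. d e \<otimes> (\<Oplus>m\<in>M. \<guillemotleft>w b m\<guillemotright> \<otimes> \<guillemotleft>v e m\<guillemotright>))"
      by (rule finsum_swap_mult[OF fB M]) (auto simp: dc)
    also have "\<dots> = (\<Oplus>e\<in>B. if b = e then d e else \<zero>)"
    proof (intro add.finprod_cong')
      fix e assume e: "e \<in> B"
      have "(\<Oplus>m\<in>M. \<guillemotleft>w b m\<guillemotright> \<otimes> \<guillemotleft>v e m\<guillemotright>) = \<guillemotleft>dot_on M (w b) (v e)\<guillemotright>"
        unfolding dot_on_def of_int_sum[OF M] by simp
      also have "\<dots> = \<guillemotleft>if b = e then 1 else 0\<guillemotright>"
        unfolding of_int_eq_iff by (rule B(3)[OF b(1) e])
      finally show "d e \<otimes> (\<Oplus>m\<in>M. \<guillemotleft>w b m\<guillemotright> \<otimes> \<guillemotleft>v e m\<guillemotright>) = (if b = e then d e else \<zero>)"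
        using dc[OF e] by simp
    qed (auto simp: dc)
    also have "\<dots> = d b"
      by (rule add.finprod_singleton[OF b(1) fB]) (auto simp: dc)
    finally show "c t = \<zero>" by (simp add: d_def b(2))
  qed
  show ?thesis
    unfolding span_dim_def
  proof (rule Max_eqI)
    show "finite {card T |T. T \<subseteq> ?S \<and> finite T \<and> lin_indep K M T}"
      by (rule finite_subset[of _ "{..rank_mod p E M v}"]) (use upper in auto)
    show "y \<le> rank_mod p E M v" if "y \<in> {card T |T. T \<subseteq> ?S \<and> finite T \<and> lin_indep K M T}" for y
      using that upper by auto
    have "card (?vec ` B) = rank_mod p E M v" using card_image[OF inj] B(2) by simp
    then show "rank_mod p E M v \<in> {card T |T. T \<subseteq> ?S \<and> finite T \<and> lin_indep K M T}"
      using indep fB B(1) by (intro CollectI exI[of _ "?vec ` B"]) auto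
  qed
qed

end

section \<open>The generators of the ideal as integer vectors\<close>

lemma finite_mons: "finite (mons N d)"
proof (rule finite_subset[OF _ finite_cube[of N "Suc d"]])
  show "mons N d \<subseteq> cube N (Suc d)"
  proof
    fix e assume e: "e \<in> mons N d"
    have "e i \<le> d" if "i < N" for i
    proof -
      have "e i \<le> (\<Sum>i<N. e i)" by (rule member_le_sum) (use that in auto)
      then show ?thesis using e by (simp add: mons_def)
    qed
    then show "e \<in> cube N (Suc d)" using e by (auto simp: xbox_def mons_def less_Suc_eq_le)
  qed
qed

lemma box_mons_mons: "box_mons N q d = {m \<in> mons N d. \<forall>i<N. m i < q}"
  by (auto simp: box_mons_def xbox_def mons_def xdeg_def)

lemma add_unitv_eq: "m = (\<lambda>j. e j + k * unitv i j) \<longleftrightarrow> (\<not> m i < k \<and> e = m(i := m i - k))"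
proof
  assume m: "m = (\<lambda>j. e j + k * unitv i j)"
  show "\<not> m i < k \<and> e = m(i := m i - k)" unfolding m by (auto simp: unitv_def fun_eq_iff)
next
  assume "\<not> m i < k \<and> e = m(i := m i - k)"
  then show "m = (\<lambda>j. e j + k * unitv i j)" by (auto simp: unitv_def fun_eq_iff)
qed

lemma mons_upd_diff: "m \<in> mons N d \<Longrightarrow> i < N \<Longrightarrow> \<not> m i < k \<Longrightarrow> m(i := m i - k) \<in> mons N (d - k) \<and> k \<le> d"
  using xdeg_upd_diff[of i N k m] by (auto simp: mons_def xdeg_def)

lemma mons_add: "e \<in> mons N d \<Longrightarrow> i < N \<Longrightarrow> (\<lambda>j. e j + k * unitv i j) \<in> mons N (d + k)"
proof -
  assume e: "e \<in> mons N d" and i: "i < N"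
  have "(\<lambda>j. e j + k * unitv i j) = e(i := e i + k)" by (auto simp: unitv_def)
  then show ?thesis using e i xdeg_upd_add[OF i, of e k] by (auto simp: mons_def xdeg_def)
qed

definition quad_exps :: "nat \<Rightarrow> nat \<Rightarrow> (nat \<Rightarrow> nat) set" where
  "quad_exps N d = (if 2 \<le> d then mons N (d - 2) else {})"

lemma finite_quad_exps: "finite (quad_exps N d)"
  by (simp add: quad_exps_def finite_mons)

text \<open>For given m and e at most one index i satisfies the condition, so the indicator of the
  existential statement is a sum of indicators.\<close>

lemma quad_sum:
  assumes m: "m \<in> mons N d"
  shows "(\<Sum>e\<in>quad_exps N d. F e * (if \<exists>i<N. m = (\<lambda>j. e j + 2 * unitv i j) then 1 else 0)) = psum 2 N F m"
proof -
  have ind: "(if \<exists>i<N. m = (\<lambda>j. e j + 2 * unitv i j) then 1 else 0 :: int)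
     = (\<Sum>i<N. if \<not> m i < 2 \<and> e = m(i := m i - 2) then 1 else 0)" for e
  proof (cases "\<exists>i<N. \<not> m i < 2 \<and> e = m(i := m i - 2)")
    case True
    then obtain i where i: "i < N" "\<not> m i < 2" "e = m(i := m i - 2)" by blast
    have "(\<not> m j < 2 \<and> e = m(j := m j - 2)) \<longleftrightarrow> j = i" for j
    proof
      assume j: "\<not> m j < 2 \<and> e = m(j := m j - 2)"
      show "j = i"
      proof (rule ccontr)
        assume "j \<noteq> i"
        then have "(m(j := m j - 2)) i = m i" "(m(i := m i - 2)) i = m i - 2" by simp_all
        then show False using i j by (metis diff_less zero_less_numeral less_le_trans not_less nat_less_le le_eq_less_or_eq)
      qed
    qed (use i in simp)
    then have "(\<Sum>j<N. if \<not> m j < 2 \<and> e = m(j := m j - 2) then 1 else 0 :: int) = (\<Sum>j<N. if j = i then 1 else 0)"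
      by (intro sum.cong refl) presburger
    then show ?thesis using True i(1) by (simp add: add_unitv_eq)
  next
    case False
    then have "(\<Sum>i<N. if \<not> m i < 2 \<and> e = m(i := m i - 2) then 1 else 0 :: int) = 0"
      by (intro sum.neutral) auto
    then show ?thesis using False by (simp add: add_unitv_eq)
  qed
  have "(\<Sum>e\<in>quad_exps N d. F e * (if \<exists>i<N. m = (\<lambda>j. e j + 2 * unitv i j) then 1 else 0))
      = (\<Sum>i<N. \<Sum>e\<in>quad_exps N d. F e * (if \<not> m i < 2 \<and> e = m(i := m i - 2) then 1 else 0))"
    unfolding ind sum_distrib_left by (rule sum.swap)
  also have "\<dots> = psum 2 N F m"
    unfolding psum_expand
  proof (rule sum.cong[OF refl])
    fix i assume "i \<in> {..<N}"
    then have i: "i < N" by simp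
    show "(\<Sum>e\<in>quad_exps N d. F e * (if \<not> m i < 2 \<and> e = m(i := m i - 2) then 1 else 0)) = (if m i < 2 then 0 else F (m(i := m i - 2)))"
    proof (cases "m i < 2")
      case False
      have "m(i := m i - 2) \<in> quad_exps N d" using mons_upd_diff[OF m i False] by (simp add: quad_exps_def)
      moreover have "(\<Sum>e\<in>quad_exps N d. F e * (if \<not> m i < 2 \<and> e = m(i := m i - 2) then 1 else 0))
         = (\<Sum>e\<in>quad_exps N d. if e = m(i := m i - 2) then F e else 0)"
        using False by (intro sum.cong) auto
      ultimately show ?thesis using False finite_quad_exps by simp
    qed simp
  qed
  finally show ?thesis .
qed

text \<open>\<open>Inl x\<close> stands for the monomial x itself, used for x outside the box; this
  merges the several presentations of x as a multiple of some x_i^q. \<open>Inr e\<close> stands for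
  x^e Q.\<close>

definition gen_vec :: "nat \<Rightarrow> (nat \<Rightarrow> nat) + (nat \<Rightarrow> nat) \<Rightarrow> (nat \<Rightarrow> nat) \<Rightarrow> int" where
  "gen_vec N g m = (case g of Inl x \<Rightarrow> if m = x then 1 else 0
     | Inr e \<Rightarrow> if \<exists>i<N. m = (\<lambda>j. e j + 2 * unitv i j) then 1 else 0)"

definition gen_idx :: "nat \<Rightarrow> nat \<Rightarrow> nat \<Rightarrow> ((nat \<Rightarrow> nat) + (nat \<Rightarrow> nat)) set" where
  "gen_idx N q d = Inl ` (mons N d - box_mons N q d) \<union> Inr ` quad_exps N d"

lemma finite_gen_idx: "finite (gen_idx N q d)"
  by (simp add: gen_idx_def finite_mons finite_quad_exps)

lemma gens_eq:
  assumes "ring K"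
  shows "frob_gens K N q d \<union> quad_gens K N d = (\<lambda>g m. \<guillemotleft>gen_vec N g m\<guillemotright>\<^bsub>K\<^esub>) ` gen_idx N q d"
proof -
  interpret ring K by fact
  have 1: "frob_gens K N q d = (\<lambda>x m. if m = x then \<one>\<^bsub>K\<^esub> else \<zero>\<^bsub>K\<^esub>) ` (mons N d - box_mons N q d)"
  proof (intro equalityI subsetI)
    fix z assume "z \<in> frob_gens K N q d"
    then obtain e i where z: "z = (\<lambda>m. if m = (\<lambda>j. e j + q * unitv i j) then \<one>\<^bsub>K\<^esub> else \<zero>\<^bsub>K\<^esub>)"
      and e: "q \<le> d" "e \<in> mons N (d - q)" "i < N" unfolding frob_gens_def by blast
    have "(\<lambda>j. e j + q * unitv i j) \<in> mons N d" using mons_add[OF e(2,3), of q] e(1) by simp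
    moreover have "(\<lambda>j. e j + q * unitv i j) \<notin> box_mons N q d"
      using e(3) by (auto simp: box_mons_mons unitv_def intro!: exI[of _ i])
    ultimately show "z \<in> (\<lambda>x m. if m = x then \<one>\<^bsub>K\<^esub> else \<zero>\<^bsub>K\<^esub>) ` (mons N d - box_mons N q d)" unfolding z by blast
  next
    fix z assume "z \<in> (\<lambda>x m. if m = x then \<one>\<^bsub>K\<^esub> else \<zero>\<^bsub>K\<^esub>) ` (mons N d - box_mons N q d)"
    then obtain x where x: "x \<in> mons N d" "x \<notin> box_mons N q d" "z = (\<lambda>m. if m = x then \<one>\<^bsub>K\<^esub> else \<zero>\<^bsub>K\<^esub>)" by blast
    then obtain i where i: "i < N" "\<not> x i < q" by (auto simp: box_mons_mons)
    let ?e = "x(i := x i - q)"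
    have e: "?e \<in> mons N (d - q)" "q \<le> d" using mons_upd_diff[OF x(1) i] by auto
    have "x = (\<lambda>j. ?e j + q * unitv i j)" using i(2) by (subst add_unitv_eq) simp
    then have "z = (\<lambda>m. if m = (\<lambda>j. ?e j + q * unitv i j) then \<one>\<^bsub>K\<^esub> else \<zero>\<^bsub>K\<^esub>)" using x(3) by simp
    then show "z \<in> frob_gens K N q d" unfolding frob_gens_def using e i(1) by blast
  qed
  have 2: "quad_gens K N d = (\<lambda>e m. if (\<exists>i<N. m = (\<lambda>j. e j + 2 * unitv i j)) then \<one>\<^bsub>K\<^esub> else \<zero>\<^bsub>K\<^esub>) ` quad_exps N d"
    unfolding quad_gens_def quad_exps_def by auto
  show ?thesis
    unfolding 1 2 gen_idx_def image_Un image_image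
    by (intro arg_cong2[of _ _ _ _ "(\<union>)"] image_cong refl ext) (auto simp: gen_vec_def)
qed

text \<open>The monomial generators make the coordinates outside the box arbitrary. Modulo them only
  the action of Q inside the box is left.\<close>

lemma rank_mod_gens:
  assumes p: "prime p"
  shows "rank_mod p (gen_idx N q d) (mons N d) (gen_vec N) =
    card (mons N d - box_mons N q d) + (if d < 2 then 0 else quad_rank p N q 1 (d - 2))"
proof -
  let ?M = "mons N d" and ?C = "mons N d - box_mons N q d"
  have p0: "int p > 0" using prime_gt_0_nat[OF p] by simp
  have bM: "box_mons N q d \<subseteq> ?M" by (auto simp: box_mons_mons)
  define R where "R = (\<lambda>F. \<lambda>y\<in>box_mons N q d. psum 2 N F y mod int p) ` UNIV"
  have comb: "(\<Sum>g\<in>gen_idx N q d. c g * gen_vec N g m) = (if m \<in> ?C then c (Inl m) else 0) + psum 2 N (\<lambda>e. c (Inr e)) m"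
    if m: "m \<in> ?M" for c m
  proof -
    have "(\<Sum>g\<in>gen_idx N q d. c g * gen_vec N g m) = (\<Sum>x\<in>?C. c (Inl x) * gen_vec N (Inl x) m) + (\<Sum>e\<in>quad_exps N d. c (Inr e) * gen_vec N (Inr e) m)"
      unfolding gen_idx_def
      by (subst sum.union_disjoint) (auto simp: finite_mons finite_quad_exps sum.reindex)
    also have "(\<Sum>x\<in>?C. c (Inl x) * gen_vec N (Inl x) m) = (\<Sum>x\<in>?C. if x = m then c (Inl x) else 0)"
      by (intro sum.cong) (auto simp: gen_vec_def)
    also have "\<dots> = (if m \<in> ?C then c (Inl m) else 0)" by (simp add: finite_mons)
    also have "(\<Sum>e\<in>quad_exps N d. c (Inr e) * gen_vec N (Inr e) m) = psum 2 N (\<lambda>e. c (Inr e)) m"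
      using quad_sum[OF m, of "\<lambda>e. c (Inr e)"] by (simp add: gen_vec_def)
    finally show ?thesis .
  qed
  let ?G = "\<lambda>z. (restrict z ?C, restrict z (box_mons N q d))"
  have "bij_betw ?G (image_mod p (gen_idx N q d) ?M (gen_vec N)) ((?C \<rightarrow>\<^sub>E {0..<int p}) \<times> R)"
    unfolding bij_betw_def
  proof
    show "inj_on ?G (image_mod p (gen_idx N q d) ?M (gen_vec N))"
    proof (rule inj_onI)
      fix z z' assume z: "z \<in> image_mod p (gen_idx N q d) ?M (gen_vec N)" "z' \<in> image_mod p (gen_idx N q d) ?M (gen_vec N)"
        and eq: "?G z = ?G z'"
      have eq1: "restrict z ?C = restrict z' ?C" and eq2: "restrict z (box_mons N q d) = restrict z' (box_mons N q d)"
        using arg_cong[OF eq, of fst] arg_cong[OF eq, of snd] by (simp_all only: fst_conv snd_conv)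
      have "z m = z' m" if "m \<in> ?M" for m
      proof (cases "m \<in> box_mons N q d")
        case True
        show ?thesis by (rule restrict_eqD[OF eq2 True])
      next
        case False
        then have "m \<in> ?C" using that by simp
        then show ?thesis by (rule restrict_eqD[OF eq1])
      qed
      moreover have "z \<in> extensional ?M" "z' \<in> extensional ?M" using z by (auto simp: image_mod_def)
      ultimately show "z = z'" by (auto intro: extensionalityI)
    qed
  next
    show "?G ` image_mod p (gen_idx N q d) ?M (gen_vec N) = (?C \<rightarrow>\<^sub>E {0..<int p}) \<times> R"
    proof (intro equalityI subsetI)
      fix u assume "u \<in> ?G ` image_mod p (gen_idx N q d) ?M (gen_vec N)"
      then obtain c where u: "u = ?G (\<lambda>m\<in>?M. (\<Sum>g\<in>gen_idx N q d. c g * gen_vec N g m) mod int p)"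
        unfolding image_mod_def by blast
      have "restrict (\<lambda>m\<in>?M. (\<Sum>g\<in>gen_idx N q d. c g * gen_vec N g m) mod int p) (box_mons N q d)
         = (\<lambda>y\<in>box_mons N q d. psum 2 N (\<lambda>e. c (Inr e)) y mod int p)"
        using bM by (intro restrict_ext) (auto simp: comb)
      then have 2: "restrict (\<lambda>m\<in>?M. (\<Sum>g\<in>gen_idx N q d. c g * gen_vec N g m) mod int p) (box_mons N q d) \<in> R"
        unfolding R_def by (intro image_eqI[where x="\<lambda>e. c (Inr e)"] UNIV_I)
      have 1: "restrict (\<lambda>m\<in>?M. (\<Sum>g\<in>gen_idx N q d. c g * gen_vec N g m) mod int p) ?C \<in> ?C \<rightarrow>\<^sub>E {0..<int p}"
        unfolding restrict_PiE_iff using p0 by simp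
      show "u \<in> (?C \<rightarrow>\<^sub>E {0..<int p}) \<times> R" unfolding u using 1 2 by (rule SigmaI)
    next
      fix u assume "u \<in> (?C \<rightarrow>\<^sub>E {0..<int p}) \<times> R"
      then obtain h F where h: "h \<in> ?C \<rightarrow>\<^sub>E {0..<int p}" and u: "u = (h, \<lambda>y\<in>box_mons N q d. psum 2 N F y mod int p)"
        unfolding R_def by blast
      \<comment> \<open>The monomial coefficients cancel the part of Q F outside the box and put the
        prescribed values h in its place.\<close>
      define c where "c g = (case g of Inl x \<Rightarrow> h x - psum 2 N F x | Inr e \<Rightarrow> F e)" for g
      define z where "z = (\<lambda>m\<in>?M. (\<Sum>g\<in>gen_idx N q d. c g * gen_vec N g m) mod int p)"
      have "restrict z ?C = h"
      proof
        fix m show "restrict z ?C m = h m"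
        proof (cases "m \<in> ?C")
          case True
          then have "h m \<in> {0..<int p}" using h by (auto simp: PiE_iff)
          then show ?thesis using True by (simp add: z_def comb c_def)
        next
          case False
          then show ?thesis using PiE_arb[OF h False] by (auto simp: restrict_def)
        qed
      qed
      moreover have "restrict z (box_mons N q d) = (\<lambda>y\<in>box_mons N q d. psum 2 N F y mod int p)"
        using bM by (intro restrict_ext) (auto simp: z_def comb c_def)
      ultimately have "u = ?G z" using u by simp
      moreover have "z \<in> image_mod p (gen_idx N q d) ?M (gen_vec N)" by (auto simp: image_mod_def z_def)
      ultimately show "u \<in> ?G ` image_mod p (gen_idx N q d) ?M (gen_vec N)" by blast
    qed
  qed
  from bij_betw_same_card[OF this]
  have 1: "p ^ rank_mod p (gen_idx N q d) ?M (gen_vec N) = p ^ card ?C * card R"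
    by (simp add: card_image_mod[OF p finite_mons finite_gen_idx] card_cartesian_product card_PiE_mod finite_mons)
  have 2: "card R = p ^ (if d < 2 then 0 else quad_rank p N q 1 (d - 2))"
  proof (cases "d < 2")
    case True
    have "psum 2 N F y = 0" if "y \<in> box_mons N q d" for F y
      using psum_pow_low[of N y 2 1 F] that True by (simp add: box_mons_def)
    then have "R = {\<lambda>y\<in>box_mons N q d. 0}" unfolding R_def by (auto intro!: restrict_ext image_eqI)
    then show ?thesis using True by simp
  next
    case False
    then have dd: "d - 2 + 2 * 1 = d" by simp
    have "R = quad_image p N q 1 (d - 2)" unfolding R_def quad_image_def dd by simp
    then show ?thesis using False card_quad_image[OF p, of N q 1 "d - 2"] by simp
  qed
  show ?thesis using 1 unfolding 2 power_add[symmetric] by (rule power_prime_inj[OF p])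
qed

lemma hilb_frob_eq_hilb_box:
  assumes K: "perfect_field_char K p" and p: "prime p"
  shows "hilb_frob K N q d = hilb_box p N q d"
proof -
  have f: "field K" and c: "[p] \<cdot>\<^bsub>K\<^esub> \<one>\<^bsub>K\<^esub> = \<zero>\<^bsub>K\<^esub>" using K by (auto simp: perfect_field_char_def)
  interpret field K by (rule f)
  interpret char_field K p by unfold_locales (use p c in auto)
  have "span_dim K (mons N d) (frob_gens K N q d \<union> quad_gens K N d) = rank_mod p (gen_idx N q d) (mons N d) (gen_vec N)"
    unfolding gens_eq[OF ring_axioms] by (rule span_dim_of_int[OF finite_mons finite_gen_idx])
  moreover have "card (mons N d - box_mons N q d) = card (mons N d) - card (box_mons N q d)"
    by (rule card_Diff_subset[OF finite_box_mons]) (auto simp: box_mons_mons)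
  moreover have "card (box_mons N q d) \<le> card (mons N d)"
    by (rule card_mono[OF finite_mons]) (auto simp: box_mons_mons)
  ultimately show ?thesis unfolding hilb_frob_def hilb_box_def rank_mod_gens[OF p] by simp
qed

section \<open>Counting monomials in a box\<close>

lemma one_minus_square: "1 - x ^ 2 = (1 - x) * (1 + x :: 'a :: comm_ring_1)"
  by (simp add: power2_eq_square algebra_simps)

lemma expand_square: "(1 + x) * (1 - y) ^ 2 * h
    = h - (y * h + y * h) + y * y * h + x * h - (y * x * h + y * x * h) + y * y * x * (h :: 'a :: comm_ring_1)"
  by (simp add: power2_eq_square algebra_simps)

lemma card_box_mons_Suc: "card (box_mons (Suc N) q d) = (\<Sum>j\<le>d. if j < q then card (box_mons N q (d - j)) else 0)"
proof -
  let ?A = "\<lambda>j. {m \<in> box_mons (Suc N) q d. m N = j}"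
  have "box_mons (Suc N) q d = (\<Union>j\<in>{..d}. ?A j)"
    by (auto simp: box_mons_def xdeg_Suc)
  from arg_cong[OF this, of card] have "card (box_mons (Suc N) q d) = card (\<Union>j\<in>{..d}. ?A j)" .
  also have "\<dots> = (\<Sum>j\<le>d. card (?A j))"
    by (rule card_UN_disjoint) (auto simp: finite_box_mons)
  also have "\<dots> = (\<Sum>j\<le>d. if j < q then card (box_mons N q (d - j)) else 0)"
  proof (rule sum.cong[OF refl])
    fix j assume j: "j \<in> {..d}"
    show "card (?A j) = (if j < q then card (box_mons N q (d - j)) else 0)"
    proof (cases "j < q")
      case True
      have "bij_betw (\<lambda>m. m(N := j)) (box_mons N q (d - j)) (?A j)"
      proof (rule bij_betw_byWitness[where f'="\<lambda>m. m(N := 0)"])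
        have deq: "xdeg N (m(N := c)) = xdeg N m" for m c by (simp add: xdeg_def)
        show "\<forall>a\<in>box_mons N q (d - j). a(N := j, N := 0) = a" by (auto simp: box_mons_def xbox_def fun_eq_iff)
        show "\<forall>a'\<in>?A j. a'(N := 0, N := j) = a'" by (auto simp: fun_eq_iff)
        show "(\<lambda>m. m(N := j)) ` box_mons N q (d - j) \<subseteq> ?A j"
          using j True by (auto simp: box_mons_def xbox_def xdeg_Suc deq less_Suc_eq)
        show "(\<lambda>m. m(N := 0)) ` ?A j \<subseteq> box_mons N q (d - j)"
          by (auto simp: box_mons_def xbox_def xdeg_Suc deq le_less_Suc_eq)
      qed
      then show ?thesis using True bij_betw_same_card by fastforce
    next
      case False
      then have "?A j = {}" by (auto simp: box_mons_def xbox_def)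
      from arg_cong[OF this, of card] show ?thesis using False by simp
    qed
  qed
  finally show ?thesis .
qed

definition cnt_fps :: "nat \<Rightarrow> nat \<Rightarrow> real fps" where
  "cnt_fps N q = Abs_fps (\<lambda>d. real (card (box_mons N q d)))"

definition geo_fps :: "real fps" where "geo_fps = Abs_fps (\<lambda>_. 1)"

lemma geo_fps_inverse: "(1 - fps_X) * geo_fps = 1"
  by (rule fps_ext) (simp add: geo_fps_def left_diff_distrib)

lemma geo_fps_power_nth: "fps_nth (geo_fps ^ Suc m) d = real ((d + m) choose m)"
proof (induction m arbitrary: d)
  case 0
  then show ?case by (simp add: geo_fps_def)
next
  case (Suc m)
  have "fps_nth (geo_fps ^ Suc (Suc m)) d = (\<Sum>i=0..d. fps_nth (geo_fps ^ Suc m) (d - i))"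
    by (subst power_Suc) (simp add: fps_mult_nth geo_fps_def)
  also have "\<dots> = (\<Sum>i\<le>d. fps_nth (geo_fps ^ Suc m) i)"
    by (rule sum.reindex_bij_witness[of _ "\<lambda>i. d - i" "\<lambda>i. d - i"]) auto
  also have "\<dots> = real (\<Sum>i\<le>d. (m + i) choose i)"
    unfolding Suc.IH of_nat_sum by (intro sum.cong) (auto simp: binomial_symmetric[of m "_ + m"] add.commute)
  also have "\<dots> = real ((d + Suc m) choose Suc m)"
    unfolding sum_choose_lower using binomial_symmetric[of d "Suc (m + d)"] by (simp add: add.commute)
  finally show ?case .
qed

lemma cnt_fps_eq: "cnt_fps N q = ((1 - fps_X ^ q) * geo_fps) ^ N"
proof (induction N)
  case 0
  have "box_mons 0 q d = (if d = 0 then {\<lambda>_. 0} else {})" for d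
    by (auto simp: box_mons_def xbox_def xdeg_def)
  then show ?case by (intro fps_ext) (simp add: cnt_fps_def)
next
  case (Suc N)
  define G where "G = (1 - fps_X ^ q) * geo_fps"
  have geo: "fps_nth G j = (if j < q then 1 else 0)" for j
    by (simp add: G_def left_diff_distrib fps_X_power_mult_nth geo_fps_def)
  have "cnt_fps (Suc N) q = G * cnt_fps N q"
    by (rule fps_ext) (simp add: fps_mult_nth geo cnt_fps_def card_box_mons_Suc atLeast0AtMost if_distrib[of real] if_distrib[of "\<lambda>c. c * _"] cong: if_cong)
  then show ?case using Suc by (simp add: G_def)
qed

lemma card_box_mons_le: "card (box_mons (Suc N) q d) \<le> q ^ N"
proof -
  have "inj_on (\<lambda>m. restrict m {..<N}) (box_mons (Suc N) q d)"
  proof (rule inj_onI)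
    fix m m' assume m: "m \<in> box_mons (Suc N) q d" "m' \<in> box_mons (Suc N) q d" and eq: "restrict m {..<N} = restrict m' {..<N}"
    have lt: "m i = m' i" if "i < N" for i using restrict_eqD[OF eq, of i] that by simp
    then have "xdeg N m = xdeg N m'" unfolding xdeg_def by (intro sum.cong) auto
    then have "m N = m' N" using m by (auto simp: box_mons_def xdeg_Suc)
    moreover have "m i = m' i" if "i > N" for i using m that by (auto simp: box_mons_def xbox_def)
    ultimately show "m = m'" using lt by (metis ext linorder_neqE_nat)
  qed
  moreover have "(\<lambda>m. restrict m {..<N}) ` box_mons (Suc N) q d \<subseteq> {..<N} \<rightarrow>\<^sub>E {..<q}"
    unfolding image_subset_iff restrict_PiE_iff by (auto simp: box_mons_def xbox_def)
  ultimately have "card (box_mons (Suc N) q d) \<le> card ({..<N} \<rightarrow>\<^sub>E {..<q})"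
    by (intro card_inj_on_le) (auto simp: finite_PiE)
  then show ?thesis by (simp add: card_PiE)
qed

definition card_diff :: "nat \<Rightarrow> nat \<Rightarrow> nat \<Rightarrow> real" where
  "card_diff N q d = real (card (box_mons N q d)) - (if d < 2 then 0 else real (card (box_mons N q (d - 2))))"

lemma card_diff_fps: "card_diff N q d = fps_nth ((1 - fps_X ^ 2) * cnt_fps N q) d"
  by (simp add: card_diff_def left_diff_distrib fps_X_power_mult_nth cnt_fps_def)

text \<open>The product (1-X)(1-X^2) cancels two geometric series and leaves (1+X)(1-X^q)^2 times
  the generating function for N-2 variables, whose coefficients are at most q^(N-3). The constant 8
  is the sum of the absolute values of the coefficients of (1+X)(1-X^q)^2.\<close>

lemma card_diff_step:
  assumes N: "3 \<le> N"
  shows "\<bar>card_diff N q (d + 1) - card_diff N q d\<bar> \<le> 8 * real q ^ (N - 3)"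
proof -
  define M where "M = N - 3"
  have M: "N = Suc (Suc (Suc M))" using N by (simp add: M_def)
  define h where "h = cnt_fps (Suc M) q"
  have b: "\<bar>if P then 0 else fps_nth h i\<bar> \<le> real q ^ M" for i P
    using card_box_mons_le[of M q i] by (simp add: h_def cnt_fps_def flip: of_nat_power)
  have e: "(1 - fps_X) * ((1 - fps_X ^ 2) * cnt_fps N q)
     = h - (fps_X ^ q * h + fps_X ^ q * h) + fps_X ^ (q + q) * h + fps_X ^ 1 * h - (fps_X ^ (q + 1) * h + fps_X ^ (q + 1) * h) + fps_X ^ (q + q + 1) * h"
  proof -
    have c: "cnt_fps N q = ((1 - fps_X ^ q) * geo_fps) ^ 2 * h"
      unfolding cnt_fps_eq h_def M power2_eq_square by (simp only: power_Suc mult.assoc)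
    have x2: "1 - fps_X ^ 2 = (1 - fps_X) * (1 + fps_X :: real fps)"
      by (rule one_minus_square)
    have "(1 - fps_X) * ((1 - fps_X ^ 2) * cnt_fps N q)
       = (1 + fps_X) * (1 - fps_X ^ q) ^ 2 * ((1 - fps_X) * geo_fps) ^ 2 * h"
      unfolding c x2 by (simp only: power2_eq_square mult_ac)
    also have "\<dots> = (1 + fps_X) * (1 - fps_X ^ q) ^ 2 * h" by (simp add: geo_fps_inverse)
    finally show ?thesis unfolding expand_square power_add power_one_right by simp
  qed
  have "card_diff N q (d + 1) - card_diff N q d = fps_nth ((1 - fps_X) * ((1 - fps_X ^ 2) * cnt_fps N q)) (d + 1)"
  proof -
    have "fps_nth ((1 - fps_X) * g) (d + 1) = fps_nth g (d + 1) - fps_nth g d" for g :: "real fps"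
      by (simp add: left_diff_distrib)
    then show ?thesis unfolding card_diff_fps by (rule sym)
  qed
  also have "\<dots> = fps_nth h (d + 1) - 2 * (if d + 1 < q then 0 else fps_nth h (d + 1 - q))
      + (if d + 1 < q + q then 0 else fps_nth h (d + 1 - (q + q))) + (if d + 1 < 1 then 0 else fps_nth h (d + 1 - 1))
      - 2 * (if d + 1 < q + 1 then 0 else fps_nth h (d + 1 - (q + 1)))
      + (if d + 1 < q + q + 1 then 0 else fps_nth h (d + 1 - (q + q + 1)))"
    unfolding e fps_add_nth fps_sub_nth fps_X_power_mult_nth by (simp only: mult_2)
  finally have eq: "card_diff N q (d + 1) - card_diff N q d = fps_nth h (d + 1) - 2 * (if d + 1 < q then 0 else fps_nth h (d + 1 - q))
      + (if d + 1 < q + q then 0 else fps_nth h (d + 1 - (q + q))) + (if d + 1 < 1 then 0 else fps_nth h (d + 1 - 1))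
      - 2 * (if d + 1 < q + 1 then 0 else fps_nth h (d + 1 - (q + 1)))
      + (if d + 1 < q + q + 1 then 0 else fps_nth h (d + 1 - (q + q + 1)))" .
  have arith: "\<bar>a1 - 2 * a2 + a3 + a4 - 2 * a5 + a6\<bar> \<le> 8 * c"
    if "\<bar>a1\<bar> \<le> c" "\<bar>a2\<bar> \<le> c" "\<bar>a3\<bar> \<le> c" "\<bar>a4\<bar> \<le> c" "\<bar>a5\<bar> \<le> c" "\<bar>a6\<bar> \<le> c" for a1 a2 a3 a4 a5 a6 c :: real
    using that by linarith
  show ?thesis unfolding eq M_def[symmetric]
    by (rule arith) (rule b[of False, simplified if_False] b)+
qed

text \<open>The coefficient of X^d in (1-X^q)^(n+2) / (1-X)^(n+1). The factor 1+X left over from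
  1-X^2 becomes the factor 2 in the limit.\<close>

definition box_count_part :: "nat \<Rightarrow> nat \<Rightarrow> nat \<Rightarrow> real" where
  "box_count_part n q d = (\<Sum>i\<le>n+2. real (n + 2 choose i) * (-1) ^ i * (if d < i * q then 0 else real ((d - i * q + n) choose n)))"

lemma card_diff_box_count_part:
  "card_diff (n + 2) q d = box_count_part n q d + (if d = 0 then 0 else box_count_part n q (d - 1))"
proof -
  have "(1 - fps_X ^ q) ^ (n + 2) * geo_fps ^ Suc n
      = (\<Sum>i\<le>n+2. of_nat (n + 2 choose i) * (- (fps_X ^ q)) ^ i * 1 ^ (n + 2 - i)) * geo_fps ^ Suc n"
    using binomial_ring[of "- (fps_X ^ q)" "1 :: real fps" "n + 2"] by simp
  also have "\<dots> = (\<Sum>i\<le>n+2. fps_const (real (n + 2 choose i) * (-1) ^ i) * (fps_X ^ (i * q) * geo_fps ^ Suc n))"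
    unfolding sum_distrib_right
  proof (rule sum.cong[OF refl])
    fix i assume "i \<in> {..n + 2}"
    have 1: "of_nat (n + 2 choose i) = fps_const (real (n + 2 choose i))" by (rule fps_of_nat[symmetric])
    have 2: "(- (fps_X ^ q)) ^ i = fps_const ((-1) ^ i) * (fps_X ^ (i * q) :: real fps)"
      by (cases "even i") (auto simp: power_mult[symmetric] mult.commute simp flip: fps_const_neg)
    show "of_nat (n + 2 choose i) * (- (fps_X ^ q)) ^ i * 1 ^ (n + 2 - i) * geo_fps ^ Suc n
       = fps_const (real (n + 2 choose i) * (-1) ^ i) * (fps_X ^ (i * q) * geo_fps ^ Suc n)"
      unfolding 1 2 power_one mult_1_right fps_const_mult[symmetric] by (simp only: mult.assoc)
  qed
  finally have t: "fps_nth ((1 - fps_X ^ q) ^ (n + 2) * geo_fps ^ Suc n) d = box_count_part n q d" for d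
    unfolding box_count_part_def
    by (simp only: fps_sum_nth fps_mult_left_const_nth fps_X_power_mult_nth geo_fps_power_nth)
  have "(1 - fps_X ^ 2) * cnt_fps (n + 2) q = (1 + fps_X) * ((1 - fps_X) * geo_fps) * ((1 - fps_X ^ q) ^ (n + 2) * geo_fps ^ Suc n)"
  proof -
    have c: "cnt_fps (n + 2) q = geo_fps * ((1 - fps_X ^ q) ^ (n + 2) * geo_fps ^ Suc n)"
      unfolding cnt_fps_eq power_mult_distrib add_2_eq_Suc' by (simp only: power_Suc mult_ac)
    have x2: "1 - fps_X ^ 2 = (1 - fps_X) * (1 + fps_X :: real fps)"
      by (rule one_minus_square)
    show ?thesis unfolding c x2 by (simp only: mult_ac)
  qed
  also have "\<dots> = (1 - fps_X ^ q) ^ (n + 2) * geo_fps ^ Suc n + fps_X * ((1 - fps_X ^ q) ^ (n + 2) * geo_fps ^ Suc n)"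
    unfolding geo_fps_inverse mult_1_right distrib_right mult_1_left ..
  finally have f: "(1 - fps_X ^ 2) * cnt_fps (n + 2) q
    = (1 - fps_X ^ q) ^ (n + 2) * geo_fps ^ Suc n + fps_X * ((1 - fps_X ^ q) ^ (n + 2) * geo_fps ^ Suc n)" .
  show ?thesis unfolding card_diff_fps f by (simp only: fps_add_nth fps_X_mult_nth t)
qed

definition bspline_deriv :: "nat \<Rightarrow> real \<Rightarrow> real" where
  "bspline_deriv n x = (\<Sum>i\<le>n+2. real (n + 2 choose i) * (-1) ^ i * (max 0 (x - real i) ^ n / fact n))"

lemma binomial_limit:
  assumes q: "filterlim q at_top sequentially" and m: "(\<lambda>s. real (m s) / real (q s)) \<longlonglongrightarrow> y"
  shows "(\<lambda>s. real ((m s + n) choose n) / real (q s) ^ n) \<longlonglongrightarrow> y ^ n / fact n"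
proof (induction n)
  case 0
  show ?case by simp
next
  case (Suc n)
  have r: "filterlim (\<lambda>s. real (q s)) at_top sequentially"
    using q by (rule filterlim_compose[OF filterlim_real_sequentially])
  have "(\<lambda>s. (real n + 1) / real (q s)) \<longlonglongrightarrow> 0"
    by (rule real_tendsto_divide_at_top[OF tendsto_const r])
  then have "(\<lambda>s. real (m s) / real (q s) + (real n + 1) / real (q s)) \<longlonglongrightarrow> y + 0"
    by (rule tendsto_add[OF m])
  then have "(\<lambda>s. (real ((m s + n) choose n) / real (q s) ^ n) * (real (m s) / real (q s) + (real n + 1) / real (q s)) / (real n + 1))
     \<longlonglongrightarrow> (y ^ n / fact n) * (y + 0) / (real n + 1)"
    by (intro tendsto_divide tendsto_mult Suc.IH tendsto_const) auto
  moreover have "(real ((m s + n) choose n) / real (q s) ^ n) * (real (m s) / real (q s) + (real n + 1) / real (q s)) / (real n + 1)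
      = real ((m s + Suc n) choose Suc n) / real (q s) ^ Suc n" for s
  proof -
    have "Suc n * (Suc (m s + n) choose Suc n) = Suc (m s + n) * ((m s + n) choose n)"
      by (rule Suc_times_binomial)
    then have "real (Suc n) * real (Suc (m s + n) choose Suc n) = real (Suc (m s + n)) * real ((m s + n) choose n)"
      by (metis of_nat_mult)
    then have "real ((m s + Suc n) choose Suc n) = real ((m s + n) choose n) * (real (m s) + (real n + 1)) / (real n + 1)"
      by (simp add: field_simps)
    then show ?thesis unfolding add_divide_distrib[symmetric] power_Suc
      by (simp only: times_divide_eq_right times_divide_eq_left divide_divide_eq_left mult_ac)
  qed
  ultimately show ?case by (simp add: fact_Suc field_simps)
qed

lemma box_count_part_limit:
  assumes n: "1 \<le> n" and q: "filterlim q at_top sequentially"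
    and d: "(\<lambda>s. real (d s) / real (q s)) \<longlonglongrightarrow> x"
  shows "(\<lambda>s. box_count_part n (q s) (d s) / real (q s) ^ n) \<longlonglongrightarrow> bspline_deriv n x"
proof -
  have ev: "\<forall>\<^sub>F s in sequentially. 0 < q s" by (rule eventually_compose_filterlim[OF eventually_gt_at_top q])
  have lim: "(\<lambda>s. (if d s < i * q s then 0 else real ((d s - i * q s + n) choose n)) / real (q s) ^ n)
      \<longlonglongrightarrow> max 0 (x - real i) ^ n / fact n" for i
  proof -
    have "(\<lambda>s. max 0 (real (d s) / real (q s) - real i)) \<longlonglongrightarrow> max 0 (x - real i)"
      by (intro tendsto_max tendsto_diff tendsto_const d)
    moreover have "\<forall>\<^sub>F s in sequentially. max 0 (real (d s) / real (q s) - real i) = real (d s - i * q s) / real (q s)"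
      using ev
    proof eventually_elim
      case (elim s)
      show ?case
      proof (cases "d s < i * q s")
        case True
        then have "real (d s) < real i * real (q s)" by (metis of_nat_less_iff of_nat_mult)
        then have "real (d s) / real (q s) < real i" using elim by (simp add: divide_less_eq)
        then show ?thesis using True by simp
      next
        case False
        then have "real i * real (q s) \<le> real (d s)" by (metis not_less of_nat_le_iff of_nat_mult)
        then have "real i \<le> real (d s) / real (q s)" using elim by (simp add: le_divide_eq)
        then show ?thesis using False elim by (simp add: of_nat_diff field_simps)
      qed
    qed
    ultimately have m: "(\<lambda>s. real (d s - i * q s) / real (q s)) \<longlonglongrightarrow> max 0 (x - real i)"
      by (rule Lim_transform_eventually)
    have B: "(\<lambda>s. real ((d s - i * q s + n) choose n) / real (q s) ^ n) \<longlonglongrightarrow> max 0 (x - real i) ^ n / fact n"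
      by (rule binomial_limit[OF q m])
    show ?thesis
    proof (cases "x - real i > 0")
      case True
      then have "\<forall>\<^sub>F s in sequentially. real i < real (d s) / real (q s)"
        using order_tendstoD(1)[OF d] by simp
      then have "\<forall>\<^sub>F s in sequentially. real ((d s - i * q s + n) choose n) / real (q s) ^ n
         = (if d s < i * q s then 0 else real ((d s - i * q s + n) choose n)) / real (q s) ^ n"
        using ev
      proof eventually_elim
        case (elim s)
        then have "real i * real (q s) < real (d s)" by (simp add: less_divide_eq)
        then have "\<not> d s < i * q s" by (metis not_less_iff_gr_or_eq of_nat_less_iff of_nat_mult)
        then show ?case by simp
      qed
      then show ?thesis by (rule Lim_transform_eventually[OF B])
    next
      \<comment> \<open>At the knot x = i the comparison of d with iq may change infinitely often.
        The term is squeezed between 0 and its version without case distinction, which tends to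
        0.\<close>
      case False
      then have 0: "max 0 (x - real i) ^ n / fact n = 0" using n by simp
      show ?thesis unfolding 0
        by (rule tendsto_sandwich[OF _ _ tendsto_const B[unfolded 0]]) (auto intro!: always_eventually)
    qed
  qed
  have "(\<lambda>s. \<Sum>i\<le>n+2. real (n + 2 choose i) * (-1) ^ i * ((if d s < i * q s then 0 else real ((d s - i * q s + n) choose n)) / real (q s) ^ n))
     \<longlonglongrightarrow> bspline_deriv n x"
    unfolding bspline_deriv_def by (intro tendsto_sum tendsto_mult tendsto_const lim)
  moreover have "(\<Sum>i\<le>n+2. real (n + 2 choose i) * (-1) ^ i * ((if d s < i * q s then 0 else real ((d s - i * q s + n) choose n)) / real (q s) ^ n))
     = box_count_part n (q s) (d s) / real (q s) ^ n" for s
    unfolding box_count_part_def sum_divide_distrib by (simp only: times_divide_eq_right)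
  ultimately show ?thesis by simp
qed

lemma card_diff_limit:
  assumes n: "1 \<le> n" and q: "filterlim q at_top sequentially"
    and d: "(\<lambda>s. real (d s) / real (q s)) \<longlonglongrightarrow> x" and x: "0 < x"
  shows "(\<lambda>s. card_diff (n + 2) (q s) (d s) / real (q s) ^ n) \<longlonglongrightarrow> 2 * bspline_deriv n x"
proof -
  have r: "filterlim (\<lambda>s. real (q s)) at_top sequentially"
    using q by (rule filterlim_compose[OF filterlim_real_sequentially])
  have ev: "\<forall>\<^sub>F s in sequentially. 0 < d s"
    using order_tendstoD(1)[OF d x] by eventually_elim (metis divide_eq_0_iff of_nat_0 less_irrefl neq0_conv)
  have "(\<lambda>s. 1 / real (q s)) \<longlonglongrightarrow> 0" by (rule real_tendsto_divide_at_top[OF tendsto_const r])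
  then have "(\<lambda>s. real (d s) / real (q s) - 1 / real (q s)) \<longlonglongrightarrow> x - 0" by (rule tendsto_diff[OF d])
  moreover have "\<forall>\<^sub>F s in sequentially. real (d s) / real (q s) - 1 / real (q s) = real (d s - 1) / real (q s)"
    using ev by eventually_elim (simp add: of_nat_diff diff_divide_distrib)
  ultimately have d1: "(\<lambda>s. real (d s - 1) / real (q s)) \<longlonglongrightarrow> x"
    using Lim_transform_eventually by fastforce
  have "(\<lambda>s. box_count_part n (q s) (d s) / real (q s) ^ n + box_count_part n (q s) (d s - 1) / real (q s) ^ n) \<longlonglongrightarrow> bspline_deriv n x + bspline_deriv n x"
    by (intro tendsto_add box_count_part_limit[OF n q] d d1)
  moreover have "\<forall>\<^sub>F s in sequentially. box_count_part n (q s) (d s) / real (q s) ^ n + box_count_part n (q s) (d s - 1) / real (q s) ^ n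
      = card_diff (n + 2) (q s) (d s) / real (q s) ^ n"
    using ev by eventually_elim (simp only: card_diff_box_count_part add_divide_distrib less_numeral_extra if_False neq0_conv[symmetric] simp_thms if_not_P)
  ultimately show ?thesis unfolding mult_2 by (rule Lim_transform_eventually)
qed

section \<open>The density function\<close>

locale hk_quadric =
  fixes p n :: nat
  assumes p: "prime p" and podd: "odd p" and n: "3 \<le> n"
begin

definition H :: "nat \<Rightarrow> nat \<Rightarrow> real" where
  "H s d = real (hilb_box p (n + 2) (p ^ s) d)"

definition Ka :: "nat \<Rightarrow> nat \<Rightarrow> real" where
  "Ka s e = real (ker_dim p (n + 2) (p ^ s) e)"

text \<open>Inside this locale the letter denotes the real number q = p^s, not the quadric.\<close>

definition Q :: "nat \<Rightarrow> real" where "Q s = real (p ^ s)"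

definition top :: "nat \<Rightarrow> nat" where "top s = (n + 2) * (p ^ s - 1)"

lemma p3: "3 \<le> p"
  using p podd prime_ge_2_nat[of p] by (cases "p = 2") auto

lemma q_pos: "0 < p ^ s"
  using p3 by simp

lemma q3: "1 \<le> s \<Longrightarrow> 3 \<le> p ^ s"
  using p3 self_le_power[of p s] by simp

lemma Q_pos: "0 < Q s"
  using q_pos[of s] by (simp add: Q_def)

lemma Q_Suc: "Q (Suc s) = real p * Q s"
  by (simp add: Q_def)

lemma Q_power: "Q s ^ n = Q s * Q s ^ (n - 1)"
  using n by (cases n) auto

lemma top_real: "real (top s) = (real n + 2) * Q s - (real n + 2)"
proof -
  have "real (p ^ s - 1) = Q s - 1" using q_pos[of s] by (simp add: Q_def of_nat_diff Suc_leI)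
  then show ?thesis unfolding top_def of_nat_mult of_nat_add of_nat_numeral \<open>real (p ^ s - 1) = Q s - 1\<close> by (simp add: algebra_simps)
qed

lemma q_lim: "filterlim (\<lambda>s. p ^ s) at_top sequentially"
proof -
  have "s \<le> p ^ s" for s using p3 power_gt_expt[of p s] by (simp add: less_imp_le)
  then show ?thesis by (intro filterlim_at_top_mono[OF filterlim_ident]) auto
qed

lemma Q_lim: "filterlim Q at_top sequentially"
  unfolding Q_def[abs_def] by (rule filterlim_compose[OF filterlim_real_sequentially q_lim])

lemma over_Q: "(\<lambda>s. c / Q s) \<longlonglongrightarrow> 0"
  by (rule real_tendsto_divide_at_top[OF tendsto_const Q_lim])

lemma H_nonneg: "0 \<le> H s d" by (simp add: H_def)

lemma H_dual: "d \<le> top s \<Longrightarrow> H s d = Ka s (top s - d)"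
  using hilb_box_dual[OF p q_pos, of d "n + 2" s] by (simp add: H_def Ka_def top_def)

lemma H_zero: "top s < d \<Longrightarrow> H s d = 0"
  using hilb_box_eq_0[of "n + 2" "p ^ s" d p] by (simp add: H_def top_def)

lemma H_Ka: "H s (e + 2) - Ka s e = card_diff (n + 2) (p ^ s) (e + 2)"
proof -
  have "int (hilb_box p (n + 2) (p ^ s) (e + 2)) - int (ker_dim p (n + 2) (p ^ s) e)
     = int (card (box_mons (n + 2) (p ^ s) (e + 2))) - int (card (box_mons (n + 2) (p ^ s) e))"
    using hilb_box_ker_dim[OF p, of "e + 2" "n + 2" "p ^ s"] by simp
  from arg_cong[OF this, of real_of_int] show ?thesis
    by (simp add: H_def Ka_def card_diff_def)
qed

lemma Ka_le: "Ka s e \<le> H s (top s - e)"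
proof (cases "e \<le> top s")
  case True
  then show ?thesis using H_dual[of "top s - e" s] by simp
next
  case False
  then have "box_mons (n + 2) (p ^ s) e = {}" by (intro box_mons_empty) (simp add: top_def)
  then show ?thesis by (simp add: Ka_def ker_dim_def H_nonneg)
qed

text \<open>By duality an increase of the cokernel dimension is a decrease of the kernel dimension
  in complementary degree, bounded by \<open>ker_dim_step\<close>.\<close>

lemma H_up:
  assumes s: "1 \<le> s"
  shows "H s (d + 1) \<le> H s d + 2 * Q s ^ (n - 1)"
proof (cases "d + 1 \<le> top s")
  case True
  then have e: "top s - d = (top s - (d + 1)) + 1" by simp
  have "n + 2 - 3 = n - 1" using n by simp
  then have "ker_dim p (n + 2) (p ^ s) (top s - (d + 1)) \<le> ker_dim p (n + 2) (p ^ s) (top s - d) + 2 * (p ^ s) ^ (n - 1)"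
    using ker_dim_step[OF p _ q3[OF s], of "n + 2" "top s - (d + 1)"] n e by simp
  then have "Ka s (top s - (d + 1)) \<le> Ka s (top s - d) + 2 * Q s ^ (n - 1)"
    unfolding Ka_def Q_def by (metis (mono_tags) of_nat_add of_nat_le_iff of_nat_mult of_nat_numeral of_nat_power)
  then show ?thesis using True by (simp add: H_dual)
next
  case False
  then have "H s (d + 1) = 0" by (intro H_zero) simp
  then show ?thesis using H_nonneg Q_pos[of s] by (simp add: add_nonneg_nonneg)
qed

text \<open>Subtract \<open>H_Ka\<close> in consecutive degrees: 2 comes from \<open>H_up\<close>
  and 8 from \<open>card_diff_step\<close>. Dualising again bounds the decrease of H.\<close>

lemma Ka_up:
  assumes s: "1 \<le> s"
  shows "Ka s (e + 1) \<le> Ka s e + 10 * Q s ^ (n - 1)"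
proof -
  have "n + 2 - 3 = n - 1" using n by simp
  then have "\<bar>card_diff (n + 2) (p ^ s) (e + 2 + 1) - card_diff (n + 2) (p ^ s) (e + 2)\<bar> \<le> 8 * Q s ^ (n - 1)"
    using card_diff_step[of "n + 2" "p ^ s" "e + 2"] n unfolding Q_def by simp
  moreover have "e + 1 + 2 = e + 2 + 1" by simp
  ultimately show ?thesis
    using H_up[OF s, of "e + 2"] H_Ka[of s e] H_Ka[of s "e + 1"] by (simp only:)
qed

lemma H_down:
  assumes s: "1 \<le> s"
  shows "H s d \<le> H s (d + 1) + 10 * Q s ^ (n - 1)"
proof -
  consider "d + 1 \<le> top s" | "d = top s" | "top s < d" by linarith
  then show ?thesis
  proof cases
    case 1
    then have e: "top s - d = (top s - (d + 1)) + 1" by simp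
    show ?thesis using Ka_up[OF s, of "top s - (d + 1)"] 1 e by (simp add: H_dual)
  next
    case 2
    have "box_mons (n + 2) (p ^ s) 0 \<subseteq> {\<lambda>_. 0}"
    proof
      fix m assume m: "m \<in> box_mons (n + 2) (p ^ s) 0"
      have "m i = 0" for i
      proof (cases "i < n + 2")
        case True
        then have "m i \<le> xdeg (n + 2) m" unfolding xdeg_def by (intro member_le_sum) auto
        then show ?thesis using m by (simp add: box_mons_def)
      next
        case False
        then show ?thesis using m by (simp add: box_mons_def xbox_def)
      qed
      then show "m \<in> {\<lambda>_. 0}" by auto
    qed
    from card_mono[OF _ this] have "card (box_mons (n + 2) (p ^ s) 0) \<le> 1" by simp
    then have "ker_dim p (n + 2) (p ^ s) 0 \<le> 1" by (simp add: ker_dim_def)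
    then have "H s d \<le> 1" using 2 by (simp add: H_dual Ka_def)
    moreover have "1 \<le> Q s" unfolding Q_def using q_pos[of s] by linarith
    then have "1 \<le> Q s ^ (n - 1)" by (rule one_le_power)
    ultimately show ?thesis using H_nonneg[of s "d + 1"] by linarith
  next
    case 3
    then show ?thesis using H_nonneg[of s "d + 1"] Q_pos[of s] by (simp add: H_zero add_nonneg_nonneg)
  qed
qed

lemma H_lip_add:
  assumes s: "1 \<le> s"
  shows "\<bar>H s (d + k) - H s d\<bar> \<le> 10 * real k * Q s ^ (n - 1)"
proof (induction k)
  case (Suc k)
  have "0 \<le> Q s ^ (n - 1)" using Q_pos[of s] by simp
  then show ?case
    using Suc H_up[OF s, of "d + k"] H_down[OF s, of "d + k"] by (simp add: algebra_simps)
qed simp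

lemma H_lip:
  assumes s: "1 \<le> s"
  shows "\<bar>H s d - H s d'\<bar> \<le> 10 * \<bar>real d - real d'\<bar> * Q s ^ (n - 1)"
proof (cases "d \<le> d'")
  case True
  then show ?thesis using H_lip_add[OF s, of d "d' - d"] by (simp add: of_nat_diff abs_minus_commute)
next
  case False
  then show ?thesis using H_lip_add[OF s, of d' "d - d'"] by (simp add: of_nat_diff)
qed

section \<open>Convergence of the normalised Hilbert function\<close>

definition C :: real where "C = 12 * real n + 35"

lemma H_frob:
  assumes s: "1 \<le> s"
  shows "H (Suc s) d \<le> real p ^ n * (H s (d div p) + C * Q s ^ (n - 1))"
proof (cases "d \<le> top (Suc s)")
  case True
  define e where "e = (top (Suc s) - d) div p"
  have N: "n + 2 - 3 = n - 1" "n + 2 - 2 = n" using n by auto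
  have "ker_dim p (n + 2) (p * p ^ s) (top (Suc s) - d)
     \<le> p ^ n * ker_dim p (n + 2) (p ^ s) e + (2 * (n + 2) + 1) * p ^ n * (p ^ s) ^ (n - 1)"
    using ker_dim_frobenius'[OF p podd _ refl q3[OF s], of "n + 2" "top (Suc s) - d"] n unfolding N e_def by simp
  then have "real (ker_dim p (n + 2) (p ^ Suc s) (top (Suc s) - d))
     \<le> real (p ^ n * ker_dim p (n + 2) (p ^ s) e + (2 * (n + 2) + 1) * p ^ n * (p ^ s) ^ (n - 1))"
    unfolding power_Suc by (rule of_nat_mono)
  then have "H (Suc s) d \<le> real p ^ n * Ka s e + (2 * real n + 5) * real p ^ n * Q s ^ (n - 1)"
    unfolding H_dual[OF True] Ka_def Q_def by (simp add: algebra_simps)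
  also have "\<dots> = real p ^ n * (Ka s e + (2 * real n + 5) * Q s ^ (n - 1))" by (simp add: algebra_simps)
  also have "\<dots> \<le> real p ^ n * (H s (d div p) + C * Q s ^ (n - 1))"
  proof (rule mult_left_mono)
    \<comment> \<open>Adding n+2 to the top degree gives a quantity that scales exactly by p, so the
      dual degrees at the two levels agree up to rounding and n+2. The Lipschitz cost 10(n+3) of
      this shift and 2n+5 from \<open>ker_dim_frobenius'\<close> add up to C.\<close>
    have "\<bar>real (top s - e) - real (d div p)\<bar> \<le> real n + 3"
    proof -
      define a where "a = d div p"
      define r where "r = d mod p"
      have d: "d = p * a + r" by (simp add: a_def r_def)
      have r: "r < p" using p3 by (simp add: r_def)
      define T where "T = (n + 2) * p ^ s"
      have aux: "a * (P - 1) + a = a * P" if "0 < P" for a P :: nat using that by (cases P) auto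
      have t1: "top (Suc s) + (n + 2) = p * T"
        unfolding top_def aux[OF q_pos] T_def by (simp add: mult_ac)
      have t0: "top s + (n + 2) = T" unfolding top_def aux[OF q_pos] T_def ..
      define g where "g = (top (Suc s) - d) mod p"
      have g: "g < p" using p3 by (simp add: g_def)
      have "top (Suc s) - d = p * e + g" by (simp add: e_def g_def)
      then have eq: "p * e + g + (p * a + r) + (n + 2) = p * T" using True t1 d by simp
      have "p * (e + a) \<le> p * T" using eq by (simp add: algebra_simps)
      then have 1: "e + a \<le> T" using p3 by simp
      have "p * T < p * (e + a + 2) + (n + 2)" using eq g r by (simp add: algebra_simps)
      also have "\<dots> \<le> p * (e + a + 2) + p * (n + 2)" using p3 mult_le_mono1[of 1 p "n + 2"] by simp
      also have "\<dots> = p * (e + a + 2 + (n + 2))" by (simp add: algebra_simps)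
      finally have 2: "T < e + a + 2 + (n + 2)" by (simp only: mult_less_cancel1)
      have "\<bar>int (top s - e) - int a\<bar> \<le> int n + 3" using 1 2 t0 by linarith
      then have "real_of_int \<bar>int (top s - e) - int a\<bar> \<le> real_of_int (int n + 3)" by (simp only: of_int_le_iff)
      then show ?thesis by (simp add: a_def)
    qed
    then have "10 * \<bar>real (top s - e) - real (d div p)\<bar> * Q s ^ (n - 1) \<le> 10 * (real n + 3) * Q s ^ (n - 1)"
      using Q_pos[of s] by (intro mult_right_mono mult_left_mono) auto
    then have "Ka s e \<le> H s (d div p) + 10 * (real n + 3) * Q s ^ (n - 1)"
      using Ka_le[of s e] H_lip[OF s, of "top s - e" "d div p"] by linarith
    then show "Ka s e + (2 * real n + 5) * Q s ^ (n - 1) \<le> H s (d div p) + C * Q s ^ (n - 1)"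
      by (simp add: C_def algebra_simps)
  qed simp
  finally show ?thesis .
next
  case False
  have "0 \<le> real p ^ n * (H s (d div p) + C * Q s ^ (n - 1))"
    using H_nonneg[of s "d div p"] Q_pos[of s] by (simp add: C_def)
  then show ?thesis using False by (simp add: H_zero)
qed

definition flr :: "real \<Rightarrow> nat \<Rightarrow> nat" where "flr x s = nat \<lfloor>x * Q s\<rfloor>"

lemma flr_bounds: "0 \<le> x \<Longrightarrow> real (flr x s) \<le> x * Q s \<and> x * Q s < real (flr x s) + 1"
  using Q_pos[of s] unfolding flr_def by (simp add: of_nat_nat)

lemma flr_Suc: "0 \<le> x \<Longrightarrow> flr x (Suc s) div p = flr x s"
proof -
  assume x: "0 \<le> x"
  have "\<lfloor>x * Q (Suc s)\<rfloor> div int p = \<lfloor>x * Q (Suc s) / real_of_int (int p)\<rfloor>"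
    by (rule floor_divide_real_eq_div[symmetric]) simp
  also have "x * Q (Suc s) / real_of_int (int p) = x * Q s" using p3 by (simp add: Q_Suc)
  finally have "\<lfloor>x * Q (Suc s)\<rfloor> div int p = \<lfloor>x * Q s\<rfloor>" .
  then have "nat (\<lfloor>x * Q (Suc s)\<rfloor> div int p) = flr x s" by (simp add: flr_def)
  then show ?thesis by (simp add: flr_def nat_div_distrib')
qed

definition u :: "real \<Rightarrow> nat \<Rightarrow> real" where "u x s = H s (flr x s) / Q s ^ n"

lemma C_pos: "0 < C" by (simp add: C_def)

lemma u_Suc:
  assumes x: "0 \<le> x" and s: "1 \<le> s"
  shows "u x (Suc s) \<le> u x s + C / Q s"
proof -
  have "u x (Suc s) \<le> real p ^ n * (H s (flr x s) + C * Q s ^ (n - 1)) / Q (Suc s) ^ n"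
    unfolding u_def using H_frob[OF s, of "flr x (Suc s)"] Q_pos[of "Suc s"]
    by (intro divide_right_mono) (auto simp: flr_Suc[OF x])
  also have "\<dots> = (H s (flr x s) + C * Q s ^ (n - 1)) / Q s ^ n"
    using p3 by (simp add: Q_Suc power_mult_distrib)
  also have "\<dots> = u x s + C / Q s"
    using Q_pos[of s] by (simp add: u_def add_divide_distrib Q_power)
  finally show ?thesis .
qed

text \<open>Adding 2C/q absorbs the error C/q of \<open>u_Suc\<close>: since p >= 2, C/q + 2C/(pq)
  <= 2C/q. The corrected sequence is decreasing and non-negative.\<close>

lemma u_convergent:
  assumes x: "0 \<le> x"
  shows "convergent (u x)"
proof -
  define v where "v s = u x (Suc s) + 2 * C / Q (Suc s)" for s
  have "v (Suc s) \<le> v s" for s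
  proof -
    have "2 * C / Q (Suc (Suc s)) \<le> C / Q (Suc s)"
    proof -
      have "2 * C / (real p * Q (Suc s)) \<le> 2 * C / (2 * Q (Suc s))"
        using p3 C_pos Q_pos[of "Suc s"] by (intro divide_left_mono mult_right_mono) auto
      then show ?thesis by (simp add: Q_Suc[of "Suc s"])
    qed
    then show ?thesis using u_Suc[OF x, of "Suc s"] by (simp add: v_def)
  qed
  then have "decseq v" by (rule decseq_SucI)
  moreover have "0 \<le> v s" for s
    using H_nonneg Q_pos C_pos by (simp add: v_def u_def less_imp_le add_nonneg_nonneg)
  ultimately obtain l where l: "v \<longlonglongrightarrow> l" using decseq_convergent[of v 0] by blast
  have "(\<lambda>s. v s - 2 * C / Q (Suc s)) \<longlonglongrightarrow> l - 0"
    by (intro tendsto_diff l LIMSEQ_Suc over_Q)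
  then have "(\<lambda>s. u x (Suc s)) \<longlonglongrightarrow> l" by (simp add: v_def)
  then show ?thesis using LIMSEQ_imp_Suc convergentI by blast
qed

definition f :: "real \<Rightarrow> real" where "f x = lim (u x)"

lemma u_lim: "0 \<le> x \<Longrightarrow> u x \<longlonglongrightarrow> f x"
  using u_convergent unfolding f_def by (simp add: convergent_LIMSEQ_iff)

text \<open>The increments of H are of order q^(n-1), so a bounded change of the degree disappears
  after division by q^n.\<close>

lemma f_lim:
  assumes x: "0 \<le> x" and d: "\<forall>\<^sub>F s in sequentially. \<bar>real (d s) - x * Q s\<bar> \<le> c"
  shows "(\<lambda>s. H s (d s) / Q s ^ n) \<longlonglongrightarrow> f x"
proof (rule Lim_transform[OF u_lim[OF x]])
  show "(\<lambda>s. H s (d s) / Q s ^ n - u x s) \<longlonglongrightarrow> 0"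
  proof (rule Lim_null_comparison[OF _ over_Q[of "10 * (c + 1)"]])
    show "\<forall>\<^sub>F s in sequentially. norm (H s (d s) / Q s ^ n - u x s) \<le> 10 * (c + 1) / Q s"
      using d eventually_ge_at_top[of 1]
    proof eventually_elim
      case (elim s)
      have "\<bar>real (d s) - real (flr x s)\<bar> \<le> c + 1" using elim(1) flr_bounds[OF x, of s] by linarith
      then have "10 * \<bar>real (d s) - real (flr x s)\<bar> * Q s ^ (n - 1) \<le> 10 * (c + 1) * Q s ^ (n - 1)"
        using Q_pos[of s] by (intro mult_right_mono mult_left_mono) auto
      then have "\<bar>H s (d s) - H s (flr x s)\<bar> \<le> 10 * (c + 1) * Q s ^ (n - 1)"
        using H_lip[OF elim(2), of "d s" "flr x s"] by linarith
      then have "\<bar>H s (d s) - H s (flr x s)\<bar> / Q s ^ n \<le> 10 * (c + 1) * Q s ^ (n - 1) / Q s ^ n"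
        using Q_pos[of s] by (intro divide_right_mono) auto
      also have "\<dots> = 10 * (c + 1) / Q s" using Q_pos[of s] by (simp add: Q_power)
      finally show ?case using Q_pos[of s] by (simp add: u_def diff_divide_distrib[symmetric] abs_divide)
    qed
  qed
qed

lemma f_nonneg: "0 \<le> x \<Longrightarrow> 0 \<le> f x"
  by (rule LIMSEQ_le_const[OF u_lim]) (auto simp: u_def H_nonneg Q_pos less_imp_le)

text \<open>That the constant is the same for all p is essential for
  \<open>hk_quadric_limit\<close>.\<close>

lemma f_lipschitz:
  assumes x: "0 \<le> x" and y: "0 \<le> y"
  shows "\<bar>f x - f y\<bar> \<le> 10 * \<bar>x - y\<bar>"
proof (rule LIMSEQ_le)
  show "(\<lambda>s. \<bar>u x s - u y s\<bar>) \<longlonglongrightarrow> \<bar>f x - f y\<bar>"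
    by (intro tendsto_rabs tendsto_diff u_lim x y)
  have "(\<lambda>s. 10 * \<bar>x - y\<bar> + 10 / Q s) \<longlonglongrightarrow> 10 * \<bar>x - y\<bar> + 0"
    by (intro tendsto_add tendsto_const over_Q)
  then show "(\<lambda>s. 10 * \<bar>x - y\<bar> + 10 / Q s) \<longlonglongrightarrow> 10 * \<bar>x - y\<bar>" by simp
  have "\<bar>u x s - u y s\<bar> \<le> 10 * \<bar>x - y\<bar> + 10 / Q s" if s: "1 \<le> s" for s
  proof -
    have "\<bar>real (flr x s) - real (flr y s)\<bar> \<le> \<bar>x * Q s - y * Q s\<bar> + 1"
      using flr_bounds[OF x, of s] flr_bounds[OF y, of s] by linarith
    also have "\<bar>x * Q s - y * Q s\<bar> = \<bar>x - y\<bar> * Q s"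
      using Q_pos[of s] by (simp add: left_diff_distrib[symmetric] abs_mult)
    finally have "10 * \<bar>real (flr x s) - real (flr y s)\<bar> * Q s ^ (n - 1) \<le> 10 * (\<bar>x - y\<bar> * Q s + 1) * Q s ^ (n - 1)"
      using Q_pos[of s] by (intro mult_right_mono mult_left_mono) auto
    then have "\<bar>H s (flr x s) - H s (flr y s)\<bar> \<le> 10 * (\<bar>x - y\<bar> * Q s + 1) * Q s ^ (n - 1)"
      using H_lip[OF s, of "flr x s" "flr y s"] by linarith
    then have "\<bar>H s (flr x s) - H s (flr y s)\<bar> / Q s ^ n \<le> 10 * (\<bar>x - y\<bar> * Q s + 1) * Q s ^ (n - 1) / Q s ^ n"
      using Q_pos[of s] by (intro divide_right_mono) auto
    also have "\<dots> = 10 * \<bar>x - y\<bar> + 10 / Q s" using Q_pos[of s] by (simp add: Q_power field_simps)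
    finally show ?thesis using Q_pos[of s] by (simp add: u_def diff_divide_distrib[symmetric] abs_divide)
  qed
  then show "\<exists>N. \<forall>s\<ge>N. \<bar>u x s - u y s\<bar> \<le> 10 * \<bar>x - y\<bar> + 10 / Q s" by blast
qed

lemma f_eq_0:
  assumes x: "real n + 2 \<le> x"
  shows "f x = 0"
proof -
  have "u x s = 0" for s
  proof -
    have "(real n + 2) * Q s \<le> x * Q s" using x Q_pos[of s] by (intro mult_right_mono) auto
    then have "real (top s) < real (flr x s)"
      using flr_bounds[of x s] x top_real[of s] n by linarith
    then show ?thesis by (simp add: u_def H_zero)
  qed
  then have "u x = (\<lambda>_. 0)" by blast
  then show ?thesis by (simp add: f_def)
qed

section \<open>Reflection identities for the density\<close>

lemma eventually_Q: "\<forall>\<^sub>F s in sequentially. c < Q s"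
  using Q_lim by (simp add: filterlim_at_top_dense)

lemma flr_eventually:
  assumes x: "0 < x" "x < real n + 2"
  shows "\<forall>\<^sub>F s in sequentially. 2 \<le> flr x s \<and> flr x s \<le> top s"
  using eventually_Q[of "2 / x"] eventually_Q[of "(real n + 2) / (real n + 2 - x)"]
proof eventually_elim
  case (elim s)
  have "2 < x * Q s" using elim(1) x by (simp add: field_simps)
  moreover have "real n + 2 < (real n + 2 - x) * Q s" using elim(2) x by (simp add: field_simps)
  ultimately have "2 < real (flr x s) + 1" "real (flr x s) < real (top s)"
    using flr_bounds[of x s] x top_real[of s] by (auto simp: left_diff_distrib)
  then show ?case by linarith
qed

lemma dual_lim:
  assumes x: "0 < x" "x < real n + 2"
  shows "(\<lambda>s. Ka s (flr x s - 2) / Q s ^ n) \<longlonglongrightarrow> f (real n + 2 - x)"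
proof -
  have "(\<lambda>s. H s (top s - (flr x s - 2)) / Q s ^ n) \<longlonglongrightarrow> f (real n + 2 - x)"
  proof (rule f_lim[where c="real n + 5"])
    show "\<forall>\<^sub>F s in sequentially. \<bar>real (top s - (flr x s - 2)) - (real n + 2 - x) * Q s\<bar> \<le> real n + 5"
      using flr_eventually[OF x]
    proof eventually_elim
      case (elim s)
      then have "real (top s - (flr x s - 2)) = real (top s) - real (flr x s) + 2" by (simp add: of_nat_diff)
      then show ?case using flr_bounds[of x s] x top_real[of s] by (simp add: left_diff_distrib) linarith
    qed
  qed (use x in simp)
  moreover have "\<forall>\<^sub>F s in sequentially. H s (top s - (flr x s - 2)) / Q s ^ n = Ka s (flr x s - 2) / Q s ^ n"
    using flr_eventually[OF x]
  proof eventually_elim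
    case (elim s)
    have "top s - (top s - (flr x s - 2)) = flr x s - 2" using elim by linarith
    then show ?case by (simp add: H_dual)
  qed
  ultimately show ?thesis by (rule Lim_transform_eventually)
qed

lemma f_reflect:
  assumes x: "0 < x" "x < real n + 2"
  shows "f x - f (real n + 2 - x) = 2 * bspline_deriv n x"
proof (rule LIMSEQ_unique)
  show "(\<lambda>s. u x s - Ka s (flr x s - 2) / Q s ^ n) \<longlonglongrightarrow> f x - f (real n + 2 - x)"
    by (intro tendsto_diff u_lim dual_lim x) (use x in simp)
  have d: "(\<lambda>s. real (flr x s) / real (p ^ s)) \<longlonglongrightarrow> x"
  proof (rule tendsto_sandwich)
    show "\<forall>\<^sub>F s in sequentially. x - 1 / Q s \<le> real (flr x s) / real (p ^ s)"
    proof (intro always_eventually allI)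
      fix s show "x - 1 / Q s \<le> real (flr x s) / real (p ^ s)"
      proof -
        have "x - 1 / Q s = (x * Q s - 1) / Q s" using Q_pos[of s] by (simp add: field_simps)
        also have "\<dots> \<le> real (flr x s) / Q s"
          using flr_bounds[of x s] x Q_pos[of s] by (intro divide_right_mono) auto
        finally show ?thesis by (simp add: Q_def)
      qed
    qed
    show "\<forall>\<^sub>F s in sequentially. real (flr x s) / real (p ^ s) \<le> x"
    proof (intro always_eventually allI)
      fix s show "real (flr x s) / real (p ^ s) \<le> x"
        using flr_bounds[of x s] x Q_pos[of s] unfolding Q_def[symmetric] by (simp add: field_simps)
    qed
    have "(\<lambda>s. x - 1 / Q s) \<longlonglongrightarrow> x - 0" by (intro tendsto_diff tendsto_const over_Q)
    then show "(\<lambda>s. x - 1 / Q s) \<longlonglongrightarrow> x" by simp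
  qed simp
  have "(\<lambda>s. card_diff (n + 2) (p ^ s) (flr x s) / real (p ^ s) ^ n) \<longlonglongrightarrow> 2 * bspline_deriv n x"
    by (rule card_diff_limit[OF _ q_lim d x(1)]) (use n in simp)
  moreover have "\<forall>\<^sub>F s in sequentially. card_diff (n + 2) (p ^ s) (flr x s) / real (p ^ s) ^ n = u x s - Ka s (flr x s - 2) / Q s ^ n"
    using flr_eventually[OF x]
  proof eventually_elim
    case (elim s)
    then have "flr x s - 2 + 2 = flr x s" by linarith
    then show ?case using H_Ka[of s "flr x s - 2"]
      by (simp add: u_def diff_divide_distrib[symmetric] Q_def)
  qed
  ultimately show "(\<lambda>s. u x s - Ka s (flr x s - 2) / Q s ^ n) \<longlonglongrightarrow> 2 * bspline_deriv n x"
    by (rule Lim_transform_eventually)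
qed

text \<open>The threshold of \<open>ker_im_power\<close>, divided by p^(s-1), becomes the condition
  x < (n+2)/2 - (n-2)/(2p).\<close>

lemma ker1:
  assumes x: "0 < x" "2 * x * real p + (real n - 2) < (real n + 2) * real p" and s: "1 \<le> s" and d: "2 \<le> flr x s"
  shows "ker_im p (n + 2) (p ^ s) 1 (flr x s - 2)"
proof -
  obtain t where t: "s = Suc t" using s by (cases s) auto
  have "2 * real (flr x s) + (real n - 2) * Q t \<le> (2 * x * real p + (real n - 2)) * Q t"
    using flr_bounds[of x s] x(1) by (simp add: t Q_Suc algebra_simps)
  also have "\<dots> < (real n + 2) * real p * Q t" using x(2) Q_pos[of t] by simp
  finally have "2 * real (flr x s) + (real n - 2) * Q t < (real n + 2) * real p * Q t" .
  moreover have e: "real ((n - 2) * p ^ t) = (real n - 2) * Q t" using n by (simp add: Q_def of_nat_diff)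
  ultimately have "real (2 * flr x s + (n - 2) * p ^ t) < real ((n + 2) * p ^ Suc t)"
    unfolding of_nat_add e by (simp add: Q_def algebra_simps)
  then have "2 * (flr x s - 2 + 2) + (n - 2) * p ^ t < (n + 2) * p ^ Suc t"
    using d unfolding of_nat_less_iff by simp
  then show ?thesis using ker_im_power[OF p podd, of n t] n unfolding t by simp
qed

text \<open>Here the threshold becomes x < (n+2)/2 + 1 - (n-2)/(2p), one unit further than for
  \<open>ker1\<close>; the inequality in the window uses this room.\<close>

lemma ker2:
  assumes x: "2 \<le> x" "2 * (x - 2) * real p + (real n - 2) < real n * real p" and s: "1 \<le> s"
  shows "ker_im p (n + 2) (p ^ s) (p ^ s - 1) (flr (x - 2) s)"
proof -
  obtain t where t: "s = Suc t" using s by (cases s) auto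
  have "2 * real (flr (x - 2) s) + (real n - 2) * Q t \<le> (2 * (x - 2) * real p + (real n - 2)) * Q t"
    using flr_bounds[of "x - 2" s] x(1) by (simp add: t Q_Suc algebra_simps)
  also have "\<dots> < real n * real p * Q t" using x(2) Q_pos[of t] by simp
  finally have "2 * real (flr (x - 2) s) + (real n - 2) * Q t < real n * real p * Q t" .
  moreover have e: "real ((n - 2) * p ^ t) = (real n - 2) * Q t" using n by (simp add: Q_def of_nat_diff)
  ultimately have "real (2 * flr (x - 2) s + (n - 2) * p ^ t) < real (n * p ^ Suc t)"
    unfolding of_nat_add e by (simp add: Q_def algebra_simps)
  then have "2 * flr (x - 2) s + (n - 2) * p ^ t < n * p ^ Suc t"
    unfolding of_nat_less_iff by simp
  then show ?thesis using ker_im_power[OF p podd, of n t] n unfolding t by simp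
qed

text \<open>Matches the kernel degree for x with the target degree of Q^(q-1) starting from the
  degree for x-2.\<close>

lemma flr_minus_2:
  assumes x: "2 \<le> x"
  shows "flr x s - 2 = flr (x - 2) s + 2 * (p ^ s - 1)"
proof -
  have "x * Q s = (x - 2) * Q s + of_int (int (2 * p ^ s))" by (simp add: Q_def algebra_simps)
  then have "\<lfloor>x * Q s\<rfloor> = \<lfloor>(x - 2) * Q s\<rfloor> + int (2 * p ^ s)" by (metis floor_add_int)
  moreover have "0 \<le> \<lfloor>(x - 2) * Q s\<rfloor>" using x Q_pos[of s] by simp
  ultimately have "flr x s = flr (x - 2) s + 2 * p ^ s" unfolding flr_def by (simp add: nat_add_distrib nat_mult_distrib nat_power_eq)
  then show ?thesis using q_pos[of s] by linarith
qed

text \<open>For x < 2 the kernel degree lies below 2(q-1), where Q is injective.\<close>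

lemma f_reflect_0:
  assumes x: "0 < x" "x < 2" "2 * x * real p + (real n - 2) < (real n + 2) * real p"
  shows "f (real n + 2 - x) = 0"
proof (rule LIMSEQ_unique[OF dual_lim])
  have x2: "x < real n + 2" using x by simp
  then show "0 < x" "x < real n + 2" using x by auto
  have "\<forall>\<^sub>F s in sequentially. 0 = Ka s (flr x s - 2) / Q s ^ n"
    using flr_eventually[OF x(1) x2] eventually_ge_at_top[of 1]
  proof eventually_elim
    case (elim s)
    have "real (flr x s) \<le> x * Q s" using flr_bounds[of x s] x by simp
    also have "\<dots> < 2 * Q s" using x(2) Q_pos[of s] by simp
    finally have "flr x s < 2 * p ^ s" unfolding Q_def by (metis of_nat_less_iff of_nat_mult of_nat_numeral)
    then have "flr x s - 2 < 2 * (p ^ s - 1)" using elim by linarith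
    then have "ker_dim p (n + 2) (p ^ s) (flr x s - 2) = 0"
      using ker_dim_eq_0[OF p ker1[OF x(1,3) elim(2)]] elim(1) by simp
    then show ?case by (simp add: Ka_def)
  qed
  then show "(\<lambda>s. Ka s (flr x s - 2) / Q s ^ n) \<longlonglongrightarrow> 0"
    by (rule Lim_transform_eventually[OF tendsto_const])
qed

lemma f_reflect_eq:
  assumes x: "2 \<le> x" "x < real n + 2" "2 * x * real p + (real n - 2) < (real n + 2) * real p"
  shows "f (real n + 2 - x) = f (x - 2)"
proof (rule LIMSEQ_unique[OF dual_lim])
  show x0: "0 < x" "x < real n + 2" using x by auto
  have "2 * (x - 2) * real p + (real n - 2) < real n * real p"
    using x(3) p3 by (simp add: algebra_simps)
  note k2 = ker2[OF x(1) this]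
  have "\<forall>\<^sub>F s in sequentially. u (x - 2) s = Ka s (flr x s - 2) / Q s ^ n"
    using flr_eventually[OF x0] eventually_ge_at_top[of 1]
  proof eventually_elim
    case (elim s)
    have "ker_im p (n + 2) (p ^ s) 1 (flr (x - 2) s + 2 * (p ^ s - 1))"
      using ker1[OF x0(1) x(3) elim(2)] elim(1) by (simp add: flr_minus_2[OF x(1)])
    from ker_dim_eq_hilb_box[OF p refl this k2[OF elim(2)]] show ?case
      by (simp add: u_def H_def Ka_def flr_minus_2[OF x(1)])
  qed
  then show "(\<lambda>s. Ka s (flr x s - 2) / Q s ^ n) \<longlonglongrightarrow> f (x - 2)"
    using x by (intro Lim_transform_eventually[OF u_lim]) auto
qed

lemma f_reflect_ge:
  assumes x: "2 \<le> x" "x < real n + 2" "2 * (x - 2) * real p + (real n - 2) < real n * real p"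
  shows "f (x - 2) \<le> f (real n + 2 - x)"
proof (rule LIMSEQ_le[OF u_lim dual_lim])
  show x0: "0 < x" "x < real n + 2" "0 \<le> x - 2" using x by auto
  have "u (x - 2) s \<le> Ka s (flr x s - 2) / Q s ^ n" if s: "1 \<le> s" for s
    using ker_dim_ge_hilb_box[OF p refl ker2[OF x(1,3) s]] Q_pos[of s]
    by (auto simp: u_def H_def Ka_def flr_minus_2[OF x(1)] intro!: divide_right_mono)
  then show "\<exists>N. \<forall>s\<ge>N. u (x - 2) s \<le> Ka s (flr x s - 2) / Q s ^ n" by blast
qed

lemma hk_density_eq:
  assumes K: "perfect_field_char K p"
  shows "hk_density K p n x = f x"
  unfolding hk_density_def f_def u_def[abs_def] H_def flr_def Q_def hilb_frob_eq_hilb_box[OF K p] ..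

end

section \<open>The limit density and its integral\<close>

definition truncated_power :: "nat \<Rightarrow> real \<Rightarrow> real" where
  "truncated_power m x = max 0 x ^ m / fact m"

definition backward_diff :: "nat \<Rightarrow> (real \<Rightarrow> real) \<Rightarrow> real \<Rightarrow> real" where
  "backward_diff m g x = (\<Sum>i\<le>m. real (m choose i) * (-1) ^ i * g (x - real i))"

lemma bspline_deriv_backward_diff: "bspline_deriv n x = backward_diff (n + 2) (truncated_power n) x"
  by (simp add: bspline_deriv_def backward_diff_def truncated_power_def)

lemma backward_diff_Suc: "backward_diff (Suc m) g x = backward_diff m g x - backward_diff m g (x - 1)"
proof -
  have s: "g (x - real (Suc i)) = g (x - 1 - real i)" for i by (simp add: algebra_simps)
  have d: "- (\<Sum>i\<le>m. (a i + b i) * c i * h i) = - (\<Sum>i\<le>m. b i * c i * h i) - (\<Sum>i\<le>m. a i * c i * h i)"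
    for a b c h :: "nat \<Rightarrow> real"
    by (simp add: distrib_right sum.distrib)
  have "backward_diff (Suc m) g x = g x + (\<Sum>i\<le>m. real (Suc m choose Suc i) * (-1) ^ Suc i * g (x - real (Suc i)))"
    unfolding backward_diff_def by (subst sum.atMost_Suc_shift) simp
  also have "\<dots> = g x + (\<Sum>i\<le>m. real (m choose Suc i) * (-1) ^ Suc i * g (x - real (Suc i))) - backward_diff m g (x - 1)"
    unfolding backward_diff_def s by (simp add: sum_negf d)
  also have "g x + (\<Sum>i\<le>m. real (m choose Suc i) * (-1) ^ Suc i * g (x - real (Suc i)))
      = (\<Sum>i\<le>Suc m. real (m choose i) * (-1) ^ i * g (x - real i))"
    by (subst sum.atMost_Suc_shift) simp
  also have "\<dots> = backward_diff m g x" by (simp add: backward_diff_def)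
  finally show ?thesis .
qed

lemma backward_diff_0: "backward_diff 0 g x = g x" by (simp add: backward_diff_def)

lemma backward_diff_deriv:
  assumes "\<And>y. (g has_real_derivative g' y) (at y)"
  shows "(backward_diff m g has_real_derivative backward_diff m g' x) (at x)"
  unfolding backward_diff_def[abs_def]
  by (auto intro!: derivative_eq_intros DERIV_chain2[OF assms] simp: mult.commute)

lemma monomial_deriv: "((\<lambda>y. y ^ Suc r / fact (Suc r)) has_real_derivative y ^ r / fact r) (at y)"
proof -
  have "((\<lambda>y. y ^ Suc r / fact (Suc r)) has_real_derivative (real (Suc r) * y ^ (Suc r - Suc 0)) / fact (Suc r)) (at y)"
    by (rule DERIV_cdivide[OF DERIV_pow])
  moreover have "(real (Suc r) * y ^ (Suc r - Suc 0)) / fact (Suc r) = y ^ r / fact r"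
    by (simp add: fact_Suc del: of_nat_Suc)
  ultimately show ?thesis by (simp only:)
qed

text \<open>In the top case the m-th difference of y^(m+1)/(m+1)! has derivative 1 by induction. So
  it is y plus a constant, and one more difference gives 1.\<close>

lemma backward_diff_monomial: "r \<le> m \<Longrightarrow> backward_diff m (\<lambda>y. y ^ r / fact r) x = (if r = m then 1 else 0)"
proof (induction m arbitrary: r x)
  case 0
  then show ?case by (simp add: backward_diff_0)
next
  case (Suc m)
  show ?case
  proof (cases "r = Suc m")
    case False
    then have "r \<le> m" using Suc.prems by simp
    then show ?thesis using Suc.IH[of r] False by (simp add: backward_diff_Suc)
  next
    case True
    let ?g = "backward_diff m (\<lambda>y. y ^ Suc m / fact (Suc m))"
    have d: "(?g has_real_derivative 1) (at y)" for y
      using backward_diff_deriv[of "\<lambda>y. y ^ Suc m / fact (Suc m)" "\<lambda>y. y ^ m / fact m" m y, OF monomial_deriv] Suc.IH[of m y] by simp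
    have "((\<lambda>y. ?g y - y) has_real_derivative 0) (at y)" for y
      using DERIV_diff[OF d[of y] DERIV_ident] by simp
    then have "?g x - x = ?g (x - 1) - (x - 1)" using DERIV_isconst_all by blast
    then show ?thesis using True by (simp add: backward_diff_Suc)
  qed
qed

lemma truncated_power_nonpos: "x \<le> 0 \<Longrightarrow> 1 \<le> m \<Longrightarrow> truncated_power m x = 0"
  by (simp add: truncated_power_def)

lemma truncated_power_reflect:
  assumes "1 \<le> m"
  shows "truncated_power m x + (-1) ^ m * truncated_power m (- x) = x ^ m / fact m"
proof (cases "0 \<le> x")
  case True
  then have "truncated_power m (- x) = 0" using assms by (intro truncated_power_nonpos) auto
  then show ?thesis using True by (simp add: truncated_power_def)
next
  case False
  have "(-1) ^ m * (- x) ^ m = x ^ m" unfolding power_mult_distrib[symmetric] by simp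
  then show ?thesis using False assms by (simp add: truncated_power_def)
qed

text \<open>The substitution i -> m-i turns m-x into -x inside the truncated powers. The truncated
  powers of y and -y combine to a full monomial, whose difference is known.\<close>

lemma backward_diff_truncated_power_reflect:
  assumes r: "1 \<le> r" "r \<le> m"
  shows "backward_diff m (truncated_power r) x + (-1) ^ (m + r) * backward_diff m (truncated_power r) (real m - x) = (if r = m then 1 else 0)"
proof -
  have "backward_diff m (truncated_power r) (real m - x) = (\<Sum>i\<le>m. real (m choose (m - i)) * (-1) ^ (m - i) * truncated_power r (real m - x - real (m - i)))"
    unfolding backward_diff_def
    by (rule sum.reindex_bij_witness[of _ "\<lambda>i. m - i" "\<lambda>i. m - i"]) auto
  then have "(-1) ^ (m + r) * backward_diff m (truncated_power r) (real m - x)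
     = (\<Sum>i\<le>m. (-1) ^ (m + r) * (real (m choose (m - i)) * (-1) ^ (m - i) * truncated_power r (real m - x - real (m - i))))"
    by (simp only: sum_distrib_left)
  also have "\<dots> = (\<Sum>i\<le>m. real (m choose i) * (-1) ^ i * ((-1) ^ r * truncated_power r (- (x - real i))))"
  proof (rule sum.cong[OF refl])
    fix i assume "i \<in> {..m}"
    then obtain j where j: "m = i + j" using le_Suc_ex by blast
    have sq: "(-1) ^ j * (-1 :: real) ^ j = 1" unfolding power_mult_distrib[symmetric] by simp
    have "(-1) ^ (m + r) * (-1 :: real) ^ (m - i) = (-1) ^ i * (-1) ^ r * ((-1) ^ j * (-1) ^ j)"
      unfolding j power_add by simp
    then have 1: "(-1) ^ (m + r) * (-1 :: real) ^ (m - i) = (-1) ^ i * (-1) ^ r" unfolding sq by simp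
    have 2: "real m - x - real (m - i) = - (x - real i)" using j by simp
    have 3: "m choose (m - i) = m choose i" using j binomial_symmetric[of i m] by simp
    have "(-1) ^ (m + r) * (real (m choose i) * (-1) ^ (m - i) * truncated_power r (- (x - real i)))
      = real (m choose i) * ((-1) ^ (m + r) * (-1) ^ (m - i)) * truncated_power r (- (x - real i))" by (simp only: mult_ac)
    then show "(-1) ^ (m + r) * (real (m choose (m - i)) * (-1) ^ (m - i) * truncated_power r (real m - x - real (m - i)))
       = real (m choose i) * (-1) ^ i * ((-1) ^ r * truncated_power r (- (x - real i)))"
      unfolding 1 2 3 by (simp only: mult.assoc)
  qed
  finally have "backward_diff m (truncated_power r) x + (-1) ^ (m + r) * backward_diff m (truncated_power r) (real m - x)
     = backward_diff m (\<lambda>y. truncated_power r y + (-1) ^ r * truncated_power r (- y)) x"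
    unfolding backward_diff_def distrib_left sum.distrib by simp
  also have "\<dots> = (if r = m then 1 else 0)"
    unfolding truncated_power_reflect[OF r(1)] using backward_diff_monomial[OF r(2), of x] by simp
  finally show ?thesis .
qed

lemma bspline_deriv_reflect: "1 \<le> n \<Longrightarrow> bspline_deriv n (real n + 2 - x) = - bspline_deriv n x"
  using backward_diff_truncated_power_reflect[of n "n + 2" x] by (simp add: bspline_deriv_backward_diff add.commute[of 2 "real n"])

lemma truncated_power_deriv: "1 \<le> m \<Longrightarrow> (truncated_power (Suc m) has_real_derivative truncated_power m x) (at x)"
proof -
  assume m: "1 \<le> m"
  consider "x > 0" | "x < 0" | "x = 0" by linarith
  then show ?thesis
  proof cases
    case 1
    have "((\<lambda>y. y ^ Suc m / fact (Suc m)) has_real_derivative truncated_power m x) (at x)"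
      using monomial_deriv[of m x] 1 by (simp add: truncated_power_def)
    then show ?thesis
      by (rule DERIV_cong_ev[THEN iffD1, rotated 3]) (use 1 eventually_nhds_in_open[of "{0<..}" x] in \<open>auto elim!: eventually_mono simp: truncated_power_def\<close>)
  next
    case 2
    have "((\<lambda>y. 0) has_real_derivative truncated_power m x) (at x)" using 2 m by (simp add: truncated_power_nonpos)
    then show ?thesis
      by (rule DERIV_cong_ev[THEN iffD1, rotated 3]) (use 2 eventually_nhds_in_open[of "{..<0}" x] in \<open>auto elim!: eventually_mono simp: truncated_power_def\<close>)
  next
    case 3
    have "((\<lambda>h. (truncated_power (Suc m) (0 + h) - truncated_power (Suc m) 0) / h) \<longlongrightarrow> 0) (at 0)"
    proof (rule Lim_null_comparison)
      show "\<forall>\<^sub>F h in at 0. norm ((truncated_power (Suc m) (0 + h) - truncated_power (Suc m) 0) / h) \<le> \<bar>h\<bar> ^ m"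
      proof (intro always_eventually allI)
        fix h :: real
        show "norm ((truncated_power (Suc m) (0 + h) - truncated_power (Suc m) 0) / h) \<le> \<bar>h\<bar> ^ m"
        proof (cases "h > 0")
          case True
          have "1 \<le> (fact (Suc m) :: real)" by (rule fact_ge_1)
          then have "h ^ m / fact (Suc m) \<le> h ^ m" using True by (simp add: divide_le_eq mult_le_cancel_left1 del: fact_Suc)
          then show ?thesis using True by (simp add: truncated_power_def del: fact_Suc)
        qed (simp add: truncated_power_def)
      qed
      have "((\<lambda>h::real. \<bar>h\<bar> ^ m) \<longlongrightarrow> \<bar>0\<bar> ^ m) (at 0)" by (intro tendsto_intros)
      moreover have "\<bar>0 :: real\<bar> ^ m = 0" using m by simp
      ultimately show "((\<lambda>h::real. \<bar>h\<bar> ^ m) \<longlongrightarrow> 0) (at 0)" by (simp only:)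
    qed
    then show ?thesis using 3 m by (simp add: DERIV_def truncated_power_nonpos)
  qed
qed

definition irwin_hall_cdf :: "nat \<Rightarrow> real \<Rightarrow> real" where "irwin_hall_cdf m = backward_diff m (truncated_power m)"

lemma backward_diff_truncated_power_nonpos: "x \<le> 0 \<Longrightarrow> 1 \<le> r \<Longrightarrow> backward_diff m (truncated_power r) x = 0"
  unfolding backward_diff_def by (intro sum.neutral) (simp add: truncated_power_nonpos)

lemma irwin_hall_cdf_reflect: "1 \<le> m \<Longrightarrow> irwin_hall_cdf m x + irwin_hall_cdf m (real m - x) = 1"
  using backward_diff_truncated_power_reflect[of m m x] by (simp add: irwin_hall_cdf_def)

text \<open>A truncated inverse of the averaging operator sending g to (g(x) + g(x-1))/2;
  \<open>alternating_sum_add_shift\<close> gives the truncation error.\<close>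

definition alternating_sum :: "nat \<Rightarrow> (real \<Rightarrow> real) \<Rightarrow> real \<Rightarrow> real" where
  "alternating_sum J g x = 2 * (\<Sum>j\<le>J. (-1) ^ j * g (x - real j))"

lemma alternating_sum_add_shift: "alternating_sum J g x + alternating_sum J g (x - 1) = 2 * (g x + (-1) ^ J * g (x - real (Suc J)))"
proof -
  have s: "g (x - 1 - real j) = g (x - real (Suc j))" for j by (simp add: algebra_simps)
  have "(\<Sum>j\<le>Suc J. (-1) ^ j * g (x - real j)) = g x - (\<Sum>j\<le>J. (-1) ^ j * g (x - real (Suc j)))"
    by (subst sum.atMost_Suc_shift) (simp add: sum_negf)
  then show ?thesis by (simp add: alternating_sum_def s)
qed

lemma alternating_sum_diff: "alternating_sum J (\<lambda>y. g y - g (y - 1)) x = alternating_sum J g x - alternating_sum J g (x - 1)"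
proof -
  have s: "x - real j - 1 = x - 1 - real j" for j by simp
  show ?thesis by (simp add: alternating_sum_def s right_diff_distrib sum_subtractf)
qed

lemma alternating_sum_deriv:
  assumes "\<And>y. (g has_real_derivative g' y) (at y)"
  shows "(alternating_sum J g has_real_derivative alternating_sum J g' x) (at x)"
  unfolding alternating_sum_def[abs_def]
  by (auto intro!: derivative_eq_intros DERIV_chain2[OF assms] simp: mult.commute)

lemma irwin_hall_cdf_deriv: "(irwin_hall_cdf (Suc (Suc m)) has_real_derivative backward_diff (Suc (Suc m)) (truncated_power (Suc m)) x) (at x)"
  unfolding irwin_hall_cdf_def by (rule backward_diff_deriv) (rule truncated_power_deriv, simp)

lemma irwin_hall_cdf_deriv': "(irwin_hall_cdf (Suc (Suc m)) has_real_derivative irwin_hall_cdf (Suc m) x - irwin_hall_cdf (Suc m) (x - 1)) (at x)"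
  using irwin_hall_cdf_deriv[of m x] unfolding backward_diff_Suc[of "Suc m"] irwin_hall_cdf_def .

lemma irwin_hall_cdf_nonpos: "x \<le> 0 \<Longrightarrow> 1 \<le> m \<Longrightarrow> irwin_hall_cdf m x = 0"
  unfolding irwin_hall_cdf_def by (rule backward_diff_truncated_power_nonpos)

text \<open>Adding the unit shift of this function to itself leaves 2F(x) + 2F(m-x) - 2 = 0 for the
  distribution function F = \<open>irwin_hall_cdf m\<close>, which explains the reflected term and
  the -1. The bound J only has to be so large that the truncation errors vanish.\<close>

definition eta :: "nat \<Rightarrow> nat \<Rightarrow> real \<Rightarrow> real" where
  "eta J m x = alternating_sum J (irwin_hall_cdf m) x + alternating_sum J (irwin_hall_cdf m) (real m - 1 - x) - 1"

lemma eta_antiperiodic: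
  assumes m: "1 \<le> m" and x: "x \<le> real J + 1" "real m - x \<le> real J + 1"
  shows "eta J m x = - eta J m (x - 1)"
proof -
  have 1: "alternating_sum J (irwin_hall_cdf m) x + alternating_sum J (irwin_hall_cdf m) (x - 1) = 2 * irwin_hall_cdf m x"
    unfolding alternating_sum_add_shift using x m by (simp add: irwin_hall_cdf_nonpos)
  have "alternating_sum J (irwin_hall_cdf m) (real m - x) + alternating_sum J (irwin_hall_cdf m) (real m - x - 1) = 2 * irwin_hall_cdf m (real m - x)"
    unfolding alternating_sum_add_shift using x m by (simp add: irwin_hall_cdf_nonpos)
  moreover have "real m - 1 - x = real m - x - 1" "real m - 1 - (x - 1) = real m - x" by simp_all
  ultimately show ?thesis using 1 irwin_hall_cdf_reflect[OF m, of x] unfolding eta_def by (simp only:)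
qed

text \<open>Since F_(m+2)' is the difference of F_(m+1), the derivative is \<open>eta\<close> one
  level down minus its unit shift. Antiperiodicity turns the difference into a double.\<close>

lemma eta_deriv:
  assumes x: "0 \<le> x" "x \<le> 1" and J: "m \<le> J"
  shows "(eta J (Suc (Suc m)) has_real_derivative 2 * eta J (Suc m) x) (at x)"
proof -
  let ?m = "Suc (Suc m)"
  have d: "(alternating_sum J (irwin_hall_cdf ?m) has_real_derivative alternating_sum J (irwin_hall_cdf (Suc m)) y - alternating_sum J (irwin_hall_cdf (Suc m)) (y - 1)) (at y)" for y
    using alternating_sum_deriv[OF irwin_hall_cdf_deriv'[of m], of J y] unfolding alternating_sum_diff .
  have d2: "((\<lambda>y. alternating_sum J (irwin_hall_cdf ?m) (real ?m - 1 - y)) has_real_derivative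
      (alternating_sum J (irwin_hall_cdf (Suc m)) (real ?m - 1 - x) - alternating_sum J (irwin_hall_cdf (Suc m)) (real ?m - 1 - x - 1)) * (0 - 1)) (at x)"
    by (rule DERIV_chain2[OF d]) (auto intro!: derivative_eq_intros)
  have "(eta J ?m has_real_derivative
     (alternating_sum J (irwin_hall_cdf (Suc m)) x - alternating_sum J (irwin_hall_cdf (Suc m)) (x - 1)) +
     (alternating_sum J (irwin_hall_cdf (Suc m)) (real ?m - 1 - x) - alternating_sum J (irwin_hall_cdf (Suc m)) (real ?m - 1 - x - 1)) * (0 - 1) - 0) (at x)"
    unfolding eta_def[abs_def] by (intro DERIV_diff DERIV_add d d2 DERIV_const)
  moreover have "(alternating_sum J (irwin_hall_cdf (Suc m)) x - alternating_sum J (irwin_hall_cdf (Suc m)) (x - 1)) +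
     (alternating_sum J (irwin_hall_cdf (Suc m)) (real ?m - 1 - x) - alternating_sum J (irwin_hall_cdf (Suc m)) (real ?m - 1 - x - 1)) * (0 - 1) - 0
     = eta J (Suc m) x - eta J (Suc m) (x - 1)"
    by (simp add: eta_def algebra_simps)
  moreover have "eta J (Suc m) x = - eta J (Suc m) (x - 1)"
    by (rule eta_antiperiodic) (use x J in auto)
  ultimately show ?thesis by simp
qed

definition cosh_fps :: "real fps" where
  "cosh_fps = fps_const (1/2) * (fps_exp 1 + fps_exp (-1))"

definition sech_coeff :: "nat \<Rightarrow> real" where "sech_coeff m = fps_nth (inverse cosh_fps) m"

text \<open>The generating function is e^((2y-1)t) / cosh t = 2e^(2yt) / (e^(2t) + 1), so this is
  2^m E_m(y) / m! for the classical Euler polynomial E_m.\<close>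

definition euler_poly :: "nat \<Rightarrow> real \<Rightarrow> real" where
  "euler_poly m y = (\<Sum>i\<le>m. sech_coeff (m - i) * (2 * y - 1) ^ i / fact i)"

lemma cosh_fps_inverse: "cosh_fps * inverse cosh_fps = 1"
  by (rule inverse_mult_eq_1') (simp add: cosh_fps_def)

lemma euler_poly_ends: "euler_poly m 0 + euler_poly m 1 = (if m = 0 then 2 else 0)"
proof -
  have "euler_poly m 0 + euler_poly m 1 = 2 * fps_nth (cosh_fps * inverse cosh_fps) m"
    unfolding fps_mult_nth euler_poly_def sum.distrib[symmetric] sum_distrib_left atLeast0AtMost
    by (intro sum.cong refl) (simp add: sech_coeff_def cosh_fps_def field_simps)
  then show ?thesis unfolding cosh_fps_inverse by simp
qed

lemma euler_poly_0: "euler_poly 0 y = 1"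
  using euler_poly_ends[of 0] by (simp add: euler_poly_def)

lemma euler_poly_half: "euler_poly m (1/2) = sech_coeff m"
proof -
  have "euler_poly m (1/2) = (\<Sum>i\<le>m. if i = 0 then sech_coeff m else 0)"
    unfolding euler_poly_def by (intro sum.cong) auto
  then show ?thesis by simp
qed

lemma euler_poly_deriv: "(euler_poly (Suc m) has_real_derivative 2 * euler_poly m y) (at y)"
proof -
  have e: "euler_poly (Suc m) = (\<lambda>y. sech_coeff (Suc m) + (\<Sum>i\<le>m. sech_coeff (m - i) * ((2 * y - 1) ^ Suc i / fact (Suc i))))"
    unfolding euler_poly_def by (subst sum.atMost_Suc_shift) (simp del: power_Suc fact_Suc)
  have "((\<lambda>y. (2 * y - 1) ^ Suc i / fact (Suc i)) has_real_derivative ((2 * y - 1) ^ i / fact i) * 2) (at y)" for i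
    by (rule DERIV_chain2[OF monomial_deriv]) (auto intro!: derivative_eq_intros)
  then have "(euler_poly (Suc m) has_real_derivative 0 + (\<Sum>i\<le>m. sech_coeff (m - i) * (((2 * y - 1) ^ i / fact i) * 2))) (at y)"
    unfolding e by (intro DERIV_add DERIV_const DERIV_sum DERIV_cmult)
  moreover have "0 + (\<Sum>i\<le>m. sech_coeff (m - i) * (((2 * y - 1) ^ i / fact i) * 2)) = 2 * euler_poly m y"
    by (simp add: euler_poly_def sum_distrib_left mult_ac)
  ultimately show ?thesis by simp
qed

text \<open>Both families satisfy the same differential recursion on [0,1], and g(0) + g(1) = 0
  fixes the constant of integration.\<close>

lemma eta_euler_poly: "m \<le> J \<Longrightarrow> 0 \<le> y \<Longrightarrow> y \<le> 1 \<Longrightarrow> eta J (Suc m) y = euler_poly (Suc m) y"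
proof (induction m arbitrary: y)
  case 0
  have z: "alternating_sum J (irwin_hall_cdf 1) x = 2 * irwin_hall_cdf 1 x" if "x \<le> 1" for x
  proof -
    have "(\<Sum>j\<le>J. (-1) ^ j * irwin_hall_cdf 1 (x - real j)) = (\<Sum>j\<le>J. if j = 0 then irwin_hall_cdf 1 x else 0)"
      using that by (intro sum.cong) (auto simp: irwin_hall_cdf_nonpos)
    then show ?thesis by (simp add: alternating_sum_def)
  qed
  have c1: "irwin_hall_cdf 1 x = max 0 x - max 0 (x - 1)" for x by (simp add: irwin_hall_cdf_def backward_diff_def truncated_power_def)
  have "eta J (Suc 0) y = 2 * y - 1"
    using 0 z[of y] z[of "-y"] by (simp add: eta_def c1[simplified])
  moreover have "euler_poly (Suc 0) y = sech_coeff 1 + sech_coeff 0 * (2 * y - 1)" by (simp add: euler_poly_def)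
  moreover have "sech_coeff 0 = 1" using euler_poly_half[of 0] euler_poly_0 by simp
  moreover have "sech_coeff 1 = 0" using euler_poly_ends[of 1] by (simp add: euler_poly_def)
  ultimately show ?case by simp
next
  case (Suc m)
  let ?g = "\<lambda>y. eta J (Suc (Suc m)) y - euler_poly (Suc (Suc m)) y"
  have d: "(?g has_real_derivative 0) (at x)" if "0 \<le> x" "x \<le> 1" for x
    using DERIV_diff[OF eta_deriv[of x m J] euler_poly_deriv[of "Suc m" x]] Suc.IH[of x] Suc.prems that by simp
  have const: "?g x = ?g 0" if "0 \<le> x" "x \<le> 1" for x
  proof (cases "x = 0")
    case False
    show ?thesis
      by (rule DERIV_isconst_end[where f = "?g" and a = 0 and b = x])
         (use False that in \<open>auto intro!: continuous_at_imp_continuous_on DERIV_isCont[OF d] d\<close>)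
  qed simp
  have "eta J (Suc (Suc m)) 1 = - eta J (Suc (Suc m)) (1 - 1)"
    by (rule eta_antiperiodic) (use Suc.prems in auto)
  then have "?g 0 + ?g 1 = 0" using euler_poly_ends[of "Suc (Suc m)"] by simp
  then have "?g 0 = 0" using const[of 1] by simp
  then show ?case using const[OF Suc.prems(2,3)] by simp
qed

lemma eta_shift:
  assumes m: "1 \<le> m" and x: "0 \<le> x" "x + real k \<le> real J + 1" and J: "m \<le> J"
  shows "eta J m (x + real k) = (-1) ^ k * eta J m x"
  using x(2)
proof (induction k)
  case (Suc k)
  have "eta J m (x + real (Suc k)) = - eta J m (x + real (Suc k) - 1)"
    by (rule eta_antiperiodic[OF m]) (use Suc.prems x J in auto)
  then show ?case using Suc by simp
qed simp

text \<open>Even indices come from sec t = sech(it), odd ones from e^(-it) sec t = 1 - i tan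
  t.\<close>

definition sec_tan :: "nat \<Rightarrow> real" where
  "sec_tan m = (if even m then (-1) ^ (m div 2) * sech_coeff m else (-1) ^ ((m + 1) div 2) * euler_poly m 0)"

text \<open>Antiperiodicity moves (m+1)/2 by integers to 1/2 for even m and to 0 for odd m.\<close>

lemma eta_middle:
  assumes m: "1 \<le> m" and J: "m \<le> J"
  shows "eta J m ((real m + 1) / 2) = sec_tan m"
proof (cases "even m")
  case True
  then obtain k where k: "m = 2 * k" by blast
  have "(real m + 1) / 2 = 1/2 + real k" by (simp add: k add_divide_distrib)
  then have "eta J m ((real m + 1) / 2) = (-1) ^ k * eta J m (1/2)"
    using eta_shift[OF m, of "1/2" k J] J k by (simp only:)
  moreover have "eta J m (1/2) = sech_coeff m"
    using eta_euler_poly[of "m - 1" J "1/2"] m J euler_poly_half[of m] by simp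
  ultimately show ?thesis using True by (simp add: sec_tan_def k)
next
  case False
  then obtain k where k: "m = 2 * k + 1" by (elim oddE)
  have "(real m + 1) / 2 = 0 + real (k + 1)" by (simp add: k field_simps)
  then have "eta J m ((real m + 1) / 2) = (-1) ^ (k + 1) * eta J m 0"
    using eta_shift[OF m, of 0 "k + 1" J] J k by (simp only:)
  moreover have "eta J m 0 = euler_poly m 0"
    using eta_euler_poly[of "m - 1" J 0] m J by simp
  ultimately show ?thesis using False by (simp add: sec_tan_def k)
qed

text \<open>The solution of L(x) = 2B(x) + L(x-2) that vanishes for x <= 0; this is the recursion of
  f to the left of the window. The cut-off at n+2 is harmless up to x = 2n+6.\<close>

definition left_density :: "nat \<Rightarrow> real \<Rightarrow> real" where
  "left_density n x = (\<Sum>k\<le>n+2. 2 * bspline_deriv n (x - 2 * real k))"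

lemma sum_even_odd: "(\<Sum>j\<le>2*M+1. (-1) ^ j * f j) = (\<Sum>k\<le>M. f (2 * k) - (f (2 * k + 1) :: real))"
  by (induction M) (simp_all add: algebra_simps)

text \<open>With S the unit shift, B is 1-S applied to the difference of order n+1. Summing
  S^(2k)(1-S) over k gives the alternating sum of the S^j, with last index 2(n+2)+1.\<close>

lemma left_density_alternating_sum: "left_density n x = alternating_sum (2 * n + 5) (backward_diff (n + 1) (truncated_power n)) x"
proof -
  have "left_density n x = 2 * (\<Sum>k\<le>n+2. backward_diff (n + 1) (truncated_power n) (x - real (2 * k)) - backward_diff (n + 1) (truncated_power n) (x - real (2 * k + 1)))"
    unfolding left_density_def sum_distrib_left bspline_deriv_backward_diff
    using backward_diff_Suc[of "n + 1" "truncated_power n"] by (intro sum.cong refl) (simp add: diff_diff_eq add.commute)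
  also have "\<dots> = 2 * (\<Sum>j\<le>2 * (n + 2) + 1. (-1) ^ j * backward_diff (n + 1) (truncated_power n) (x - real j))"
    unfolding sum_even_odd ..
  also have "2 * (n + 2) + 1 = 2 * n + 5" by simp
  finally show ?thesis by (simp add: alternating_sum_def)
qed

lemma left_density_nonpos: "1 \<le> n \<Longrightarrow> x \<le> 0 \<Longrightarrow> left_density n x = 0"
  unfolding left_density_def by (intro sum.neutral) (simp add: bspline_deriv_backward_diff backward_diff_truncated_power_nonpos)

lemma bspline_deriv_nonpos: "1 \<le> n \<Longrightarrow> x \<le> 0 \<Longrightarrow> bspline_deriv n x = 0"
  unfolding bspline_deriv_backward_diff by (rule backward_diff_truncated_power_nonpos)

lemma left_density_shift:
  assumes n: "1 \<le> n" and x: "x \<le> 2 * real n + 6"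
  shows "left_density n x = 2 * bspline_deriv n x + left_density n (x - 2)"
proof -
  have s: "x - 2 * real (Suc k) = x - 2 - 2 * real k" for k by simp
  have "bspline_deriv n (x - 2 * real (Suc (n + 2))) = 0" using n x by (intro bspline_deriv_nonpos) auto
  then have "left_density n x = (\<Sum>k\<le>Suc (n + 2). 2 * bspline_deriv n (x - 2 * real k))" unfolding left_density_def by simp
  also have "\<dots> = 2 * bspline_deriv n x + left_density n (x - 2)"
    unfolding left_density_def sum.atMost_Suc_shift s by simp
  finally show ?thesis .
qed

text \<open>B is antisymmetric about (n+2)/2 and vanishes there, so the two branches of
  \<open>limit_density\<close> meet.\<close>

lemma left_density_middle:
  assumes n: "1 \<le> n" and x: "x * 2 = real n + 2"
  shows "left_density n x = left_density n (real n - x)"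
proof -
  have e: "real n + 2 - x = x" "x - 2 = real n - x" using x by simp_all
  have "bspline_deriv n x = 0" using bspline_deriv_reflect[OF n, of x] unfolding e by simp
  then show ?thesis using left_density_shift[OF n, of x] x unfolding e by simp
qed

lemma continuous_bspline_deriv: "continuous_on S (bspline_deriv n)"
  unfolding bspline_deriv_def[abs_def] by (intro continuous_intros) auto

lemma continuous_left_density: "continuous_on S (left_density n)"
  unfolding left_density_def[abs_def]
  by (intro continuous_intros continuous_on_compose2[OF continuous_bspline_deriv[of UNIV]]) auto

definition left_density_primitive :: "nat \<Rightarrow> real \<Rightarrow> real" where "left_density_primitive n = alternating_sum (2 * n + 5) (irwin_hall_cdf (n + 1))"

lemma left_density_primitive_deriv: "1 \<le> n \<Longrightarrow> (left_density_primitive n has_real_derivative left_density n x) (at x)"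
  unfolding left_density_primitive_def left_density_alternating_sum
proof (rule alternating_sum_deriv)
  fix y assume "1 \<le> n"
  then obtain m where "n = Suc m" by (cases n) auto
  then show "(irwin_hall_cdf (n + 1) has_real_derivative backward_diff (n + 1) (truncated_power n) y) (at y)"
    using irwin_hall_cdf_deriv[of m y] by simp
qed

lemma left_density_primitive_0: "left_density_primitive n 0 = 0"
  unfolding left_density_primitive_def alternating_sum_def by (simp add: irwin_hall_cdf_nonpos)

definition limit_density :: "nat \<Rightarrow> real \<Rightarrow> real" where
  "limit_density n x = (if x \<le> (real n + 2) / 2 then left_density n x else left_density n (real n - x))"

text \<open>For the primitive P with P(0) = 0 the two halves contribute P(x) and P(n-x) at x =
  (n+2)/2. With m = n+1 this sum is 1 + \<open>eta\<close> at (m+1)/2.\<close>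

lemma limit_density_integral:
  assumes n: "3 \<le> n"
  shows "(limit_density n has_integral (1 + sec_tan (n + 1))) {0..}"
proof -
  let ?N = "(real n + 2) / 2"
  have 1: "(left_density n has_integral (left_density_primitive n ?N - left_density_primitive n 0)) {0..?N}"
    by (rule fundamental_theorem_of_calculus)
       (use n in \<open>auto intro!: has_field_derivative_at_within left_density_primitive_deriv simp flip: has_real_derivative_iff_has_vector_derivative\<close>)
  have "((\<lambda>x. - left_density_primitive n (real n - x)) has_real_derivative - (left_density n (real n - x) * (0 - 1))) (at x)" for x
    by (rule DERIV_minus, rule DERIV_chain2[OF left_density_primitive_deriv]) (use n in \<open>auto intro!: derivative_eq_intros\<close>)
  then have d: "((\<lambda>x. - left_density_primitive n (real n - x)) has_real_derivative left_density n (real n - x)) (at x within S)" for x S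
    by (simp add: has_field_derivative_at_within)
  have 2: "((\<lambda>x. left_density n (real n - x)) has_integral (- left_density_primitive n (real n - real n) - - left_density_primitive n (real n - ?N))) {?N..real n}"
    by (rule fundamental_theorem_of_calculus)
       (use n d in \<open>auto simp flip: has_real_derivative_iff_has_vector_derivative\<close>)
  have a: "(limit_density n has_integral (left_density_primitive n ?N - left_density_primitive n 0)) {0..?N}"
    by (rule has_integral_eq[OF _ 1]) (simp add: limit_density_def)
  have "left_density n ?N = left_density n (real n - ?N)" using n by (intro left_density_middle) auto
  then have b: "(limit_density n has_integral (- left_density_primitive n (real n - real n) - - left_density_primitive n (real n - ?N))) {?N..real n}"
    by (intro has_integral_eq[OF _ 2]) (auto simp: limit_density_def)
  have "(limit_density n has_integral (left_density_primitive n ?N - left_density_primitive n 0 + (- left_density_primitive n (real n - real n) - - left_density_primitive n (real n - ?N)))) {0..real n}"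
    by (rule has_integral_combine[OF _ _ a b]) (use n in auto)
  moreover have "left_density_primitive n ?N - left_density_primitive n 0 + (- left_density_primitive n (real n - real n) - - left_density_primitive n (real n - ?N)) = 1 + sec_tan (n + 1)"
  proof -
    have "eta (2 * n + 5) (n + 1) ((real (n + 1) + 1) / 2) = sec_tan (n + 1)" by (rule eta_middle) auto
    moreover have "(real (n + 1) + 1) / 2 = ?N" "real (n + 1) - 1 - ?N = real n - ?N" by simp_all
    ultimately have "left_density_primitive n ?N + left_density_primitive n (real n - ?N) - 1 = sec_tan (n + 1)"
      unfolding eta_def left_density_primitive_def by (simp only:)
    then show ?thesis by (simp add: left_density_primitive_0)
  qed
  ultimately have "(limit_density n has_integral (1 + sec_tan (n + 1))) {0..real n}" by simp
  then show ?thesis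
    by (rule has_integral_on_superset) (use n in \<open>auto simp: limit_density_def left_density_nonpos not_le\<close>)
qed

section \<open>The coefficients of sec + tan\<close>

text \<open>The origin is excluded so that the induction may divide the series by x.\<close>

lemma power_series_eq_0:
  fixes c :: "nat \<Rightarrow> real"
  assumes "0 < s" and "\<And>x. x \<noteq> 0 \<Longrightarrow> \<bar>x\<bar> < s \<Longrightarrow> (\<lambda>i. c i * x ^ i) sums 0"
  shows "c k = 0"
  using assms(2)
proof (induction k arbitrary: c)
  case 0
  have "((\<lambda>x::real. 0 :: real) \<longlongrightarrow> c 0) (at 0)"
    by (rule powser_limit_0_strong[OF assms(1)]) (use 0 in auto)
  then show ?case using LIM_const_eq by force
next
  case (Suc k)
  have "((\<lambda>x::real. 0 :: real) \<longlongrightarrow> c 0) (at 0)"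
    by (rule powser_limit_0_strong[OF assms(1)]) (use Suc.prems in auto)
  then have c0: "c 0 = 0" using LIM_const_eq by force
  have "(\<lambda>i. c (Suc i) * x ^ i) sums 0" if x: "x \<noteq> 0" "\<bar>x\<bar> < s" for x
  proof -
    have "(\<lambda>i. c (Suc i) * x ^ Suc i) sums 0"
      using Suc.prems[OF x] sums_Suc_iff[of "\<lambda>i. c i * x ^ i" 0] c0 by simp
    then have "(\<lambda>i. c (Suc i) * x ^ Suc i / x) sums (0 / x)" by (rule sums_divide)
    then show ?thesis using x by simp
  qed
  from Suc.IH[OF this] show ?case .
qed

definition sec_fps :: "complex fps" where "sec_fps = Abs_fps (\<lambda>m. \<i> ^ m * of_real (sech_coeff m))"

definition euler_fps :: "complex fps" where "euler_fps = Abs_fps (\<lambda>m. \<i> ^ m * of_real (euler_poly m 0))"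

lemma fps_cos_nth_cosh: "fps_nth (fps_cos 1 :: complex fps) m = \<i> ^ m * of_real (fps_nth cosh_fps m)"
proof (cases "even m")
  case True
  then obtain k where k: "m = 2 * k" by blast
  show ?thesis by (simp add: k fps_cos_def cosh_fps_def power_mult)
qed (simp add: fps_cos_def cosh_fps_def)

lemma sec_fps_cos: "sec_fps * fps_cos 1 = 1"
proof (rule fps_ext)
  fix m
  have "fps_nth (sec_fps * fps_cos 1) m
      = (\<Sum>i=0..m. \<i> ^ m * of_real (fps_nth (inverse cosh_fps) i * fps_nth cosh_fps (m - i)))"
    unfolding fps_mult_nth fps_cos_nth_cosh sec_fps_def
  proof (rule sum.cong[OF refl])
    fix i assume "i \<in> {0..m}"
    then have "\<i> ^ m = \<i> ^ i * \<i> ^ (m - i)" by (simp flip: power_add)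
    then show "fps_nth (Abs_fps (\<lambda>m. \<i> ^ m * of_real (sech_coeff m))) i * (\<i> ^ (m - i) * of_real (fps_nth cosh_fps (m - i)))
        = \<i> ^ m * of_real (fps_nth (inverse cosh_fps) i * fps_nth cosh_fps (m - i))"
      by (simp add: sech_coeff_def)
  qed
  also have "\<dots> = \<i> ^ m * of_real (fps_nth (inverse cosh_fps * cosh_fps) m)"
    unfolding fps_mult_nth by (simp add: sum_distrib_left)
  also have "inverse cosh_fps * cosh_fps = 1" using cosh_fps_inverse by (simp only: mult.commute)
  also have "\<i> ^ m * of_real (fps_nth 1 m) = fps_nth 1 m" by simp
  finally show "fps_nth (sec_fps * fps_cos 1) m = fps_nth 1 m" .
qed

text \<open>The numbers \<open>euler_poly m 0\<close> are the coefficients of e^(-t) / cosh t;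
  replacing t by it gives e^(-it) sec t.\<close>

lemma euler_fps_eq: "euler_fps = 1 - fps_const \<i> * (sec_fps * fps_sin 1)"
proof -
  have "euler_fps = fps_exp (- \<i>) * sec_fps"
  proof (rule fps_ext)
    fix m
    have "fps_nth euler_fps m = (\<Sum>i=0..m. \<i> ^ m * of_real (sech_coeff (m - i) * (-1) ^ i / fact i))"
      by (simp add: euler_fps_def euler_poly_def sum_distrib_left atLeast0AtMost)
    also have "\<dots> = fps_nth (fps_exp (- \<i>) * sec_fps) m"
      unfolding fps_mult_nth sec_fps_def
    proof (rule sum.cong[OF refl])
      fix i assume "i \<in> {0..m}"
      then have m: "\<i> ^ m = \<i> ^ i * \<i> ^ (m - i)" by (simp flip: power_add)
      have "(- \<i>) ^ i = (-1) ^ i * \<i> ^ i" by (rule power_minus)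
      then show "\<i> ^ m * of_real (sech_coeff (m - i) * (-1) ^ i / fact i) = fps_nth (fps_exp (- \<i>)) i * fps_nth (Abs_fps (\<lambda>m. \<i> ^ m * of_real (sech_coeff m))) (m - i)"
        using m by (simp add: field_simps)
    qed
    finally show "fps_nth euler_fps m = fps_nth (fps_exp (- \<i>) * sec_fps) m" .
  qed
  also have "fps_exp (- \<i>) = fps_cos 1 - fps_const \<i> * fps_sin 1"
    using fps_exp_minus_ii_sin_cos[of 1] by simp
  also have "(fps_cos 1 - fps_const \<i> * fps_sin 1) * sec_fps = 1 - fps_const \<i> * (sec_fps * fps_sin 1)"
    unfolding left_diff_distrib using sec_fps_cos by (simp only: mult_ac)
  finally show ?thesis .
qed

lemma cos_nonzero_ball: "z \<in> ball 0 (pi / 2) \<Longrightarrow> cos z \<noteq> (0 :: complex)"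
proof
  assume z: "z \<in> ball 0 (pi / 2)" and "cos z = 0"
  then obtain k where "z = of_int k * of_real pi + of_real pi / 2" using cos_eq_0[of z] by auto
  then have "z = of_real ((of_int k + 1/2) * pi)" by (simp add: distrib_right)
  then have "norm z = \<bar>of_int k + 1/2\<bar> * pi" by (simp only: norm_of_real abs_mult) simp
  moreover have "\<bar>of_int k + 1/2\<bar> \<ge> (1/2 :: real)" by (cases "k \<ge> 0") linarith+
  then have "\<bar>of_int k + 1/2\<bar> * pi \<ge> 1/2 * pi" by (intro mult_right_mono) auto
  ultimately show False using z by simp
qed

definition sec_tan_fps :: "complex fps" where "sec_tan_fps = fps_expansion (\<lambda>z. (1 + sin z) / cos z) 0"

lemma sec_tan_holomorphic: "(\<lambda>z. (1 + sin z) / cos z) holomorphic_on ball 0 (pi / 2)"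
  by (rule holomorphic_on_divide[OF _ _ cos_nonzero_ball]) (auto intro!: holomorphic_intros)

text \<open>Multiplying by cos reduces the expansion to the known one of 1 + sin; the formal inverse
  \<open>sec_fps\<close> of cos then undoes the multiplication.\<close>

lemma sec_tan_fps_eq: "sec_tan_fps = sec_fps + fps_const \<i> * (euler_fps - 1)"
proof -
  have e: "(\<lambda>z::complex. (1 + sin z) / cos z) has_fps_expansion sec_tan_fps"
    unfolding sec_tan_fps_def
    by (rule has_fps_expansion_fps_expansion[OF open_ball _ sec_tan_holomorphic]) simp
  have h: "(\<lambda>z. cos z * ((1 + sin z) / cos z)) has_fps_expansion fps_cos 1 * sec_tan_fps"
    by (intro has_fps_expansion_mult has_fps_expansion_cos' e)
  have "\<forall>\<^sub>F z in nhds 0. z \<in> ball 0 (pi / 2 :: real)"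
    by (rule eventually_nhds_in_open) auto
  then have "\<forall>\<^sub>F z in nhds 0. cos z * ((1 + sin z) / cos z) = 1 + sin (z :: complex)"
  proof eventually_elim
    case (elim z)
    then show ?case using cos_nonzero_ball[OF elim] by simp
  qed
  then have "(\<lambda>z::complex. 1 + sin z) has_fps_expansion fps_cos 1 * sec_tan_fps"
    by (rule has_fps_expansion_cong[THEN iffD1, OF _ refl h])
  moreover have "(\<lambda>z::complex. 1 + sin z) has_fps_expansion 1 + fps_sin 1"
    by (intro has_fps_expansion_add has_fps_expansion_1 has_fps_expansion_sin')
  ultimately have "fps_cos 1 * sec_tan_fps = 1 + fps_sin 1" by (rule fps_expansion_unique_complex)
  then have "sec_fps * fps_cos 1 * sec_tan_fps = sec_fps * (1 + fps_sin 1)" by (simp only: mult.assoc)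
  then have "sec_tan_fps = sec_fps + sec_fps * fps_sin 1" unfolding sec_fps_cos by (simp add: distrib_left)
  moreover have "fps_const \<i> * (fps_const \<i> * g) = - g" for g :: "complex fps"
    by (simp add: fps_eq_iff mult.assoc[symmetric])
  ultimately show ?thesis unfolding euler_fps_eq by simp
qed

lemma Re_sec_tan_fps: "1 \<le> m \<Longrightarrow> Re (fps_nth sec_tan_fps m) = sec_tan m"
proof -
  assume m: "1 \<le> m"
  have e: "fps_nth sec_tan_fps m = \<i> ^ m * of_real (sech_coeff m) + \<i> * (\<i> ^ m * of_real (euler_poly m 0))"
    unfolding sec_tan_fps_eq using m by (simp add: sec_fps_def euler_fps_def)
  show ?thesis
  proof (cases "even m")
    case True
    then obtain k where k: "m = 2 * k" by blast
    have "\<i> ^ m = of_real ((-1) ^ k)" by (simp add: k power_mult)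
    then show ?thesis unfolding e using True by (simp add: sec_tan_def k)
  next
    case False
    then obtain k where k: "m = 2 * k + 1" by (elim oddE)
    have "\<i> ^ m = \<i> * of_real ((-1) ^ k)" by (simp add: k power_mult)
    then show ?thesis unfolding e using False by (simp add: sec_tan_def k)
  qed
qed

text \<open>Holomorphy on the disc of radius pi/2 supplies convergence on the whole interval; taking
  real parts returns to the real series.\<close>

lemma sec_tan_sums:
  assumes x: "\<bar>x\<bar> < pi / 2"
  shows "(\<lambda>i. sec_tan (Suc i) * x ^ Suc i) sums (1 / cos x + tan x - 1)"
proof -
  have "(\<lambda>i. fps_nth sec_tan_fps i * of_real x ^ i) sums ((1 + sin (of_real x)) / cos (of_real x))"
    using holomorphic_power_series[OF sec_tan_holomorphic, of "of_real x"] x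
    by (simp add: sec_tan_fps_def fps_expansion_def)
  then have "(\<lambda>i. Re (fps_nth sec_tan_fps i * of_real x ^ i)) sums Re ((1 + sin (of_real x)) / cos (of_real x))"
    by (rule sums_Re)
  moreover have "(1 + sin (of_real x)) / cos (of_real x) = complex_of_real (1 / cos x + tan x)"
    by (simp add: sin_of_real cos_of_real tan_def add_divide_distrib)
  moreover have "Re (c * of_real x ^ i) = Re c * x ^ i" for c i
    by (simp flip: of_real_power)
  ultimately have "(\<lambda>i. Re (fps_nth sec_tan_fps i) * x ^ i) sums (1 / cos x + tan x)" by simp
  moreover have "Re (fps_nth sec_tan_fps 0) = 1" by (simp add: sec_tan_fps_def fps_expansion_def)
  ultimately have "(\<lambda>i. Re (fps_nth sec_tan_fps (Suc i)) * x ^ Suc i) sums (1 / cos x + tan x - 1)"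
    using sums_Suc_iff[of "\<lambda>i. Re (fps_nth sec_tan_fps i) * x ^ i" "1 / cos x + tan x - 1"] by simp
  then show ?thesis by (simp add: Re_sec_tan_fps)
qed

text \<open>Uniqueness of power series removes the choice operator. Only positive indices are
  determined, because the defining series starts with the coefficient at index 1.\<close>

lemma sectan_coeff_eq: "sectan_coeff (Suc k) = sec_tan (Suc k)"
proof -
  let ?P = "\<lambda>a. \<forall>x::real. \<bar>x\<bar> < pi / 2 \<longrightarrow> (\<lambda>i. a (Suc i) * x ^ Suc i) sums (1 / cos x + tan x - 1)"
  define a where "a = (SOME a. ?P a)"
  have "?P sec_tan" using sec_tan_sums by blast
  then have a: "?P a" unfolding a_def by (rule someI[where P = ?P])
  have "a (Suc k) - sec_tan (Suc k) = 0"
  proof (rule power_series_eq_0[of "pi / 2" "\<lambda>i. a (Suc i) - sec_tan (Suc i)"])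
    fix x :: real assume x: "x \<noteq> 0" "\<bar>x\<bar> < pi / 2"
    have "(\<lambda>i. a (Suc i) * x ^ Suc i - sec_tan (Suc i) * x ^ Suc i) sums
       ((1 / cos x + tan x - 1) - (1 / cos x + tan x - 1))"
      by (rule sums_diff) (use a sec_tan_sums x in blast)+
    then have "(\<lambda>i. (a (Suc i) * x ^ Suc i - sec_tan (Suc i) * x ^ Suc i) / x) sums (0 / x)"
      by (intro sums_divide) simp
    moreover have "(a (Suc i) * x ^ Suc i - sec_tan (Suc i) * x ^ Suc i) / x = (a (Suc i) - sec_tan (Suc i)) * x ^ i" for i
      using x by (simp add: field_simps)
    ultimately show "(\<lambda>i. (a (Suc i) - sec_tan (Suc i)) * x ^ i) sums 0" by simp
  qed simp
  then show ?thesis by (simp add: sectan_coeff_def a_def)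
qed

section \<open>Comparison with the limit density\<close>

lemma continuous_agree_closure:
  fixes g h :: "real \<Rightarrow> real"
  assumes "continuous_on {u..v} g" "continuous_on {u..v} h" "u < v"
    and "\<And>x. u < x \<Longrightarrow> x < v \<Longrightarrow> g x = h x" and "x \<in> {u..v}"
  shows "g x = h x"
proof -
  have c: "closure {u<..<v} = {u..v}" using \<open>u < v\<close> by simp
  have "g x - h x = 0"
    by (rule continuous_constant_on_closure[of "{u<..<v}" "\<lambda>x. g x - h x"])
       (use assms c in \<open>auto intro!: continuous_intros\<close>)
  then show ?thesis by simp
qed

lemma continuous_limit_density: "1 \<le> n \<Longrightarrow> continuous_on S (limit_density n)"
  unfolding limit_density_def[abs_def]
  by (rule continuous_on_cases_le)
     (auto intro!: continuous_on_compose2[OF continuous_left_density[of UNIV]] continuous_intros simp: left_density_middle)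

lemma limit_density_right: "1 \<le> n \<Longrightarrow> (real n + 2) / 2 \<le> x \<Longrightarrow> limit_density n x = left_density n (real n - x)"
  using left_density_middle[of n x] by (auto simp: limit_density_def)

context hk_quadric
begin

definition eps :: real where "eps = (real n - 2) / (2 * real p)"

lemma eps_bounds: "0 < eps" "eps \<le> (real n - 2) / 6"
proof -
  have "3 \<le> real p" using p3 by simp
  then show "0 < eps" "eps \<le> (real n - 2) / 6"
    using n unfolding eps_def by (simp, intro divide_left_mono) auto
qed

lemma below_window: "x < (real n + 2) / 2 - eps \<longleftrightarrow> 2 * x * real p + (real n - 2) < (real n + 2) * real p"
proof -
  have pp: "0 < real p" using p3 by simp
  then have e: "real n - 2 = 2 * eps * real p" by (simp add: eps_def)
  have "2 * x * real p + (real n - 2) < (real n + 2) * real p \<longleftrightarrow> (2 * x + 2 * eps) * real p < (real n + 2) * real p"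
    unfolding e distrib_right ..
  also have "\<dots> \<longleftrightarrow> 2 * x + 2 * eps < real n + 2" using pp by simp
  finally show ?thesis by (auto simp: field_simps)
qed

lemma continuous_f: "S \<subseteq> {0..} \<Longrightarrow> continuous_on S f"
proof -
  have "10-lipschitz_on {0..} f"
    by (rule lipschitz_onI) (auto simp: dist_real_def f_lipschitz)
  then show "S \<subseteq> {0..} \<Longrightarrow> continuous_on S f"
    by (meson continuous_on_subset lipschitz_on_continuous_on)
qed

lemma f_small:
  assumes x: "0 \<le> x" "x \<le> 2"
  shows "f x = left_density n x"
proof (rule continuous_agree_closure[of 0 2 f "left_density n"])
  fix y :: real assume y: "0 < y" "y < 2"
  have lt: "y < (real n + 2) / 2 - eps" using y eps_bounds n by (auto simp: field_simps)
  then have "f (real n + 2 - y) = 0" by (intro f_reflect_0) (use y below_window in auto)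
  moreover have "f y - f (real n + 2 - y) = 2 * bspline_deriv n y" by (rule f_reflect) (use y in auto)
  moreover have "left_density n y = 2 * bspline_deriv n y + left_density n (y - 2)" by (rule left_density_shift) (use y n in auto)
  moreover have "left_density n (y - 2) = 0" by (rule left_density_nonpos) (use y n in auto)
  ultimately show "f y = left_density n y" by simp
qed (use x in \<open>auto intro!: continuous_f continuous_left_density\<close>)

text \<open>Left of the window the two reflection identities combine to f(x) = 2B(x) + f(x-2), the
  recursion of \<open>left_density\<close>. Each induction step covers two more units.\<close>

lemma f_left_open: "0 \<le> x \<Longrightarrow> x < (real n + 2) / 2 - eps \<Longrightarrow> x \<le> 2 * real k \<Longrightarrow> f x = left_density n x"
proof (induction k arbitrary: x)
  case 0
  then show ?case by (intro f_small) auto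
next
  case (Suc k)
  show ?case
  proof (cases "x \<le> 2")
    case False
    then have x: "2 \<le> x" "x < real n + 2" using Suc.prems eps_bounds n by (auto simp: field_simps)
    have "f (real n + 2 - x) = f (x - 2)"
      by (rule f_reflect_eq) (use x Suc.prems below_window in auto)
    moreover have "f (x - 2) = left_density n (x - 2)" by (rule Suc.IH) (use x Suc.prems in auto)
    moreover have "f x - f (real n + 2 - x) = 2 * bspline_deriv n x" by (rule f_reflect) (use x in auto)
    moreover have "left_density n x = 2 * bspline_deriv n x + left_density n (x - 2)" by (rule left_density_shift) (use x n in auto)
    ultimately show ?thesis by simp
  qed (use Suc.prems f_small in auto)
qed

lemma f_left:
  assumes x: "0 \<le> x" "x \<le> (real n + 2) / 2 - eps"
  shows "f x = left_density n x"
proof (rule continuous_agree_closure[of 0 "(real n + 2) / 2 - eps" f "left_density n"])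
  fix y assume y: "0 < y" "y < (real n + 2) / 2 - eps"
  obtain k :: nat where "y \<le> real k" using real_arch_simple by blast
  then show "f y = left_density n y" using y by (intro f_left_open[of _ k]) auto
qed (use x eps_bounds n in \<open>auto intro!: continuous_f continuous_left_density simp: field_simps\<close>)

lemma f_right:
  assumes x: "(real n + 2) / 2 + eps \<le> x"
  shows "f x = left_density n (real n - x)"
proof (cases "x \<le> real n + 2")
  case True
  show ?thesis
  proof (rule continuous_agree_closure[of "(real n + 2) / 2 + eps" "real n + 2" f "\<lambda>x. left_density n (real n - x)"])
    fix y assume y: "(real n + 2) / 2 + eps < y" "y < real n + 2"
    let ?x = "real n + 2 - y"
    have x: "0 < ?x" "?x < real n + 2" "?x < (real n + 2) / 2 - eps"
      using y eps_bounds by (auto simp: field_simps)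
    show "f y = left_density n (real n - y)"
    proof (cases "?x < 2")
      case True
      then have "f (real n + 2 - ?x) = 0" by (intro f_reflect_0) (use x below_window in auto)
      moreover have "left_density n (real n - y) = 0" by (rule left_density_nonpos) (use True n in auto)
      ultimately show ?thesis by simp
    next
      case False
      then have "f (real n + 2 - ?x) = f (?x - 2)" by (intro f_reflect_eq) (use x below_window in auto)
      moreover have "f (?x - 2) = left_density n (?x - 2)" by (rule f_left) (use x False in auto)
      ultimately show ?thesis by simp
    qed
  qed (use True x eps_bounds n in \<open>auto intro!: continuous_f continuous_on_compose2[OF continuous_left_density[of UNIV]] continuous_intros simp: field_simps\<close>)
next
  case False
  then show ?thesis using f_eq_0[of x] left_density_nonpos[of n "real n - x"] n by simp
qed

text \<open>The assumption says that the half-width is below 1. It keeps x-2 left of the window,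
  where f is known, and x within the range of \<open>f_reflect_ge\<close>.\<close>

lemma f_window_aux:
  assumes np: "real n - 2 < 2 * real p"
    and x: "(real n + 2) / 2 - eps \<le> x" "x \<le> (real n + 2) / 2"
  shows "left_density n (x - 2) \<le> f (real n + 2 - x)" "2 \<le> x"
proof -
  have n': "3 \<le> real n" using n by simp
  have "eps < 1" using np p3 by (simp add: eps_def divide_less_eq)
  show x2: "2 \<le> x" using x eps_bounds n' by (simp add: field_simps)
  have "2 * (x - 2) * real p \<le> (real n - 2) * real p" using x by (intro mult_right_mono) auto
  then have "2 * (x - 2) * real p + (real n - 2) < real n * real p"
    using np by (simp add: algebra_simps)
  then have "f (x - 2) \<le> f (real n + 2 - x)" by (intro f_reflect_ge) (use x2 x n' in auto)
  moreover have "f (x - 2) = left_density n (x - 2)"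
    by (rule f_left) (use x x2 \<open>eps < 1\<close> n' in \<open>auto simp: field_simps\<close>)
  ultimately show "left_density n (x - 2) \<le> f (real n + 2 - x)" by simp
qed

lemma f_window:
  assumes np: "real n - 2 < 2 * real p"
    and x: "(real n + 2) / 2 - eps \<le> x" "x \<le> (real n + 2) / 2 + eps"
  shows "limit_density n x \<le> f x"
proof (cases "x \<le> (real n + 2) / 2")
  case True
  note w = f_window_aux[OF np x(1) True]
  have "f x - f (real n + 2 - x) = 2 * bspline_deriv n x" by (rule f_reflect) (use w True n in auto)
  moreover have "left_density n x = 2 * bspline_deriv n x + left_density n (x - 2)" by (rule left_density_shift) (use True n in auto)
  ultimately show ?thesis using w True by (simp add: limit_density_def)
next
  case False
  have "left_density n (real n + 2 - x - 2) \<le> f (real n + 2 - (real n + 2 - x))"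
    by (rule f_window_aux[OF np]) (use x False in \<open>auto simp: field_simps\<close>)
  then show ?thesis using False by (simp add: limit_density_def)
qed

lemma f_eq_limit_density:
  assumes "0 \<le> x" "x \<le> (real n + 2) / 2 - eps \<or> (real n + 2) / 2 + eps \<le> x"
  shows "f x = limit_density n x"
  using assms(2)
proof
  assume l: "x \<le> (real n + 2) / 2 - eps"
  then have "x \<le> (real n + 2) / 2" using eps_bounds(1) by linarith
  then show ?thesis using f_left[OF assms(1) l] by (simp add: limit_density_def)
next
  assume r: "(real n + 2) / 2 + eps \<le> x"
  then have "(real n + 2) / 2 \<le> x" using eps_bounds(1) by linarith
  then show ?thesis using f_right[OF r] limit_density_right[of n x] n by simp
qed

end

text \<open>\<open>y p\<close> is a point closest to x where the density for p is known to equal the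
  limit density. It tends to x, and the Lipschitz constant common to all p bounds the error at x by
  10 |x - y p|.\<close>

lemma hk_quadric_limit:
  assumes n: "3 \<le> n" and x: "0 \<le> x"
  shows "((\<lambda>p. hk_quadric.f p n x) \<longlongrightarrow> limit_density n x) (inf sequentially (principal {p. prime p \<and> odd p}))"
    (is "(_ \<longlongrightarrow> _) ?F")
proof -
  let ?N = "(real n + 2) / 2"
  let ?e = "\<lambda>p::nat. (real n - 2) / (2 * real p)"
  define y where "y p = (if x \<le> ?N then min x (?N - ?e p) else max x (?N + ?e p))" for p :: nat
  have "(\<lambda>p. (real n - 2) / 2 * (1 / real p)) \<longlonglongrightarrow> (real n - 2) / 2 * 0"
    by (intro tendsto_mult tendsto_const lim_1_over_n)
  then have e: "?e \<longlonglongrightarrow> 0" by simp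
  have yx: "y \<longlonglongrightarrow> x"
  proof (cases "x \<le> ?N")
    case True
    have "(\<lambda>p. min x (?N - ?e p)) \<longlonglongrightarrow> min x (?N - 0)" by (intro tendsto_intros e)
    then show ?thesis using True unfolding y_def by (simp add: min_def)
  next
    case False
    have "(\<lambda>p. max x (?N + ?e p)) \<longlonglongrightarrow> max x (?N + 0)" by (intro tendsto_intros e)
    then show ?thesis using False unfolding y_def by (simp add: max_def)
  qed
  have "isCont (limit_density n) x"
    using continuous_limit_density[of n UNIV] n by (simp add: continuous_on_eq_continuous_at)
  then have "(\<lambda>p. limit_density n (y p)) \<longlonglongrightarrow> limit_density n x" using yx by (rule isCont_tendsto_compose)
  then have 1: "((\<lambda>p. limit_density n (y p)) \<longlongrightarrow> limit_density n x) ?F" by (rule tendsto_mono[OF inf_le1])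
  have "(\<lambda>p. 10 * \<bar>x - y p\<bar>) \<longlonglongrightarrow> 10 * \<bar>x - x\<bar>" by (intro tendsto_intros yx)
  then have "((\<lambda>p. 10 * \<bar>x - y p\<bar>) \<longlongrightarrow> 0) ?F" by (intro tendsto_mono[OF inf_le1]) simp
  moreover have "\<forall>\<^sub>F p in ?F. norm (hk_quadric.f p n x - limit_density n (y p)) \<le> 10 * \<bar>x - y p\<bar>"
    unfolding eventually_inf_principal
  proof (intro always_eventually allI impI)
    fix p :: nat assume "p \<in> {p. prime p \<and> odd p}"
    then interpret hk_quadric p n using n by unfold_locales auto
    have e: "?e p = eps" by (simp add: eps_def)
    have n': "3 \<le> real n" using n by simp
    have "eps \<le> ?N" using eps_bounds n' by (simp add: field_simps)
    then have y: "0 \<le> y p" "y p \<le> ?N - eps \<or> ?N + eps \<le> y p"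
      using x eps_bounds n' unfolding y_def e by (auto simp: min_def max_def)
    show "norm (f x - limit_density n (y p)) \<le> 10 * \<bar>x - y p\<bar>"
      using f_lipschitz[OF x y(1)] f_eq_limit_density[OF y] by simp
  qed
  ultimately have "((\<lambda>p. hk_quadric.f p n x - limit_density n (y p)) \<longlongrightarrow> 0) ?F"
    by (rule Lim_null_comparison[rotated])
  from tendsto_add[OF this 1] show ?thesis by simp
qed

lemma odd_primes_filter: "inf sequentially (principal {p::nat. prime p \<and> odd p}) \<noteq> bot"
proof
  assume "inf sequentially (principal {p::nat. prime p \<and> odd p}) = bot"
  then have "eventually (\<lambda>_. False) (inf sequentially (principal {p::nat. prime p \<and> odd p}))" by simp
  then obtain N where N: "\<And>p::nat. N \<le> p \<Longrightarrow> \<not> (prime p \<and> odd p)"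
    unfolding eventually_inf_principal eventually_sequentially by auto
  obtain p where p: "prime p" "max N 2 < p" using bigger_prime by blast
  then have "odd p" using prime_odd_nat by auto
  then show False using N[of p] p by auto
qed

theorem theorem1p2:
  fixes n :: nat and K :: "nat \<Rightarrow> ('a, 'b) ring_scheme"
  assumes n3: "n \<ge> 3"
    and fields: "\<And>p. Factorial_Ring.prime p \<Longrightarrow> odd p \<Longrightarrow> perfect_field_char (K p) p"
  shows "\<exists>finf :: real \<Rightarrow> real.
     (\<forall>x\<ge>0. ((\<lambda>p. hk_density (K p) p n x) \<longlongrightarrow> finf x)
                (inf sequentially (principal {p. Factorial_Ring.prime p \<and> odd p})))
   \<and> continuous_on {0..} finf
   \<and> (\<forall>x\<ge>0. finf x \<ge> 0)
   \<and> (finf has_integral (1 + sectan_coeff (n + 1))) {0..}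
   \<and> (\<forall>p. Factorial_Ring.prime p \<and> odd p \<and>
          ((odd n \<and> p \<ge> 2 * n - 4) \<or> (even n \<and> p \<ge> n - 2)) \<longrightarrow>
        (let a = (real n + 2) / 2 - (real n - 2) / (2 * real p);
             b = (real n + 2) / 2 + (real n - 2) / (2 * real p)
         in (\<forall>x\<in>{0..a}. hk_density (K p) p n x = finf x)
          \<and> (\<forall>x\<in>{a..b}. hk_density (K p) p n x \<ge> finf x)
          \<and> (\<forall>x\<ge>b. hk_density (K p) p n x = finf x)))"
proof -
  let ?S = "{p::nat. prime p \<and> odd p}"
  let ?F = "inf sequentially (principal ?S)"
  have hk: "hk_quadric p n" if "prime p" "odd p" for p
    using that n3 by unfold_locales auto
  have eq: "hk_density (K p) p n x = hk_quadric.f p n x" if "prime p" "odd p" for p x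
    using hk_quadric.hk_density_eq[OF hk[OF that] fields[OF that]] .
  have lim: "((\<lambda>p. hk_density (K p) p n x) \<longlongrightarrow> limit_density n x) ?F" if x: "0 \<le> x" for x
  proof (rule Lim_transform_eventually[OF hk_quadric_limit[OF n3 x]])
    show "\<forall>\<^sub>F p in ?F. hk_quadric.f p n x = hk_density (K p) p n x"
      unfolding eventually_inf_principal by (auto simp: eq)
  qed
  have nonneg: "0 \<le> limit_density n x" if x: "0 \<le> x" for x
  proof (rule tendsto_lowerbound[OF hk_quadric_limit[OF n3 x] _ odd_primes_filter])
    show "\<forall>\<^sub>F p in ?F. 0 \<le> hk_quadric.f p n x"
      unfolding eventually_inf_principal by (intro always_eventually allI impI hk_quadric.f_nonneg[OF hk] x) auto
  qed
  have window: "let a = (real n + 2) / 2 - (real n - 2) / (2 * real p);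
             b = (real n + 2) / 2 + (real n - 2) / (2 * real p)
         in (\<forall>x\<in>{0..a}. hk_density (K p) p n x = limit_density n x)
          \<and> (\<forall>x\<in>{a..b}. hk_density (K p) p n x \<ge> limit_density n x)
          \<and> (\<forall>x\<ge>b. hk_density (K p) p n x = limit_density n x)"
    if P: "prime p" "odd p" and big: "(odd n \<and> p \<ge> 2 * n - 4) \<or> (even n \<and> p \<ge> n - 2)" for p
  proof -
    interpret hk_quadric p n by (rule hk[OF P])
    \<comment> \<open>Both parity cases imply that the half-width (n-2)/(2p) is below 1, which is
      what \<open>f_window\<close> requires.\<close>
    have "n < 2 * p + 2" using big n3 by auto
    then have np: "real n - 2 < 2 * real p" by linarith
    have N: "0 \<le> (real n + 2) / 2 + eps" using eps_bounds by simp
    show ?thesis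
      unfolding Let_def eq[OF P] eps_def[symmetric]
      using f_eq_limit_density f_window[OF np] N by auto
  qed
  show ?thesis
    using lim nonneg continuous_limit_density[of n "{0..}"] limit_density_integral[OF n3] window n3
    by (intro exI[of _ "limit_density n"]) (simp add: sectan_coeff_eq)
qed

end
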